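(* Let $\mathbb{F}$ be an algebraically closed field of characteristic $p>3$, and let $L=H\oplus\mathbb{F}\Gamma\oplus\mathbb{F}\Theta\subseteq W(2;\underline{1})$ be the restricted Lie algebra defined in the context, with its subalgebra $L_{(0)}$. Then the restricted $L$-module $M(\lambda):=\mathrm{Ind}_{L_{(0)}}^L(V(\lambda),0)$ is irreducible for every $\lambda\in\{2,\dots,p-1\}$.
   Context: Let $\mathcal{O}(2;\underline{1})=\mathbb{F}[x,y]/(x^p,y^p)$ be the truncated polynomial algebra over $\mathbb{F}$, with partial derivatives $\partial_x,\partial_y$. $W(2;\underline{1})=\{f\partial_x+g\partial_y\mid f,g\in\mathcal{O}(2;\underline{1})\}$ is the Jacobson–Witt algebra (all derivations of $\mathcal{O}(2;\underline{1})$), a restricted Lie algebra with $D^{[p]}=D^p$, graded by $\deg x=\deg y=1$, $\deg\partial_x=\deg\partial_y=-1$; put $W(2;\underline{1})_{(n)}:=\bigoplus_{d\ge n}W(2;\underline{1})_d$. Let $\Lambda:=1-x^{p-1}y^{p-1}$ and $\mathbf{D}_\Lambda(f):=\Lambda\,(\partial_x(f)\partial_y-\partial_y(f)\partial_x)$ for $f\in\mathcal{O}(2;\underline{1})$. Put $H:=\mathrm{Im}(\mathbf{D}_\Lambda)$, $\Gamma:=x^{p-1}\partial_y$, $\Theta:=-y^{p-1}\partial_x$, and $L:=H\oplus\mathbb{F}\Gamma\oplus\mathbb{F}\Theta$. Then $L$ is a $p$-subalgebra (subalgebra closed under $[p]$) of $W(2;\underline{1})$. (For $p>3$, $H$ is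 the simple Lie algebra $H(2;\underline{1};\Phi(\tau))^{(1)}$ and $L$ is its minimal $p$-envelope in $W(2;\underline{1})$.) Put $L_{(n)}:=L\cap W(2;\underline{1})_{(n)}$ for $n\in\mathbb{Z}$; $L_{(0)}$ is a $p$-subalgebra, $L_{(1)}$ is a $p$-ideal of $L_{(0)}$, and $L_{(0)}/L_{(1)}\cong\mathfrak{sl}_2(\mathbb{F})$ as restricted Lie algebras (identified with the degree-zero, i.e. linear, vector fields spanned by $x\partial_y$, $y\partial_y-x\partial_x$, $y\partial_x$). For $\lambda\in\{0,\dots,p-1\}$, $V(\lambda)$ denotes the irreducible restricted $\mathfrak{sl}_2(\mathbb{F})$-module of highest weight $\lambda$ (so $\dim_{\mathbb{F}}V(\lambda)=\lambda+1$), and also its inflation to $L_{(0)}$ along $L_{(0)}\to L_{(0)}/L_{(1)}$. For a restricted Lie algebra $G$, $u(G,0):=U(G)/(x^p-x^{[p]}\mid x\in G)$; restricted $G$-modules are $u(G,0)$-modules; for a $p$-subalgebra $K$ and a restricted $K$-module $V$, $\mathrm{Ind}_K^G(V,0):=u(G,0)\otimes_{u(K,0)}V$. *)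

theory Defs
  imports
    "HOL-Algebra.Algebra"
    "HOL-Computational_Algebra.Computational_Algebra"
begin

section \<open>Irreducible left modules and extension of scalars\<close>

text \<open>The library locale \<^locale>\<open>module\<close> is restricted to commutative rings.  The record
  type \<^typ>\<open>('a, 'b) module\<close> is kept; its fields \<^const>\<open>monoid.mult\<close> and
  \<^const>\<open>monoid.one\<close> play no role for modules.\<close>

locale left_module = R?: ring R + M?: abelian_group M
  for R :: "('r, 'k) ring_scheme" (structure)
    and M :: "('r, 'm, 'l) module_scheme" (structure) +
  assumes smult_closed: "\<lbrakk>a \<in> carrier R; x \<in> carrier M\<rbrakk> \<Longrightarrow> a \<odot>\<^bsub>M\<^esub> x \<in> carrier M"
    and smult_l_distr: "\<lbrakk>a \<in> carrier R; b \<in> carrier R; x \<in> carrier M\<rbrakk> \<Longrightarrow>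
      (a \<oplus>\<^bsub>R\<^esub> b) \<odot>\<^bsub>M\<^esub> x = a \<odot>\<^bsub>M\<^esub> x \<oplus>\<^bsub>M\<^esub> b \<odot>\<^bsub>M\<^esub> x"
    and smult_r_distr: "\<lbrakk>a \<in> carrier R; x \<in> carrier M; y \<in> carrier M\<rbrakk> \<Longrightarrow>
      a \<odot>\<^bsub>M\<^esub> (x \<oplus>\<^bsub>M\<^esub> y) = a \<odot>\<^bsub>M\<^esub> x \<oplus>\<^bsub>M\<^esub> a \<odot>\<^bsub>M\<^esub> y"
    and smult_assoc: "\<lbrakk>a \<in> carrier R; b \<in> carrier R; x \<in> carrier M\<rbrakk> \<Longrightarrow>
      (a \<otimes>\<^bsub>R\<^esub> b) \<odot>\<^bsub>M\<^esub> x = a \<odot>\<^bsub>M\<^esub> (b \<odot>\<^bsub>M\<^esub> x)"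
    and smult_one: "x \<in> carrier M \<Longrightarrow> \<one>\<^bsub>R\<^esub> \<odot>\<^bsub>M\<^esub> x = x"

definition irreducible_module ::
    "('r, 'k) ring_scheme \<Rightarrow> ('r, 'm, 'l) module_scheme \<Rightarrow> bool" where
  "irreducible_module R M \<longleftrightarrow> left_module R M \<and> carrier M \<noteq> {\<zero>\<^bsub>M\<^esub>} \<and>
     (\<forall>N. submodule N R M \<longrightarrow> N = {\<zero>\<^bsub>M\<^esub>} \<or> N = carrier M)"

text \<open>The map induced by \<open>f\<close> from the cosets of some ideal (or subgroup) to the cosets of \<open>J\<close>;
  meaningful if \<open>J +> f r\<close> does not depend on the representative \<open>r\<close> of a coset.\<close>

definition coset_map :: "('s, 'k) ring_scheme \<Rightarrow> 's set \<Rightarrow> ('r \<Rightarrow> 's) \<Rightarrow> 'r set \<Rightarrow> 's set" where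
  "coset_map S J f C = the_elem ((\<lambda>r. J +>\<^bsub>S\<^esub> f r) ` C)"

text \<open>For a ring homomorphism \<open>\<phi> : B \<rightarrow> A\<close> and a left \<open>B\<close>-module \<open>V\<close>, the left \<open>A\<close>-module
  \<open>A \<otimes>\<^sub>B V\<close>, where \<open>A\<close> is a right \<open>B\<close>-module through \<open>\<phi>\<close>: the free abelian group on
  \<open>A \<times> V\<close> modulo biadditivity and \<open>B\<close>-balancedness.\<close>

definition tensor_relations ::
    "('b, 'k) ring_scheme \<Rightarrow> ('a, 'l) ring_scheme \<Rightarrow> ('b \<Rightarrow> 'a) \<Rightarrow> ('b, 'v) module
      \<Rightarrow> ('a \<times> 'v \<Rightarrow>\<^sub>0 int) set" where
  "tensor_relations B A \<phi> V =
     {frag_of (a \<oplus>\<^bsub>A\<^esub> a', v) - frag_of (a, v) - frag_of (a', v) | a a' v.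
        a \<in> carrier A \<and> a' \<in> carrier A \<and> v \<in> carrier V} \<union>
     {frag_of (a, v \<oplus>\<^bsub>V\<^esub> v') - frag_of (a, v) - frag_of (a, v') | a v v'.
        a \<in> carrier A \<and> v \<in> carrier V \<and> v' \<in> carrier V} \<union>
     {frag_of (a \<otimes>\<^bsub>A\<^esub> \<phi> b, v) - frag_of (a, b \<odot>\<^bsub>V\<^esub> v) | a b v.
        a \<in> carrier A \<and> b \<in> carrier B \<and> v \<in> carrier V}"

definition extend_scalars ::
    "('b, 'k) ring_scheme \<Rightarrow> ('a, 'l) ring_scheme \<Rightarrow> ('b \<Rightarrow> 'a) \<Rightarrow> ('b, 'v) module
      \<Rightarrow> ('a, ('a \<times> 'v \<Rightarrow>\<^sub>0 int) set) module" where
  "extend_scalars B A \<phi> V =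
     (let F = free_Abelian_group (carrier A \<times> carrier V);
          N = generate F (tensor_relations B A \<phi> V);
          Q = F Mod N
      in \<lparr>carrier = carrier Q, monoid.mult = undefined, monoid.one = undefined,
          ring.zero = \<one>\<^bsub>Q\<^esub>, ring.add = (\<lambda>C D. C \<otimes>\<^bsub>Q\<^esub> D),
          module.smult = (\<lambda>r C. the_elem
            ((\<lambda>c. N #>\<^bsub>F\<^esub> frag_extend (\<lambda>(a, v). frag_of (r \<otimes>\<^bsub>A\<^esub> a, v)) c) ` C))\<rparr>)"


section \<open>Restricted enveloping algebras\<close>

record ('a, 'g) restricted_lie =
  lie_carrier :: "'g set"
  lie_add :: "'g \<Rightarrow> 'g \<Rightarrow> 'g"
  lie_scale :: "'a \<Rightarrow> 'g \<Rightarrow> 'g"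
  lie_bracket :: "'g \<Rightarrow> 'g \<Rightarrow> 'g"
  lie_pmap :: "'g \<Rightarrow> 'g"

text \<open>Lists form the free monoid under concatenation; hence \<^typ>\<open>'g list \<Rightarrow>\<^sub>0 'a\<close> with its
  convolution product is the free associative unital \<open>'a\<close>-algebra on \<open>'g\<close>.\<close>

instantiation list :: (type) monoid_add
begin
definition zero_list :: "'a list" where "zero_list = []"
definition plus_list :: "'a list \<Rightarrow> 'a list \<Rightarrow> 'a list" where "plus_list = (@)"
instance by standard (simp_all add: zero_list_def plus_list_def)
end

definition free_algebra :: "'g set \<Rightarrow> ('g list \<Rightarrow>\<^sub>0 'a::field) ring" where
  "free_algebra S = \<lparr>carrier = {a. Poly_Mapping.keys a \<subseteq> lists S},
     monoid.mult = (*), monoid.one = 1, ring.zero = 0, ring.add = (+)\<rparr>"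

definition fgen :: "'g \<Rightarrow> 'g list \<Rightarrow>\<^sub>0 'a::field" where
  "fgen x = Poly_Mapping.single [x] 1"

definition fscal :: "'a \<Rightarrow> 'g list \<Rightarrow>\<^sub>0 'a::field" where
  "fscal c = Poly_Mapping.single [] c"

text \<open>The functorial algebra homomorphism with \<open>fgen x \<mapsto> fgen (f x)\<close>.\<close>

definition fmap_algebra :: "('g \<Rightarrow> 'h) \<Rightarrow> ('g list \<Rightarrow>\<^sub>0 'a::field) \<Rightarrow> ('h list \<Rightarrow>\<^sub>0 'a)" where
  "fmap_algebra f a = (\<Sum>w\<in>Poly_Mapping.keys a.
     Poly_Mapping.single (map f w) (Poly_Mapping.lookup a w))"

text \<open>\<open>U(G)\<close>: the first two families of relations make the generators linear in \<open>G\<close> (so that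
  the quotient by them is the tensor algebra), the third identifies commutators with brackets.\<close>

definition U_relations :: "('a::field, 'g) restricted_lie \<Rightarrow> ('g list \<Rightarrow>\<^sub>0 'a) set" where
  "U_relations G =
     {fgen (lie_add G x y) - fgen x - fgen y | x y.
        x \<in> lie_carrier G \<and> y \<in> lie_carrier G} \<union>
     {fgen (lie_scale G c x) - fscal c * fgen x | c x. x \<in> lie_carrier G} \<union>
     {fgen x * fgen y - fgen y * fgen x - fgen (lie_bracket G x y) | x y.
        x \<in> lie_carrier G \<and> y \<in> lie_carrier G}"

definition U_ideal :: "('a::field, 'g) restricted_lie \<Rightarrow> ('g list \<Rightarrow>\<^sub>0 'a) set" where
  "U_ideal G = Idl\<^bsub>free_algebra (lie_carrier G)\<^esub> (U_relations G)"

definition U_alg :: "('a::field, 'g) restricted_lie \<Rightarrow> ('g list \<Rightarrow>\<^sub>0 'a) set ring" where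
  "U_alg G = free_algebra (lie_carrier G) Quot U_ideal G"

definition U_class :: "('a::field, 'g) restricted_lie \<Rightarrow> ('g list \<Rightarrow>\<^sub>0 'a) \<Rightarrow> ('g list \<Rightarrow>\<^sub>0 'a) set" where
  "U_class G a = U_ideal G +>\<^bsub>free_algebra (lie_carrier G)\<^esub> a"

definition u_relations :: "('a::field, 'g) restricted_lie \<Rightarrow> ('g list \<Rightarrow>\<^sub>0 'a) set set" where
  "u_relations G =
     {U_class G (fgen x) [^]\<^bsub>U_alg G\<^esub> CHAR('a) \<ominus>\<^bsub>U_alg G\<^esub> U_class G (fgen (lie_pmap G x)) | x.
        x \<in> lie_carrier G}"

definition u_ideal :: "('a::field, 'g) restricted_lie \<Rightarrow> ('g list \<Rightarrow>\<^sub>0 'a) set set" where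
  "u_ideal G = Idl\<^bsub>U_alg G\<^esub> (u_relations G)"

definition u_alg :: "('a::field, 'g) restricted_lie \<Rightarrow> ('g list \<Rightarrow>\<^sub>0 'a) set set ring" where
  "u_alg G = U_alg G Quot u_ideal G"

definition u_class ::
    "('a::field, 'g) restricted_lie \<Rightarrow> ('g list \<Rightarrow>\<^sub>0 'a) \<Rightarrow> ('g list \<Rightarrow>\<^sub>0 'a) set set" where
  "u_class G a = u_ideal G +>\<^bsub>U_alg G\<^esub> U_class G a"

text \<open>The functorial map \<open>u(K,0) \<rightarrow> u(G,0)\<close> of a homomorphism \<open>f : K \<rightarrow> G\<close> of restricted
  Lie algebras.\<close>

definition U_map :: "('a::field, 'h) restricted_lie \<Rightarrow> ('g \<Rightarrow> 'h)
    \<Rightarrow> ('g list \<Rightarrow>\<^sub>0 'a) set \<Rightarrow> ('h list \<Rightarrow>\<^sub>0 'a) set" where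
  "U_map G f = coset_map (free_algebra (lie_carrier G)) (U_ideal G) (fmap_algebra f)"

definition u_map :: "('a::field, 'h) restricted_lie \<Rightarrow> ('g \<Rightarrow> 'h)
    \<Rightarrow> ('g list \<Rightarrow>\<^sub>0 'a) set set \<Rightarrow> ('h list \<Rightarrow>\<^sub>0 'a) set set" where
  "u_map G f = coset_map (U_alg G) (u_ideal G) (U_map G f)"

text \<open>Restricted \<open>G\<close>-modules are left \<^term>\<open>u_alg G\<close>-modules.  The scalar \<open>c\<close> acts as
  \<^term>\<open>u_class G (fscal c)\<close>, so no separate vector space structure is recorded.\<close>

type_synonym ('a, 'g, 'v) restricted_module = "(('g list \<Rightarrow>\<^sub>0 'a) set set, 'v) module"

definition inflate :: "('a::field, 'h) restricted_lie \<Rightarrow> ('g \<Rightarrow> 'h)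
    \<Rightarrow> ('a, 'h, 'v) restricted_module \<Rightarrow> ('a, 'g, 'v) restricted_module" where
  "inflate G f V =
     \<lparr>carrier = carrier V, monoid.mult = monoid.mult V, monoid.one = monoid.one V,
      ring.zero = ring.zero V, ring.add = ring.add V,
      module.smult = (\<lambda>r v. u_map G f r \<odot>\<^bsub>V\<^esub> v)\<rparr>"

definition Ind :: "('a::field, 'g) restricted_lie \<Rightarrow> ('a, 'g) restricted_lie
    \<Rightarrow> ('a, 'g, 'v) restricted_module
    \<Rightarrow> ('a, 'g, (('g list \<Rightarrow>\<^sub>0 'a) set set \<times> 'v \<Rightarrow>\<^sub>0 int) set) restricted_module" where
  "Ind G K V = extend_scalars (u_alg K) (u_alg G) (u_map G (\<lambda>x. x)) V"


section \<open>The truncated polynomial algebra \<open>O(2;1)\<close>\<close>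

text \<open>An element of \<open>F[x,y]/(x\<^sup>p,y\<^sup>p)\<close>, \<open>p = CHAR(F)\<close>, is given by its coefficients with respect
  to the basis \<open>x\<^sup>i y\<^sup>j\<close>, \<open>i, j < p\<close>.\<close>

typedef (overloaded) ('a::field) O2 =
    "{f :: nat \<Rightarrow> nat \<Rightarrow> 'a. \<forall>i j. \<not> (i < CHAR('a) \<and> j < CHAR('a)) \<longrightarrow> f i j = 0}"
  morphisms coeff2 Abs_O2
  by (rule exI[of _ "\<lambda>_ _. 0"]) simp

setup_lifting type_definition_O2

instantiation O2 :: (field) comm_ring
begin

lift_definition zero_O2 :: "'a O2" is "\<lambda>_ _. 0" by simp
lift_definition plus_O2 :: "'a O2 \<Rightarrow> 'a O2 \<Rightarrow> 'a O2" is "\<lambda>f g i j. f i j + g i j" by simp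
lift_definition minus_O2 :: "'a O2 \<Rightarrow> 'a O2 \<Rightarrow> 'a O2" is "\<lambda>f g i j. f i j - g i j" by simp
lift_definition uminus_O2 :: "'a O2 \<Rightarrow> 'a O2" is "\<lambda>f i j. - f i j" by simp
lift_definition times_O2 :: "'a O2 \<Rightarrow> 'a O2 \<Rightarrow> 'a O2" is
  "\<lambda>f g i j. if i < CHAR('a) \<and> j < CHAR('a)
     then \<Sum>k\<le>i. \<Sum>l\<le>j. f k l * g (i - k) (j - l) else 0"
  by auto

instance
proof
  fix a b c :: "'a O2"
  define F :: "'a O2 \<Rightarrow> 'a fps fps" where "F f = Abs_fps (\<lambda>i. Abs_fps (coeff2 f i))" for f
  have F: "fps_nth (fps_nth (F f) i) j = coeff2 f i j" for f i j
    by (simp add: F_def)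
  have coeff_times: "coeff2 (f * g) i j =
      (if i < CHAR('a) \<and> j < CHAR('a) then fps_nth (fps_nth (F f * F g) i) j else 0)" for f g i j
    by (simp add: times_O2.rep_eq fps_mult_nth fps_sum_nth F atLeast0AtMost)
  have eqI: "f = g" if "\<And>i j. i < CHAR('a) \<Longrightarrow> j < CHAR('a) \<Longrightarrow> coeff2 f i j = coeff2 g i j"
    for f g :: "'a O2"
  proof -
    have "coeff2 f i j = coeff2 g i j" for i j
      using that coeff2[of f] coeff2[of g] by (cases "i < CHAR('a) \<and> j < CHAR('a)") auto
    thus ?thesis by (simp add: coeff2_inject[symmetric] fun_eq_iff)
  qed
  have F_times: "fps_nth (fps_nth (F (f * g)) i) j = fps_nth (fps_nth (F f * F g) i) j"
    if "i < CHAR('a)" "j < CHAR('a)" for f g i j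
    using that by (simp add: F coeff_times)
  have F_left: "fps_nth (fps_nth (F (f * g) * u) i) j = fps_nth (fps_nth (F f * F g * u) i) j"
    if "i < CHAR('a)" "j < CHAR('a)" for f g u i j
    unfolding fps_mult_nth[of _ _ i] fps_mult_nth[of "F (f * g)"] fps_sum_nth
    using that by (intro sum.cong refl)
      (auto simp: fps_mult_nth[of _ _ j] F_times intro!: sum.cong)
  have comm: "f * g = g * f" for f g :: "'a O2"
    by (rule eqI) (simp add: coeff_times mult.commute)
  show "a * b = b * a" by (rule comm)
  show "a * b * c = a * (b * c)"
  proof (rule eqI)
    fix i j assume ij: "i < CHAR('a)" "j < CHAR('a)"
    have "coeff2 (a * b * c) i j = fps_nth (fps_nth (F a * F b * F c) i) j"
      using ij by (simp add: coeff_times F_left)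
    also have "\<dots> = fps_nth (fps_nth (F (b * c) * F a) i) j"
      by (subst F_left[OF ij]) (simp add: mult.commute mult.left_commute)
    also have "\<dots> = coeff2 (a * (b * c)) i j"
      using ij by (subst comm[of a "b * c"]) (simp only: coeff_times if_True simp_thms)
    finally show "coeff2 (a * b * c) i j = coeff2 (a * (b * c)) i j" .
  qed
  show "(a + b) * c = a * c + b * c"
    by transfer (auto simp: fun_eq_iff sum.distrib[symmetric] distrib_right)
qed (transfer; simp add: fun_eq_iff algebra_simps)+

end

lift_definition monom2 :: "nat \<Rightarrow> nat \<Rightarrow> 'a::field O2" is
  "\<lambda>a b i j. if i = a \<and> j = b \<and> a < CHAR('a) \<and> b < CHAR('a) then 1 else 0" by auto

instantiation O2 :: (field) one
begin
definition one_O2 :: "'a O2" where "one_O2 = monom2 0 0"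
instance ..
end

abbreviation varx :: "'a::field O2" where "varx \<equiv> monom2 1 0"
abbreviation vary :: "'a::field O2" where "vary \<equiv> monom2 0 1"

lift_definition scale2 :: "'a \<Rightarrow> 'a::field O2 \<Rightarrow> 'a O2" is "\<lambda>c f i j. c * f i j" by simp

lift_definition dx :: "'a::field O2 \<Rightarrow> 'a O2" is "\<lambda>f i j. of_nat (Suc i) * f (Suc i) j" by auto
lift_definition dy :: "'a::field O2 \<Rightarrow> 'a O2" is "\<lambda>f i j. of_nat (Suc j) * f i (Suc j)" by auto


section \<open>The Jacobson--Witt algebra and the subalgebra \<open>L\<close>\<close>

text \<open>Vector fields are represented by the derivations of \<open>O(2;1)\<close> they define.\<close>

type_synonym 'a vfield = "'a O2 \<Rightarrow> 'a O2"

definition vf :: "'a::field O2 \<Rightarrow> 'a O2 \<Rightarrow> 'a vfield" where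
  "vf f g = (\<lambda>h. f * dx h + g * dy h)"

definition vadd :: "'a::field vfield \<Rightarrow> 'a vfield \<Rightarrow> 'a vfield" where
  "vadd D E = (\<lambda>h. D h + E h)"

definition vscale :: "'a::field \<Rightarrow> 'a vfield \<Rightarrow> 'a vfield" where
  "vscale c D = (\<lambda>h. scale2 c (D h))"

definition W2 :: "('a::field, 'a vfield) restricted_lie" where
  "W2 = \<lparr>lie_carrier = {vf f g | f g. True}, lie_add = vadd, lie_scale = vscale,
     lie_bracket = (\<lambda>D E h. D (E h) - E (D h)), lie_pmap = (\<lambda>D. D ^^ CHAR('a))\<rparr>"

definition W2_sub :: "'a::field vfield set \<Rightarrow> ('a, 'a vfield) restricted_lie" where
  "W2_sub S = W2\<lparr>lie_carrier := S\<rparr>"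

text \<open>The filtration \<open>W(2;1)\<^sub>(\<^sub>n\<^sub>)\<close>: \<open>x\<^sup>i y\<^sup>j \<partial>\<^sub>x\<close> and \<open>x\<^sup>i y\<^sup>j \<partial>\<^sub>y\<close> have degree \<open>i + j - 1\<close>.\<close>

definition W2_filt :: "int \<Rightarrow> 'a::field vfield set" where
  "W2_filt n = {vf f g | f g.
     \<forall>i j. int i + int j - 1 < n \<longrightarrow> coeff2 f i j = 0 \<and> coeff2 g i j = 0}"

definition Lam :: "'a::field O2" where
  "Lam = 1 - monom2 (CHAR('a) - 1) (CHAR('a) - 1)"

definition D_Lam :: "'a::field O2 \<Rightarrow> 'a vfield" where
  "D_Lam f = vf (- (Lam * dy f)) (Lam * dx f)"

definition H_carrier :: "'a::field vfield set" where
  "H_carrier = range D_Lam"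

definition Gam :: "'a::field vfield" where
  "Gam = vf 0 (monom2 (CHAR('a) - 1) 0)"

definition Theta :: "'a::field vfield" where
  "Theta = vf (- monom2 0 (CHAR('a) - 1)) 0"

definition L_carrier :: "'a::field vfield set" where
  "L_carrier = {vadd D (vadd (vscale a Gam) (vscale b Theta)) | D a b. D \<in> H_carrier}"

definition L_filt :: "int \<Rightarrow> 'a::field vfield set" where
  "L_filt n = L_carrier \<inter> W2_filt n"

definition L_alg :: "('a::field, 'a vfield) restricted_lie" where
  "L_alg = W2_sub L_carrier"

definition L0_alg :: "('a::field, 'a vfield) restricted_lie" where
  "L0_alg = W2_sub (L_filt 0)"


section \<open>The modules \<open>V(\<lambda>)\<close> and \<open>M(\<lambda>)\<close>\<close>

text \<open>\<open>sl\<^sub>2\<close> as linear vector fields.  With \<open>e = y \<partial>\<^sub>x\<close>, \<open>h = y \<partial>\<^sub>y - x \<partial>\<^sub>x\<close>,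
  \<open>f = x \<partial>\<^sub>y\<close> one has \<open>[e,f] = h\<close>, \<open>[h,e] = 2e\<close>, \<open>[h,f] = -2f\<close>.\<close>

definition sl2_e :: "'a::field vfield" where "sl2_e = vf vary 0"
definition sl2_h :: "'a::field vfield" where "sl2_h = vf (- varx) vary"
definition sl2_f :: "'a::field vfield" where "sl2_f = vf 0 varx"

definition sl2_alg :: "('a::field, 'a vfield) restricted_lie" where
  "sl2_alg = W2_sub {vadd (vscale a sl2_e) (vadd (vscale b sl2_h) (vscale c sl2_f)) | a b c. True}"

text \<open>The degree-zero component of a vector field \<open>D = D(x) \<partial>\<^sub>x + D(y) \<partial>\<^sub>y\<close>.  On \<open>L\<^sub>(\<^sub>0\<^sub>)\<close> it has
  kernel \<open>L\<^sub>(\<^sub>1\<^sub>)\<close> and realizes the projection \<open>L\<^sub>(\<^sub>0\<^sub>) \<rightarrow> L\<^sub>(\<^sub>0\<^sub>)/L\<^sub>(\<^sub>1\<^sub>) \<cong> sl\<^sub>2\<close>.\<close>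

lift_definition linear_part :: "'a::field O2 \<Rightarrow> 'a O2" is
  "\<lambda>f i j. if i + j = 1 then f i j else 0" by simp

definition deg0_part :: "'a::field vfield \<Rightarrow> 'a vfield" where
  "deg0_part D = vf (linear_part (D varx)) (linear_part (D vary))"

text \<open>\<open>V\<close> is the (up to isomorphism unique) irreducible restricted \<open>sl\<^sub>2\<close>-module of highest
  weight \<open>lam\<close>, i.e. it contains a nonzero vector annihilated by \<open>e\<close> on which \<open>h\<close> acts as \<open>lam\<close>.\<close>

definition is_V :: "nat \<Rightarrow> ('a::field, 'a vfield, 'v) restricted_module \<Rightarrow> bool" where
  "is_V lam V \<longleftrightarrow> irreducible_module (u_alg sl2_alg) V \<and>
     (\<exists>v\<in>carrier V. v \<noteq> \<zero>\<^bsub>V\<^esub> \<and>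
        u_class sl2_alg (fgen sl2_e) \<odot>\<^bsub>V\<^esub> v = \<zero>\<^bsub>V\<^esub> \<and>
        u_class sl2_alg (fgen sl2_h) \<odot>\<^bsub>V\<^esub> v =
          u_class sl2_alg (fscal (of_nat lam)) \<odot>\<^bsub>V\<^esub> v)"

text \<open>\<open>M(\<lambda>)\<close> for \<open>V = V(\<lambda>)\<close>.\<close>

definition M_mod :: "('a::field, 'a vfield, 'v) restricted_module
    \<Rightarrow> ('a, 'a vfield, (('a vfield list \<Rightarrow>\<^sub>0 'a) set set \<times> 'v \<Rightarrow>\<^sub>0 int) set) restricted_module" where
  "M_mod V = Ind L_alg L0_alg (inflate sl2_alg deg0_part V)"

end

theory Submission
  imports Defs "HOL-Library.Function_Algebras"
begin

text \<open>Inducing from \<open>L\<^sub>(\<^sub>0\<^sub>)\<close> amounts to coinducing, so \<open>M(\<lambda>)\<close> can be compared with the module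
  \<open>T\<close> of symmetric differential forms \<open>\<Sum>k. s\<^sub>k dx\<^sup>\<lambda>\<^sup>-\<^sup>k dy\<^sup>k\<close>, \<open>s\<^sub>k \<in> O(2;1)\<close>, on which vector fields act by
  Lie derivatives.  That the action is compatible with brackets and \<open>p\<close>-th powers follows from the
  Leibniz rule, by multiplying up one-forms.  The multiples of \<open>x\<^sup>p\<^sup>-\<^sup>1 y\<^sup>p\<^sup>-\<^sup>1\<close> in \<open>T\<close> form a copy of
  \<open>V(\<lambda>)\<close> inflated to \<open>L\<^sub>(\<^sub>0\<^sub>)\<close>, which induces a homomorphism \<open>M(\<lambda>) \<rightarrow> T\<close>.  Let \<open>X = \<Lambda> \<partial>\<^sub>x\<close> and \<open>Y = \<Lambda> \<partial>\<^sub>y\<close>.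
  The products \<open>X\<^sup>a Y\<^sup>b \<otimes> v\<close> with \<open>a, b < p\<close> span \<open>M(\<lambda>)\<close>, and their images in \<open>T\<close> have independent
  leading terms, so the homomorphism is injective.

  Let \<open>U\<close> be a nonzero submodule of \<open>T\<close>.  Applying \<open>X\<close> and \<open>Y\<close> to an element of \<open>U\<close> produces one with
  nonzero constant term \<open>v\<close>.  The composition of \<open>x\<^sup>3 \<partial>\<^sub>y\<close> and
  \<open>x\<^sup>p\<^sup>-\<^sup>1 y\<^sup>p\<^sup>-\<^sup>2 \<partial>\<^sub>x - x\<^sup>p\<^sup>-\<^sup>2 y\<^sup>p\<^sup>-\<^sup>1 \<partial>\<^sub>y\<close> maps it to \<open>6 x\<^sup>p\<^sup>-\<^sup>1 y\<^sup>p\<^sup>-\<^sup>1 f\<^sup>2 v\<close>, and \<open>f\<^sup>2 \<noteq> 0\<close> on \<open>V(\<lambda>)\<close> because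
  \<open>\<lambda> \<ge> 2\<close>.  Hence \<open>U\<close> contains the copy of \<open>V(\<lambda>)\<close> that generates the image of \<open>M(\<lambda>)\<close>.\<close>

section \<open>The truncated polynomial algebra\<close>

text \<open>No basis of u(L,0) has to be known in advance. Reordering products shows that M(lambda)
  has dimension at most p^2 (lambda + 1), and T supplies the lower bound: if the images of a
  spanning family are independent, so is the family itself. Induction and coinduction agree here
  without a twist by a character because L_(0) acts on L/L_(0) with trace zero; concretely, L_(0)
  kills x^{p-1} y^{p-1}, so the multiples of this monomial carry V(lambda) itself. The factor Lambda
  in X and Y is forced, since the plain partial derivatives do not lie in L. It differs from 1 only
  in degree 2p - 2 and so leaves leading terms alone. The bound lambda >= 2 is a genuine boundary:
  for lambda = 0 the constants, and for lambda = 1 the exact one-forms, are proper nonzero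
  submodules of T.\<close>

lemma coeff2_simps [simp]:
  "coeff2 0 i j = 0"
  "coeff2 (f + g) i j = coeff2 f i j + coeff2 g i j"
  "coeff2 (f - g) i j = coeff2 f i j - coeff2 g i j"
  "coeff2 (- f) i j = - coeff2 f i j"
  "coeff2 (scale2 c f) i j = c * coeff2 f i j"
  "coeff2 (dx f) i j = of_nat (Suc i) * coeff2 f (Suc i) j"
  "coeff2 (dy f) i j = of_nat (Suc j) * coeff2 f i (Suc j)"
  "coeff2 (linear_part f) i j = (if i + j = 1 then coeff2 f i j else 0)"
  by (transfer; simp)+

lemma coeff2_monom2:
  "coeff2 (monom2 a b :: 'a::field O2) i j =
     (if i = a \<and> j = b \<and> a < CHAR('a) \<and> b < CHAR('a) then 1 else 0)"
  by transfer simp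

lemma coeff2_eq_0:
  fixes f :: "'a::field O2"
  shows "\<not> (i < CHAR('a) \<and> j < CHAR('a)) \<Longrightarrow> coeff2 f i j = 0"
  by transfer simp

lemma coeff2_sum [simp]: "coeff2 (sum f A) i j = (\<Sum>a\<in>A. coeff2 (f a) i j)"
  by (induction A rule: infinite_finite_induct) auto

lemma O2_eqI:
  fixes f g :: "'a::field O2"
  assumes "\<And>i j. i < CHAR('a) \<Longrightarrow> j < CHAR('a) \<Longrightarrow> coeff2 f i j = coeff2 g i j"
  shows "f = g"
proof -
  have "coeff2 f i j = coeff2 g i j" for i j
    using assms coeff2_eq_0[of i j f] coeff2_eq_0[of i j g]
    by (cases "i < CHAR('a) \<and> j < CHAR('a)") auto
  thus ?thesis by (simp add: coeff2_inject[symmetric] fun_eq_iff)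
qed

lemma coeff2_times:
  fixes f g :: "'a::field O2"
  assumes "i < CHAR('a)" "j < CHAR('a)"
  shows "coeff2 (f * g) i j = (\<Sum>k\<le>i. \<Sum>l\<le>j. coeff2 f k l * coeff2 g (i - k) (j - l))"
  using assms by (simp add: times_O2.rep_eq)

lemma scale2_simps [simp]:
  "scale2 c (f + g) = scale2 c f + scale2 c g"
  "scale2 c (f - g) = scale2 c f - scale2 c g"
  "scale2 c (- f) = - scale2 c f"
  "scale2 c 0 = 0" "scale2 0 f = 0" "scale2 1 f = f"
  "scale2 c (scale2 d f) = scale2 (c * d) f"
  by (rule O2_eqI; simp add: algebra_simps)+

lemma scale2_left: "scale2 (c + d) f = scale2 c f + scale2 d f"
  "scale2 (c - d) f = scale2 c f - scale2 d f"
  by (rule O2_eqI; simp add: algebra_simps)+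

lemma scale2_mult [simp]:
  "scale2 c f * g = scale2 c (f * g)" "g * scale2 c f = scale2 c (g * f)"
proof -
  show *: "scale2 c f * g = scale2 c (f * g)" for f g :: "'a O2"
    by (rule O2_eqI) (simp add: coeff2_times sum_distrib_left mult.assoc)
  show "g * scale2 c f = scale2 c (g * f)"
    using *[of f g] by (simp add: mult.commute)
qed

lemma coeff2_monom2_mult:
  fixes f :: "'a::field O2"
  shows "coeff2 (monom2 a b * f) i j =
    (if a \<le> i \<and> b \<le> j \<and> i < CHAR('a) \<and> j < CHAR('a) then coeff2 f (i - a) (j - b) else 0)"
proof (cases "i < CHAR('a) \<and> j < CHAR('a)")
  case True
  have "coeff2 (monom2 a b * f) i j =
      (\<Sum>k\<le>i. \<Sum>l\<le>j. if k = a then if l = b then coeff2 f (i - k) (j - l) else 0 else 0)"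
    using True by (auto simp: coeff2_times coeff2_monom2 intro!: sum.cong)
  also have "\<dots> = (\<Sum>k\<le>i. if k = a then \<Sum>l\<le>j. if l = b then coeff2 f (i - k) (j - l) else 0 else 0)"
    by (rule sum.cong[OF refl]) simp
  also have "\<dots> = (if a \<le> i then if b \<le> j then coeff2 f (i - a) (j - b) else 0 else 0)"
    by (simp add: sum.delta)
  finally show ?thesis using True by simp
qed (auto simp: coeff2_eq_0)

lemma monom2_mult: "monom2 a b * monom2 c d = monom2 (a + c) (b + d)"
  by (rule O2_eqI) (auto simp: coeff2_monom2_mult coeff2_monom2)

lemma dx_simps [simp]:
  "dx (f + g) = dx f + dx g" "dx (f - g) = dx f - dx g" "dx (- f) = - dx f"
  "dx 0 = 0" "dx (scale2 c f) = scale2 c (dx f)"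
  by (rule O2_eqI; simp add: algebra_simps)+

lemma dy_simps [simp]:
  "dy (f + g) = dy f + dy g" "dy (f - g) = dy f - dy g" "dy (- f) = - dy f"
  "dy 0 = 0" "dy (scale2 c f) = scale2 c (dy f)"
  by (rule O2_eqI; simp add: algebra_simps)+

lemma dy_dx: "dy (dx f) = dx (dy f)"
  by (rule O2_eqI) (simp add: algebra_simps)

text \<open>Inherited from \<open>fps_deriv\<close> on power series in x over power series in y.
  Truncation does no harm because x^p has derivative 0.\<close>

lemma dx_mult: "dx (f * g) = dx f * g + f * dx g"
  for f g :: "'a::field O2"
proof -
  define F :: "'a O2 \<Rightarrow> 'a fps fps" where "F f = Abs_fps (\<lambda>i. Abs_fps (coeff2 f i))" for f
  have F: "fps_nth (fps_nth (F f) i) j = coeff2 f i j" for f i j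
    by (simp add: F_def)
  have times: "coeff2 (f * g) i j = fps_nth (fps_nth (F f * F g) i) j"
    if "i < CHAR('a)" "j < CHAR('a)" for f g i j
    using that by (simp add: coeff2_times fps_mult_nth fps_sum_nth F atLeast0AtMost)
  have nat: "fps_nth (of_nat n * h) j = of_nat n * fps_nth h j" for n j and h :: "'a fps"
    by (simp add: fps_of_nat[symmetric])
  have deriv: "fps_deriv (F f) = F (dx f)" for f
    by (intro fps_ext) (simp add: F nat del: of_nat_Suc of_nat_add)
  show ?thesis
  proof (rule O2_eqI)
    fix i j assume ij: "i < CHAR('a)" "j < CHAR('a)"
    have "coeff2 (dx (f * g)) i j = of_nat (Suc i) * fps_nth (fps_nth (F f * F g) (Suc i)) j"
    proof (cases "Suc i < CHAR('a)")
      \<comment> \<open>At exponent p the truncated product and the power series product differ, but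
        both are multiplied by p = 0.\<close>
      case False
      hence "Suc i = CHAR('a)" using ij by simp
      hence "of_nat (Suc i) = (0::'a)" by (metis of_nat_CHAR)
      thus ?thesis by (simp del: of_nat_Suc)
    qed (use ij in \<open>simp add: times\<close>)
    also have "\<dots> = fps_nth (fps_nth (fps_deriv (F f * F g)) i) j"
      by (simp only: fps_deriv_nth nat Suc_eq_plus1)
    also have "\<dots> = coeff2 (dx f * g + f * dx g) i j"
      using ij by (simp only: fps_deriv_mult deriv fps_add_nth times coeff2_simps) (simp add: add.commute)
    finally show "coeff2 (dx (f * g)) i j = coeff2 (dx f * g + f * dx g) i j" .
  qed
qed

text \<open>Exchange of x and y, an algebra automorphism that conjugates \<open>dx\<close> into
  \<open>dy\<close>; it reduces \<open>dy_mult\<close> to \<open>dx_mult\<close>.\<close>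

lift_definition swap2 :: "'a::field O2 \<Rightarrow> 'a O2" is "\<lambda>f i j. f j i" by auto

lemma dy_mult: "dy (f * g) = dy f * g + f * dy g"
  for f g :: "'a::field O2"
proof -
  have c: "coeff2 (swap2 f) i j = coeff2 f j i" for f :: "'a O2" and i j
    by transfer simp
  have m: "swap2 (f * g) = swap2 f * swap2 g" for f g :: "'a O2"
    by (rule O2_eqI) (simp add: c coeff2_times, subst sum.swap, rule refl)
  have d: "dy f = swap2 (dx (swap2 f))" for f :: "'a O2"
    by (rule O2_eqI) (simp add: c)
  have "swap2 (swap2 f) = f" "swap2 (f + g) = swap2 f + swap2 g" for f g :: "'a O2"
    by (rule O2_eqI; simp add: c)+
  thus ?thesis by (simp add: d m dx_mult)
qed

lemma dx_monom2: "dx (monom2 a b :: 'a::field O2) = scale2 (of_nat a) (monom2 (a - 1) b)"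
proof (rule O2_eqI)
  fix i j assume ij: "i < CHAR('a)" "j < CHAR('a)"
  show "coeff2 (dx (monom2 a b)) i j = coeff2 (scale2 (of_nat a :: 'a) (monom2 (a - 1) b)) i j"
  proof (cases "a = 0 \<or> a = CHAR('a)")
    \<comment> \<open>For a = 0 the scalar vanishes, whatever a - 1 means. For a = p the monomial on
      the left is 0 and the scalar on the right is p = 0.\<close>
    case True
    thus ?thesis by (auto simp: coeff2_monom2)
  qed (use ij in \<open>auto simp: coeff2_monom2\<close>)
qed

lemma dy_monom2: "dy (monom2 a b :: 'a::field O2) = scale2 (of_nat b) (monom2 a (b - 1))"
proof (rule O2_eqI)
  fix i j assume ij: "i < CHAR('a)" "j < CHAR('a)"
  show "coeff2 (dy (monom2 a b)) i j = coeff2 (scale2 (of_nat b :: 'a) (monom2 a (b - 1))) i j"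
  proof (cases "b = 0 \<or> b = CHAR('a)")
    case True
    thus ?thesis by (auto simp: coeff2_monom2)
  qed (use ij in \<open>auto simp: coeff2_monom2\<close>)
qed

lemma one_mult_O2 [simp]:
  fixes f :: "'a::field O2"
  shows "1 * f = f" "f * 1 = f"
proof -
  show "1 * f = f"
    unfolding one_O2_def by (rule O2_eqI) (simp add: coeff2_monom2_mult)
  thus "f * 1 = f" by (simp add: mult.commute)
qed

lemma dx_one [simp]: "dx 1 = 0" and dy_one [simp]: "dy 1 = 0"
  by (simp_all add: one_O2_def dx_monom2 dy_monom2)

lemma dx_var [simp]: "dx varx = 1" "dx (monom2 (Suc 0) 0) = 1" "dx (monom2 0 j) = 0"
  and dy_var [simp]: "dy (monom2 i 0) = 0" "dy vary = 1" "dy (monom2 0 (Suc 0)) = 1"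
  by (simp_all add: one_O2_def dx_monom2 dy_monom2)

section \<open>The degree filtration\<close>

text \<open>Membership in the d-th power of the maximal ideal (x, y).\<close>

definition ordge :: "nat \<Rightarrow> 'a::field O2 \<Rightarrow> bool" where
  "ordge d f \<longleftrightarrow> (\<forall>i j. i + j < d \<longrightarrow> coeff2 f i j = 0)"

lemma ordgeD: "ordge d f \<Longrightarrow> i + j < d \<Longrightarrow> coeff2 f i j = 0"
  by (simp add: ordge_def)

lemma ordge_0 [simp]: "ordge 0 f" "ordge d 0"
  by (simp_all add: ordge_def)

lemma ordge_add: "ordge d f \<Longrightarrow> ordge d g \<Longrightarrow> ordge d (f + g)"
  and ordge_uminus: "ordge d f \<Longrightarrow> ordge d (- f)"
  and ordge_scale2: "ordge d f \<Longrightarrow> ordge d (scale2 c f)"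
  and ordge_dx: "ordge d f \<Longrightarrow> ordge (d - 1) (dx f)"
  and ordge_dy: "ordge d f \<Longrightarrow> ordge (d - 1) (dy f)"
  by (auto simp: ordge_def)

lemma ordge_monom2: "d \<le> a + b \<Longrightarrow> ordge d (monom2 a b)"
  by (auto simp: ordge_def coeff2_monom2)

lemma ordge_mult:
  fixes f g :: "'a::field O2"
  assumes "ordge d f" "ordge e g" "c \<le> d + e"
  shows "ordge c (f * g)"
  unfolding ordge_def
proof safe
  fix i j assume ij: "i + j < c"
  have "coeff2 f k l * coeff2 g (i - k) (j - l) = 0" if "k \<le> i" "l \<le> j" for k l
  proof (cases "k + l < d")
    case False
    hence "i - k + (j - l) < e" using that ij assms(3) by linarith
    thus ?thesis using assms by (simp add: ordge_def)
  qed (use assms in \<open>simp add: ordge_def\<close>)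
  thus "coeff2 (f * g) i j = 0"
    by (cases "i < CHAR('a) \<and> j < CHAR('a)") (auto simp: coeff2_times coeff2_eq_0 intro!: sum.neutral)
qed

section \<open>Vector fields\<close>

lemma vf_simps [simp]:
  "vf f g (h + k) = vf f g h + vf f g k" "vf f g (h - k) = vf f g h - vf f g k"
  "vf f g 0 = 0" "vf f g (- h) = - vf f g h" "vf f g (scale2 c h) = scale2 c (vf f g h)"
  "vf f g 1 = 0" "vf f g varx = f" "vf f g vary = g"
  "vf f g (monom2 (Suc 0) 0) = f" "vf f g (monom2 0 (Suc 0)) = g"
  by (simp_all add: vf_def algebra_simps)

lemma vf_mult: "vf f g (h * k) = vf f g h * k + h * vf f g k"
  by (simp add: vf_def dx_mult dy_mult algebra_simps)

lemma vf_inject: "vf f g = vf f' g' \<longleftrightarrow> f = f' \<and> g = g'"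
proof
  assume eq: "vf f g = vf f' g'"
  have "vf f g varx = vf f' g' varx" "vf f g vary = vf f' g' vary" by (simp_all only: eq)
  thus "f = f' \<and> g = g'" by simp
qed simp

lemma vadd_vf: "vadd (vf f g) (vf f' g') = vf (f + f') (g + g')"
  by (auto simp: vadd_def vf_def algebra_simps)

lemma vscale_vf: "vscale c (vf f g) = vf (scale2 c f) (scale2 c g)"
  by (auto simp: vscale_def vf_def)

abbreviation W_carrier :: "'a::field vfield set" where
  "W_carrier \<equiv> {vf f g | f g. True}"

lemma W_eqI: "D \<in> W_carrier \<Longrightarrow> E \<in> W_carrier \<Longrightarrow> D varx = E varx \<Longrightarrow> D vary = E vary \<Longrightarrow> D = E"
  by auto

lemma bracket_vf:
  "(\<lambda>h. vf f g (vf f' g' h) - vf f' g' (vf f g h)) =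
     vf (vf f g f' - vf f' g' f) (vf f g g' - vf f' g' g)"
  by (rule ext) (simp add: vf_def dx_mult dy_mult dy_dx algebra_simps)

section \<open>Derivations and their p-th powers\<close>

lemma O2_expand:
  fixes f :: "'a::field O2"
  shows "f = (\<Sum>i<CHAR('a). \<Sum>j<CHAR('a). scale2 (coeff2 f i j) (monom2 i j))"
proof (rule O2_eqI)
  fix i j assume ij: "i < CHAR('a)" "j < CHAR('a)"
  have "(\<Sum>k<CHAR('a). \<Sum>l<CHAR('a). coeff2 f k l * coeff2 (monom2 k l :: 'a O2) i j)
    = (\<Sum>k<CHAR('a). \<Sum>l<CHAR('a). if k = i then (if l = j then coeff2 f i j else 0) else 0)"
    using ij by (intro sum.cong refl) (auto simp: coeff2_monom2)
  also have "\<dots> = (\<Sum>k<CHAR('a). if k = i then (\<Sum>l<CHAR('a). if l = j then coeff2 f i j else 0) else 0)"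
    by (intro sum.cong refl) auto
  also have "\<dots> = coeff2 f i j" using ij by simp
  finally show "coeff2 f i j = coeff2 (\<Sum>i<CHAR('a). \<Sum>j<CHAR('a). scale2 (coeff2 f i j) (monom2 i j)) i j"
    by simp
qed

text \<open>Two linear derivations that agree on the generators x and y agree on all monomials. This
  is what brings the p-th power of a vector field back into W.\<close>

lemma derivation_vf:
  fixes D :: "'a::field vfield"
  assumes add: "\<And>h k. D (h + k) = D h + D k"
    and mult: "\<And>h k. D (h * k) = D h * k + h * D k"
    and scale: "\<And>c h. D (scale2 c h) = scale2 c (D h)"
  shows "D = vf (D varx) (D vary)"
proof -
  define F G where FG: "F = D varx" "G = D vary"
  let ?E = "vf F G"
  have "D 1 = D 1 + D 1" using mult[of 1 1] by simp
  hence D1: "D 1 = 0" by simp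
  have D0: "D 0 = 0" using add[of 0 0] by simp
  have sum: "D (sum f A) = (\<Sum>a\<in>A. D (f a))" for f :: "nat \<Rightarrow> 'a O2" and A
    by (induction A rule: infinite_finite_induct) (auto simp: D0 add)
  have sumE: "?E (sum f A) = (\<Sum>a\<in>A. ?E (f a))" for f :: "nat \<Rightarrow> 'a O2" and A
    by (induction A rule: infinite_finite_induct) auto
  have x: "D (monom2 i 0) = ?E (monom2 i 0)" for i
  proof (induction i)
    case (Suc i)
    have "monom2 (Suc i) 0 = varx * (monom2 i 0 :: 'a O2)" by (simp add: monom2_mult)
    thus ?case by (simp only: mult vf_mult Suc vf_simps FG)
  qed (simp add: one_O2_def[symmetric] D1)
  have "D (monom2 i j) = ?E (monom2 i j)" for i j
  proof (induction j)
    case (Suc j)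
    have "monom2 i (Suc j) = vary * (monom2 i j :: 'a O2)" by (simp add: monom2_mult)
    thus ?case by (simp only: mult vf_mult Suc vf_simps FG)
  qed (rule x)
  hence exp: "D (\<Sum>i<CHAR('a). \<Sum>j<CHAR('a). scale2 (c i j) (monom2 i j)) =
      ?E (\<Sum>i<CHAR('a). \<Sum>j<CHAR('a). scale2 (c i j) (monom2 i j))" for c
    by (simp add: sum sumE scale)
  have "D f = ?E f" for f
    using exp[of "coeff2 f"] by (simp only: O2_expand[of f, symmetric])
  thus ?thesis unfolding FG by (rule ext)
qed

text \<open>Iterating a Leibniz rule \<open>p\<close> times leaves only the two outer terms, since the binomial
  coefficients \<open>p choose k\<close> vanish in characteristic \<open>p\<close> for \<open>0 < k < p\<close>.\<close>

lemma leibniz_power: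
  fixes b :: "'u::ab_group_add \<Rightarrow> 'v::ab_group_add \<Rightarrow> 'w::ab_group_add"
    and sc :: "'a::field \<Rightarrow> 'w \<Rightarrow> 'w"
  assumes dadd: "\<And>x y. d3 (x + y) = d3 x + d3 y"
    and dsc: "\<And>c x. d3 (sc c x) = sc c (d3 x)"
    and sc: "\<And>c x y. sc c (x + y) = sc c x + sc c y" "\<And>c e x. sc (c + e) x = sc c x + sc e x"
      "\<And>x. sc 1 x = x" 
    and leibniz: "\<And>u v. P u \<Longrightarrow> Q v \<Longrightarrow> d3 (b u v) = b (d1 u) v + b u (d2 v)"
    and stable: "\<And>u. P u \<Longrightarrow> P (d1 u)" "\<And>v. Q v \<Longrightarrow> Q (d2 v)"
    and p: "CHAR('a) > 0" and uv: "P u" "Q v"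
  shows "(d3 ^^ CHAR('a)) (b u v) = b ((d1 ^^ CHAR('a)) u) v + b u ((d2 ^^ CHAR('a)) v)"
proof -
  have sc0: "sc 0 x = 0" for x using sc(2)[of 0 0 x] by simp
  have scz: "sc c 0 = 0" for c using sc(1)[of c 0 0] by simp
  have d0: "d3 0 = 0" using dadd[of 0 0] by simp
  have dsum: "d3 (sum f A) = (\<Sum>a\<in>A. d3 (f a))" for f :: "nat \<Rightarrow> 'w" and A
    by (induction A rule: infinite_finite_induct) (auto simp: d0 dadd)
  \<comment> \<open>Stability keeps all iterates where the Leibniz rule is available; for
    \<open>mu\<close>, for example, it is only available for one-forms in
    \<open>Sym 1\<close>.\<close>
  have P: "P ((d1 ^^ n) u)" and Q: "Q ((d2 ^^ n) v)" for n
    by (induction n) (auto simp: uv stable)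
  define B where "B i j = b ((d1 ^^ i) u) ((d2 ^^ j) v)" for i j
  have dB: "d3 (B i j) = B (Suc i) j + B i (Suc j)" for i j
    using leibniz[OF P[of i] Q[of j]] by (simp add: B_def)
  have gen: "(d3 ^^ n) (b u v) = (\<Sum>k\<le>n. sc (of_nat (n choose k)) (B k (n - k)))" for n
  proof (induction n)
    case (Suc n)
    let ?c = "\<lambda>k. of_nat (n choose k) :: 'a"
    have "(d3 ^^ Suc n) (b u v) = (\<Sum>k\<le>n. sc (?c k) (B (Suc k) (n - k)) + sc (?c k) (B k (Suc (n - k))))"
      by (simp add: Suc dsum dsc dB sc)
    also have "\<dots> = (\<Sum>k\<le>n. sc (?c k) (B (Suc k) (n - k))) + (\<Sum>k\<le>n. sc (?c k) (B k (Suc n - k)))"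
      by (simp add: sum.distrib Suc_diff_le)
    \<comment> \<open>The added term has coefficient n choose n + 1, which is 0; after an index
      shift the two sums merge by Pascal's rule.\<close>
    also have "(\<Sum>k\<le>n. sc (?c k) (B k (Suc n - k))) = (\<Sum>k\<le>Suc n. sc (?c k) (B k (Suc n - k)))"
      by (simp add: sc0 binomial_eq_0)
    also have "\<dots> = sc (?c 0) (B 0 (Suc n)) + (\<Sum>k\<le>n. sc (?c (Suc k)) (B (Suc k) (n - k)))"
      by (subst sum.atMost_Suc_shift) simp
    also have "(\<Sum>k\<le>n. sc (?c k) (B (Suc k) (n - k))) + \<dots> =
       sc (?c 0) (B 0 (Suc n)) + (\<Sum>k\<le>n. sc (of_nat (Suc n choose Suc k)) (B (Suc k) (n - k)))"
      by (simp add: sc sum.distrib algebra_simps)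
    also have "\<dots> = (\<Sum>k\<le>Suc n. sc (of_nat (Suc n choose k)) (B k (Suc n - k)))"
      by (subst sum.atMost_Suc_shift) simp
    finally show ?case .
  qed (simp add: B_def sc)
  let ?p = "CHAR('a)"
  have prime: "Factorial_Ring.prime ?p" using p prime_CHAR_semidom by blast
  have mid: "sc (of_nat (?p choose k)) (B k (?p - k)) = 0" if "0 < k" "k < ?p" for k
  proof -
    have "?p dvd (?p choose k)"
      using that prime by (intro dvd_choose_prime) auto
    hence "of_nat (?p choose k) = (0::'a)" by (simp add: of_nat_eq_0_iff_char_dvd)
    thus ?thesis by (simp add: sc0)
  qed
  have "(d3 ^^ ?p) (b u v) = (\<Sum>k\<in>{0, ?p}. sc (of_nat (?p choose k)) (B k (?p - k)))"
    unfolding gen by (rule sum.mono_neutral_right) (use mid in auto)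
  also have "\<dots> = B ?p 0 + B 0 ?p" using p by (simp add: sc add.commute)
  finally show ?thesis by (simp add: B_def)
qed

lemma W_power:
  fixes D :: "'a::field vfield"
  assumes "CHAR('a) > 0" "D \<in> W_carrier"
  shows "D ^^ CHAR('a) \<in> W_carrier"
proof -
  have add: "(D ^^ n) (h + k) = (D ^^ n) h + (D ^^ n) k"
    and scale: "(D ^^ n) (scale2 c h) = scale2 c ((D ^^ n) h)" for n h k c
    using assms(2) by (induction n) auto
  have "(D ^^ CHAR('a)) (h * k) = (D ^^ CHAR('a)) h * k + h * (D ^^ CHAR('a)) k" for h k
    by (rule leibniz_power[where sc = scale2 and P = "\<lambda>_. True" and Q = "\<lambda>_. True"
        and ?d1.0 = D and ?d2.0 = D and b = "(*)"])
      (use assms in \<open>auto simp: scale2_left vf_mult\<close>)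
  from derivation_vf[OF add this scale] show ?thesis by blast
qed

section \<open>Symmetric powers of the module of one-forms\<close>

text \<open>A symmetric differential form \<open>\<Sum>k. s k dx\<^sup>l\<^sup>-\<^sup>k dy\<^sup>k\<close> of degree \<open>l\<close> is represented by its
  coefficient function; \<open>rho l D\<close> is the Lie derivative along \<open>D\<close>, \<open>mu\<close> the multiplication
  by a one-form, \<open>dT\<close> the exterior derivative of a function, and \<open>theta D\<close> the Lie derivative on
  two-forms \<open>h dx \<and> dy\<close>.\<close>

type_synonym 'a form = "nat \<Rightarrow> 'a O2"

definition shift :: "'a::field form \<Rightarrow> 'a form" where
  "shift s k = (case k of 0 \<Rightarrow> 0 | Suc n \<Rightarrow> s n)"

definition scT :: "'a::field \<Rightarrow> 'a form \<Rightarrow> 'a form" where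
  "scT c s = (\<lambda>k. scale2 c (s k))"

text \<open>The formula expands D(dx) = d(D x) and D(dy) = d(D y). The last two summands are the
  contributions of the neighbouring monomials with one dy less and one dy more.\<close>

definition rho :: "nat \<Rightarrow> 'a::field vfield \<Rightarrow> 'a form \<Rightarrow> 'a form" where
  "rho l D s = (\<lambda>k. D (s k)
      + scale2 (of_nat l - of_nat k) (dx (D varx) * s k)
      + scale2 (of_nat k) (dy (D vary) * s k)
      + scale2 (of_nat l + 1 - of_nat k) (dy (D varx) * shift s k)
      + scale2 (of_nat k + 1) (dx (D vary) * s (Suc k)))"

definition mu :: "'a::field form \<Rightarrow> 'a form \<Rightarrow> 'a form" where
  "mu a s = (\<lambda>k. a 0 * s k + a 1 * shift s k)"

definition dT :: "'a::field O2 \<Rightarrow> 'a form" where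
  "dT h = (\<lambda>k. if k = 0 then dx h else if k = 1 then dy h else 0)"

definition wedge :: "'a::field form \<Rightarrow> 'a form \<Rightarrow> 'a O2" where
  "wedge a b = a 0 * b 1 - a 1 * b 0"

definition theta :: "'a::field vfield \<Rightarrow> 'a O2 \<Rightarrow> 'a O2" where
  "theta D h = D h + (dx (D varx) + dy (D vary)) * h"

definition Sym :: "nat \<Rightarrow> 'a::field form set" where
  "Sym l = {s. \<forall>k>l. s k = 0}"

abbreviation lie :: "'a::field vfield \<Rightarrow> 'a vfield \<Rightarrow> 'a vfield" where
  "lie D E \<equiv> (\<lambda>h. D (E h) - E (D h))"

lemma shift_simps [simp]: "shift s 0 = 0" "shift s (Suc k) = s k"
  "shift (s + t) k = shift s k + shift t k" "shift (s - t) k = shift s k - shift t k"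
  "shift 0 k = 0" "shift (\<lambda>k. scale2 c (s k)) k = scale2 c (shift s k)"
  by (auto simp: shift_def split: nat.split)

lemma scT_simps [simp]:
  "scT c (s + t) = scT c s + scT c t" "scT c (s - t) = scT c s - scT c t" "scT 1 s = s"
  "scT c 0 = 0" "scT 0 s = 0" "scT c (scT d s) = scT (c * d) s"
  by (auto simp: scT_def fun_eq_iff)

lemma scT_left: "scT (c + d) s = scT c s + scT d s"
  by (auto simp: scT_def fun_eq_iff scale2_left)

lemma scale2_2: "scale2 2 f = f + f"
  using scale2_left(1)[of 1 1 f] by simp

lemma SymI: "(\<And>k. k > l \<Longrightarrow> s k = 0) \<Longrightarrow> s \<in> Sym l"
  and SymD: "s \<in> Sym l \<Longrightarrow> k > l \<Longrightarrow> s k = 0"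
  by (auto simp: Sym_def)

lemma Sym_simps [simp]:
  "0 \<in> Sym l" "s \<in> Sym l \<Longrightarrow> t \<in> Sym l \<Longrightarrow> s + t \<in> Sym l"
  "s \<in> Sym l \<Longrightarrow> t \<in> Sym l \<Longrightarrow> s - t \<in> Sym l" "s \<in> Sym l \<Longrightarrow> scT c s \<in> Sym l"
  "dT h \<in> Sym 1" "dT h \<in> Sym (Suc 0)"
  by (auto simp: Sym_def scT_def dT_def)

lemma rho_Sym:
  assumes "D \<in> W_carrier" "s \<in> Sym l"
  shows "rho l D s \<in> Sym l"
proof (rule SymI)
  fix k assume k: "k > l"
  have D0: "D 0 = 0" using assms by auto
  show "rho l D s k = 0"
  proof (cases "k = Suc l")
    \<comment> \<open>Here the shifted coefficient \<open>s l\<close> may be nonzero, but its factor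
      l + 1 - k vanishes.\<close>
    case True
    thus ?thesis using k assms(2) by (simp add: rho_def Sym_def D0)
  next
    case False
    hence "shift s k = 0" using k assms(2) by (auto simp: shift_def Sym_def split: nat.split)
    thus ?thesis using k assms(2) by (simp add: rho_def Sym_def D0)
  qed
qed

lemma rho_linear:
  assumes "D \<in> W_carrier"
  shows "rho l D (s + t) = rho l D s + rho l D t" "rho l D (s - t) = rho l D s - rho l D t"
    "rho l D 0 = 0" "rho l D (scT c s) = scT c (rho l D s)"
  using assms by (auto simp: rho_def scT_def fun_eq_iff algebra_simps)

lemma rho_vadd: "rho l (vadd D E) s = rho l D s + rho l E s"
  by (auto simp: rho_def vadd_def fun_eq_iff algebra_simps)

lemma rho_vscale: "rho l (vscale c D) s = scT c (rho l D s)"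
  by (auto simp: rho_def vscale_def scT_def fun_eq_iff algebra_simps)

text \<open>One-forms generate all symmetric forms over the functions, so with
  \<open>Sym_Suc_cases\<close> this rule carries identities from degree l to degree l + 1. The
  assumption on \<open>a\<close> removes \<open>a 2\<close>, which \<open>mu\<close> ignores but
  \<open>rho 1 D a\<close> would see.\<close>

lemma rho_mu:
  assumes D: "D \<in> W_carrier" and a: "a \<in> Sym 1"
  shows "rho (Suc l) D (mu a s) = mu (rho 1 D a) s + mu a (rho l D s)"
proof -
  obtain f g where [simp]: "D = vf f g" using D by auto
  have a2: "a (Suc (Suc 0)) = 0" using a by (auto simp: Sym_def)
  show ?thesis
  proof
    fix k
    show "rho (Suc l) D (mu a s) k = (mu (rho 1 D a) s + mu a (rho l D s)) k"
    proof (cases k)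
      case 0
      thus ?thesis by (simp add: rho_def mu_def vf_mult a2 scale2_left algebra_simps)
    next
      case (Suc n)
      thus ?thesis by (simp add: rho_def mu_def vf_mult a2 scale2_left scale2_2 algebra_simps)
    qed
  qed
qed

text \<open>Lie derivatives commute with the exterior derivative; on the generators dx and dy this
  reduces every identity to one for functions.\<close>

lemma rho_dT:
  assumes "D \<in> W_carrier"
  shows "rho 1 D (dT h) = dT (D h)"
proof
  fix k
  obtain f g where D: "D = vf f g" using assms by auto
  show "rho 1 D (dT h) k = dT (D h) k"
  proof (cases k)
    case 0
    thus ?thesis unfolding D
      by (simp add: rho_def dT_def) (simp add: vf_def dx_mult dy_dx algebra_simps)
  next
    case (Suc n)
    thus ?thesis unfolding D
      by (cases n) (simp_all add: rho_def dT_def, simp add: vf_def dy_mult dy_dx algebra_simps)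
  qed
qed

lemma mu_linear: "mu (a + b) s = mu a s + mu b s" "mu a (s + t) = mu a s + mu a t"
  "mu (a - b) s = mu a s - mu b s" "mu a (s - t) = mu a s - mu a t"
  by (auto simp: mu_def fun_eq_iff algebra_simps)

lemma Sym_Suc_cases:
  assumes "s \<in> Sym (Suc l)"
  obtains s1 s2 where "s1 \<in> Sym l" "s2 \<in> Sym l" "s = mu (dT varx) s1 + mu (dT vary) s2"
proof (rule that)
  \<comment> \<open>Every monomial except dy^{l+1} is divisible by dx, so the dy part only has to
    supply that one.\<close>
  let ?s1 = "\<lambda>k. if k \<le> l then s k else 0" and ?s2 = "\<lambda>k. if k = l then s (Suc l) else 0"
  show "?s1 \<in> Sym l" "?s2 \<in> Sym l" by (auto simp: Sym_def)
  show "s = mu (dT varx) ?s1 + mu (dT vary) ?s2"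
  proof
    fix k
    show "s k = (mu (dT varx) ?s1 + mu (dT vary) ?s2) k"
      using assms by (cases k) (auto simp: mu_def dT_def Sym_def)
  qed
qed

lemma rho_Sym0: "D \<in> W_carrier \<Longrightarrow> s \<in> Sym 0 \<Longrightarrow> rho 0 D s = (\<lambda>k. if k = 0 then D (s 0) else 0)"
  using rho_Sym[of D s 0] by (auto simp: rho_def Sym_def fun_eq_iff)

lemma lie_W: "D \<in> W_carrier \<Longrightarrow> E \<in> W_carrier \<Longrightarrow> lie D E \<in> W_carrier"
  by (auto simp: bracket_vf) blast

text \<open>Induction on the degree: on a product of dh with t the identity holds for dh by
  \<open>rho_dT\<close> and for t by induction, and the mixed terms of the two compositions
  cancel.\<close>

lemma rho_lie:
  assumes D: "D \<in> W_carrier" and E: "E \<in> W_carrier" and "s \<in> Sym l"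
  shows "rho l (lie D E) s = rho l D (rho l E s) - rho l E (rho l D s)"
  using assms(3)
proof (induction l arbitrary: s)
  case 0
  have "rho 0 D s \<in> Sym 0" "rho 0 E s \<in> Sym 0" using rho_Sym[OF D] rho_Sym[OF E] 0 by blast+
  with 0 show ?case
    by (simp only: rho_Sym0 D E lie_W) (auto simp: fun_eq_iff)
next
  case (Suc l)
  note DE = lie_W[OF D E]
  note lin = rho_linear[OF D] rho_linear[OF E] rho_linear[OF DE]
  have *: "rho (Suc l) (lie D E) (mu (dT h) t)
      = rho (Suc l) D (rho (Suc l) E (mu (dT h) t)) - rho (Suc l) E (rho (Suc l) D (mu (dT h) t))"
    if "t \<in> Sym l" for h t
    using that rho_Sym[OF D that] rho_Sym[OF E that]
    by (simp only: rho_mu D E DE Sym_simps rho_dT lin Suc.IH mu_linear)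
      (simp add: mu_def fun_eq_iff dT_def algebra_simps)
  from Suc.prems obtain s1 s2 where
    "s1 \<in> Sym l" "s2 \<in> Sym l" "s = mu (dT varx) s1 + mu (dT vary) s2"
    by (rule Sym_Suc_cases)
  thus ?case by (simp only: lin *) (simp add: algebra_simps)
qed

text \<open>The same induction; here the mixed terms disappear by
  \<open>leibniz_power\<close>.\<close>

lemma rho_power:
  fixes D :: "'a::field vfield"
  assumes p: "CHAR('a) > 0" and D: "D \<in> W_carrier" and "s \<in> Sym l"
  shows "rho l (D ^^ CHAR('a)) s = (rho l D ^^ CHAR('a)) s"
  using assms(3)
proof (induction l arbitrary: s)
  case 0
  have "(rho 0 D ^^ n) s = (\<lambda>k. if k = 0 then (D ^^ n) (s 0) else 0)" for n
  proof (induction n)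
    case 0
    show ?case using \<open>s \<in> Sym 0\<close> by (auto simp: Sym_def fun_eq_iff)
  next
    case (Suc n)
    have "(\<lambda>k. if k = 0 then (D ^^ n) (s 0) else 0) \<in> Sym 0" by (auto simp: Sym_def)
    hence "rho 0 D (\<lambda>k. if k = 0 then (D ^^ n) (s 0) else 0) =
        (\<lambda>k. if k = 0 then (D ^^ Suc n) (s 0) else 0)"
      by (subst rho_Sym0[OF D]) (auto simp: fun_eq_iff)
    thus ?case by (simp add: Suc)
  qed
  thus ?case using W_power[OF p D] 0 by (simp only: rho_Sym0)
next
  case (Suc l)
  note Dp = W_power[OF p D]
  have d: "(rho 1 D ^^ n) (dT h) = dT ((D ^^ n) h)" for n h
    by (induction n) (simp_all add: rho_dT[OF D, simplified])
  have *: "rho (Suc l) (D ^^ CHAR('a)) (mu (dT h) t) = (rho (Suc l) D ^^ CHAR('a)) (mu (dT h) t)"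
    if t: "t \<in> Sym l" for h t
  proof -
    have "(rho (Suc l) D ^^ CHAR('a)) (mu (dT h) t) =
        mu ((rho 1 D ^^ CHAR('a)) (dT h)) t + mu (dT h) ((rho l D ^^ CHAR('a)) t)"
      by (rule leibniz_power[where sc = scT and P = "\<lambda>a. a \<in> Sym 1" and Q = "\<lambda>_. True"
          and b = mu and ?d1.0 = "rho 1 D" and ?d2.0 = "rho l D"])
        (simp_all add: rho_linear[OF D] rho_mu[OF D] scT_left p rho_Sym[OF D] del: One_nat_def)
    thus ?thesis by (simp only: rho_mu Dp Sym_simps d rho_dT Suc.IH t)
  qed
  have add: "(rho (Suc l) D ^^ n) (s + t) = (rho (Suc l) D ^^ n) s + (rho (Suc l) D ^^ n) t" for n s t
    by (induction n) (simp_all only: funpow.simps o_apply id_apply rho_linear[OF D])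
  from Suc.prems obtain s1 s2 where
    "s1 \<in> Sym l" "s2 \<in> Sym l" "s = mu (dT varx) s1 + mu (dT vary) s2"
    by (rule Sym_Suc_cases)
  thus ?case by (simp only: rho_linear[OF Dp] add *)
qed

text \<open>Every two-form is a product of a one-form with dy, so this rule deduces
  \<open>theta_lie\<close> and \<open>theta_power\<close> from the results on one-forms.\<close>

lemma theta_wedge:
  assumes "D \<in> W_carrier" "a \<in> Sym 1" "b \<in> Sym 1"
  shows "theta D (wedge a b) = wedge (rho 1 D a) b + wedge a (rho 1 D b)"
proof -
  obtain f g where [simp]: "D = vf f g" using assms by auto
  have "a (Suc (Suc 0)) = 0" "b (Suc (Suc 0)) = 0" using assms by (auto simp: Sym_def)
  thus ?thesis by (simp add: theta_def wedge_def rho_def vf_mult algebra_simps)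
qed

lemma theta_linear:
  assumes "D \<in> W_carrier"
  shows "theta D (h + k) = theta D h + theta D k" "theta D (h - k) = theta D h - theta D k"
    "theta D 0 = 0" "theta D (scale2 c h) = scale2 c (theta D h)"
  using assms by (auto simp: theta_def algebra_simps)

lemma theta_vadd: "theta (vadd D E) h = theta D h + theta E h"
  and theta_vscale: "theta (vscale c D) h = scale2 c (theta D h)"
  by (auto simp: theta_def vadd_def vscale_def algebra_simps)

lemma wedge_linear: "wedge (a + b) s = wedge a s + wedge b s" "wedge a (s + t) = wedge a s + wedge a t"
  "wedge (a - b) s = wedge a s - wedge b s" "wedge a (s - t) = wedge a s - wedge a t"
  by (auto simp: wedge_def algebra_simps)

lemma two_form_cases:
  obtains a where "a \<in> Sym 1" "h = wedge a (dT vary)"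
  by (rule that[of "\<lambda>k. if k = 0 then h else 0"]) (auto simp: Sym_def wedge_def dT_def)

lemma theta_lie:
  assumes D: "D \<in> W_carrier" and E: "E \<in> W_carrier"
  shows "theta (lie D E) h = theta D (theta E h) - theta E (theta D h)"
proof -
  obtain a where a: "a \<in> Sym 1" and h: "h = wedge a (dT vary)" by (rule two_form_cases)
  show ?thesis unfolding h using rho_Sym[OF D a] rho_Sym[OF E a] a
    by (simp only: theta_wedge D E lie_W Sym_simps rho_Sym rho_lie theta_linear wedge_linear) simp
qed

lemma theta_power:
  fixes D :: "'a::field vfield"
  assumes p: "CHAR('a) > 0" and D: "D \<in> W_carrier"
  shows "theta (D ^^ CHAR('a)) h = (theta D ^^ CHAR('a)) h"
proof -
  obtain a where a: "a \<in> Sym 1" and h: "h = wedge a (dT vary)" by (rule two_form_cases)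
  have "(theta D ^^ CHAR('a)) h = wedge ((rho 1 D ^^ CHAR('a)) a) (dT vary)
      + wedge a ((rho 1 D ^^ CHAR('a)) (dT vary))"
    unfolding h
    by (rule leibniz_power[where sc = scale2 and P = "\<lambda>a. a \<in> Sym 1" and Q = "\<lambda>a. a \<in> Sym 1"
          and b = wedge and ?d1.0 = "rho 1 D" and ?d2.0 = "rho 1 D"])
      (simp_all add: theta_linear[OF D] theta_wedge[OF D] scale2_left p a rho_Sym[OF D] del: One_nat_def)
  thus ?thesis unfolding h
    using a by (simp only: rho_power[OF p D, symmetric] theta_wedge W_power[OF p D] Sym_simps)
qed

section \<open>The Lie algebra \<open>L\<close>\<close>

text \<open>\<open>L\<close> consists of the vector fields whose Lie derivative kills the two-form
  \<open>\<Lambda>\<^sup>-\<^sup>1 dx \<and> dy\<close>, where \<open>\<Lambda>\<^sup>-\<^sup>1 = 1 + x\<^sup>p\<^sup>-\<^sup>1 y\<^sup>p\<^sup>-\<^sup>1\<close>.  This makes the closure under brackets and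
  \<open>p\<close>-th powers evident.  The classes of \<open>\<Gamma>\<close> and \<open>\<Theta>\<close> account for the first de Rham
  cohomology of \<open>O(2;1)\<close>.\<close>

definition Lam_inv :: "'a::field O2" where
  "Lam_inv = 1 + monom2 (CHAR('a) - 1) (CHAR('a) - 1)"

locale char_gt3 =
  fixes ty :: "'a::field itself"
  assumes char: "CHAR('a) > 3"
begin

lemma p0: "CHAR('a) > 0" using char by simp

lemma Lam_inv: "Lam * Lam_inv = (1 :: 'a O2)" "Lam_inv * Lam = (1 :: 'a O2)"
proof -
  have "monom2 (CHAR('a) - 1) (CHAR('a) - 1) * monom2 (CHAR('a) - 1) (CHAR('a) - 1) = (0 :: 'a O2)"
    using char by (intro O2_eqI) (simp add: monom2_mult coeff2_monom2)
  thus "Lam * Lam_inv = (1 :: 'a O2)" by (simp add: Lam_def Lam_inv_def algebra_simps)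
  thus "Lam_inv * Lam = (1 :: 'a O2)" by (simp add: mult.commute)
qed

text \<open>The monomial x^{p-1} y^{p-1} spans the socle: every monomial of positive degree
  annihilates it.\<close>

lemma Lam_mult_monom2:
  assumes "a > 0 \<or> b > 0"
  shows "Lam * monom2 a b = (monom2 a b :: 'a O2)" "Lam_inv * monom2 a b = (monom2 a b :: 'a O2)"
proof -
  have "monom2 (CHAR('a) - 1) (CHAR('a) - 1) * monom2 a b = (0 :: 'a O2)"
    using char assms by (intro O2_eqI) (auto simp add: monom2_mult coeff2_monom2)
  thus "Lam * monom2 a b = (monom2 a b :: 'a O2)" "Lam_inv * monom2 a b = (monom2 a b :: 'a O2)"
    by (simp_all add: Lam_def Lam_inv_def algebra_simps)
qed

text \<open>Cartan's formula for top forms: the Lie derivative is the exterior derivative of the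
  contraction. It turns the condition \<open>theta D Lam_inv = 0\<close> into closedness of a
  one-form.\<close>

lemma theta_vf: "theta (vf f g) h = dx (h * f) + dy (h * g)"
  by (simp add: theta_def) (simp add: vf_def dx_mult dy_mult algebra_simps)

text \<open>The hypothesis says that the one-form G dx - F dy is closed. The conclusion computes the
  first de Rham cohomology: integration fails exactly at x^{p-1} dx and y^{p-1} dy.\<close>

lemma closed_one_form:
  fixes F G :: "'a O2"
  assumes "dx F + dy G = 0"
  obtains u a b where
    "F = - dy u - scale2 b (monom2 0 (CHAR('a) - 1))"
    "G = dx u + scale2 a (monom2 (CHAR('a) - 1) 0)"
proof -
  let ?p = "CHAR('a)"
  have nz: "of_nat n \<noteq> (0::'a)" if "0 < n" "n < ?p" for n
    using that by (simp add: of_nat_eq_0_iff_char_dvd nat_dvd_not_less)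
  have top: "of_nat ?p = (0::'a)" by simp
  have rel: "of_nat (Suc i) * coeff2 F (Suc i) j + of_nat (Suc j) * coeff2 G i (Suc j) = 0" for i j
    using arg_cong[OF assms, of "\<lambda>f. coeff2 f i j"] by (simp del: of_nat_Suc)
  \<comment> \<open>The primitive: G is integrated along x, and the part free of x, which G does not
    see, comes from integrating F along y.\<close>
  define c where "c i j = (if i < ?p \<and> j < ?p then
      if i > 0 then coeff2 G (i - 1) j / of_nat i
      else if j > 0 then - coeff2 F 0 (j - 1) / of_nat j else 0 else 0)" for i j
  define u where "u = Abs_O2 c"
  have u: "coeff2 u i j = c i j" for i j
    unfolding u_def by (subst Abs_O2_inverse) (auto simp: c_def)
  have G: "coeff2 (dx u) i j = (if i = ?p - 1 then 0 else coeff2 G i j)" if "i < ?p" "j < ?p" for i j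
  proof (cases "i = ?p - 1")
    case True
    hence "Suc i = ?p" using that by simp
    thus ?thesis using True by (simp add: u c_def)
  next
    case False
    hence "Suc i < ?p" using that by simp
    thus ?thesis using False that nz[of "Suc i"] by (simp add: u c_def del: of_nat_Suc)
  qed
  have F: "coeff2 (dy u) i j = (if j = ?p - 1 then 0 else - coeff2 F i j)" if "i < ?p" "j < ?p" for i j
  proof (cases "j = ?p - 1")
    case True
    hence "Suc j = ?p" using that by simp
    thus ?thesis using True by (simp add: u c_def)
  next
    case False
    hence j: "Suc j < ?p" using that by simp
    show ?thesis
    proof (cases i)
      case 0
      thus ?thesis using False that j nz[of "Suc j"] by (simp add: u c_def del: of_nat_Suc)
    next
      case (Suc n)
      have "of_nat (Suc j) * coeff2 G n (Suc j) = - (of_nat i * coeff2 F i j)"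
        using rel[of n j] Suc by (simp add: add_eq_0_iff del: of_nat_Suc)
      thus ?thesis using False that j nz[of i] Suc by (simp add: u c_def del: of_nat_Suc)
    qed
  qed
  \<comment> \<open>Terms with exponent p - 1 have no primitive. Closedness, with the other summand
    multiplied by p = 0, leaves only the pure power.\<close>
  have G0: "coeff2 G (?p - 1) j = 0" if "0 < j" "j < ?p" for j
    using rel[of "?p - 1" "j - 1"] that nz[of j] char by (simp del: of_nat_Suc)
  have F0: "coeff2 F i (?p - 1) = 0" if "0 < i" "i < ?p" for i
    using rel[of "i - 1" "?p - 1"] that nz[of i] char by (simp del: of_nat_Suc)
  show ?thesis
  proof (rule that)
    show "F = - dy u - scale2 (- coeff2 F 0 (?p - 1)) (monom2 0 (?p - 1))"
    proof (rule O2_eqI)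
      fix i j assume ij: "i < ?p" "j < ?p"
      show "coeff2 F i j = coeff2 (- dy u - scale2 (- coeff2 F 0 (?p - 1)) (monom2 0 (?p - 1))) i j"
        using F[OF ij] F0[of i] ij char
        by (auto simp del: coeff2_simps(7) simp: coeff2_monom2)
    qed
    show "G = dx u + scale2 (coeff2 G (?p - 1) 0) (monom2 (?p - 1) 0)"
    proof (rule O2_eqI)
      fix i j assume ij: "i < ?p" "j < ?p"
      show "coeff2 G i j = coeff2 (dx u + scale2 (coeff2 G (?p - 1) 0) (monom2 (?p - 1) 0)) i j"
        using G[OF ij] G0[of j] ij char
        by (auto simp del: coeff2_simps(6) simp: coeff2_monom2)
    qed
  qed
qed

lemma Gam_W: "(Gam :: 'a vfield) = vf 0 (monom2 (CHAR('a) - 1) 0)"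
  and Theta_W: "(Theta :: 'a vfield) = vf (- monom2 0 (CHAR('a) - 1)) 0"
  by (simp_all add: Gam_def Theta_def)

lemma L_iff: "(D :: 'a vfield) \<in> L_carrier \<longleftrightarrow> D \<in> W_carrier \<and> theta D Lam_inv = 0"
proof
  assume "D \<in> L_carrier"
  then obtain u a b where D: "D = vadd (D_Lam u) (vadd (vscale a Gam) (vscale b Theta))"
    by (auto simp: L_carrier_def H_carrier_def)
  have "theta (D_Lam u) Lam_inv = 0"
    unfolding D_Lam_def theta_vf
    by (simp add: mult.assoc[symmetric] Lam_inv dy_dx)
  moreover have "theta Gam (Lam_inv :: 'a O2) = 0" "theta Theta (Lam_inv :: 'a O2) = 0"
    using char by (simp_all add: Gam_W Theta_W theta_vf Lam_mult_monom2)
  ultimately have "theta D Lam_inv = 0"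
    by (simp only: D theta_vadd theta_vscale) simp
  moreover have "D \<in> W_carrier"
    unfolding D D_Lam_def Gam_W Theta_W vadd_vf vscale_vf by blast
  ultimately show "D \<in> W_carrier \<and> theta D Lam_inv = 0" by blast
next
  assume "D \<in> W_carrier \<and> theta D Lam_inv = 0"
  then obtain f g where D: "D = vf f g" and "theta (vf f g) Lam_inv = 0" by auto
  hence "dx (Lam_inv * f) + dy (Lam_inv * g) = 0" by (simp add: theta_vf)
  then obtain u a b where u:
    "Lam_inv * f = - dy u - scale2 b (monom2 0 (CHAR('a) - 1))"
    "Lam_inv * g = dx u + scale2 a (monom2 (CHAR('a) - 1) 0)"
    by (rule closed_one_form)
  have "f = Lam * (Lam_inv * f)" "g = Lam * (Lam_inv * g)"
    by (simp_all add: mult.assoc[symmetric] Lam_inv)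
  hence fg: "f = Lam * (- dy u - scale2 b (monom2 0 (CHAR('a) - 1)))"
      "g = Lam * (dx u + scale2 a (monom2 (CHAR('a) - 1) 0))"
    by (simp_all only: u)
  \<comment> \<open>\<open>Lam\<close> fixes x^{p-1} and y^{p-1}, so the two cohomology classes turn
    into \<open>Gam\<close> and \<open>Theta\<close> unchanged.\<close>
  hence f: "f = - (Lam * dy u) + scale2 b (- monom2 0 (CHAR('a) - 1))"
    and g: "g = Lam * dx u + scale2 a (monom2 (CHAR('a) - 1) 0)"
    using char by (simp_all add: algebra_simps Lam_mult_monom2)
  have "D = vadd (D_Lam u) (vadd (vscale a Gam) (vscale b Theta))"
    unfolding D f g by (simp add: D_Lam_def Gam_W Theta_W vadd_vf vscale_vf)
  thus "D \<in> L_carrier" by (auto simp: L_carrier_def H_carrier_def)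
qed

end

section \<open>Restricted enveloping algebras and their modules\<close>

lemma poly_mapping_induct_add [consumes 1, case_names zero single add]:
  assumes "Poly_Mapping.keys a \<subseteq> S" and zero: "P 0"
    and single: "\<And>w c. w \<in> S \<Longrightarrow> P (Poly_Mapping.single w c)"
    and add: "\<And>a b. Poly_Mapping.keys a \<subseteq> S \<Longrightarrow> Poly_Mapping.keys b \<subseteq> S \<Longrightarrow> P a \<Longrightarrow> P b \<Longrightarrow> P (a + b)"
  shows "P (a :: 'w \<Rightarrow>\<^sub>0 'c::ab_group_add)"
  using assms(1)
proof (induction "card (Poly_Mapping.keys a)" arbitrary: a rule: less_induct)
  case less
  show ?case
  proof (cases "a = 0")
    case False
    then obtain w where w: "w \<in> Poly_Mapping.keys a" by (meson keys_eq_empty ex_in_conv)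
    let ?s = "Poly_Mapping.single w (Poly_Mapping.lookup a w)"
    have sub: "Poly_Mapping.keys (a - ?s) \<subseteq> Poly_Mapping.keys a - {w}"
      by (auto simp: in_keys_iff lookup_minus lookup_single when_def split: if_splits)
    hence "card (Poly_Mapping.keys (a - ?s)) < card (Poly_Mapping.keys a)"
      by (intro psubset_card_mono) (use w in auto)
    hence "P (a - ?s)" using less sub by blast
    hence "P (?s + (a - ?s))"
      using w less.prems sub by (intro add single) auto
    thus ?thesis by simp
  qed (simp add: zero)
qed

lemma poly_mapping_induct [case_names zero single add]:
  assumes "P 0" "\<And>w c. P (Poly_Mapping.single w c)" "\<And>a b. P a \<Longrightarrow> P b \<Longrightarrow> P (a + b)"
  shows "P (a :: 'w \<Rightarrow>\<^sub>0 'c::ab_group_add)"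
  using subset_UNIV by (rule poly_mapping_induct_add) (use assms in auto)

text \<open>Only additivity in the coefficient is asked of \<open>\<phi>\<close>, so that one
  construction serves field coefficients (free algebras) and integer coefficients (free abelian
  groups).\<close>

definition pm_extend :: "('w \<Rightarrow> 'c::ab_group_add \<Rightarrow> 'b::ab_group_add) \<Rightarrow> ('w \<Rightarrow>\<^sub>0 'c) \<Rightarrow> 'b" where
  "pm_extend \<phi> a = (\<Sum>w\<in>Poly_Mapping.keys a. \<phi> w (Poly_Mapping.lookup a w))"

context
  fixes \<phi> :: "'w \<Rightarrow> 'c::ab_group_add \<Rightarrow> 'b::ab_group_add"
  assumes add: "\<And>w c d. \<phi> w (c + d) = \<phi> w c + \<phi> w d"
begin

lemma pm_extend_add: "pm_extend \<phi> (a + b) = pm_extend \<phi> a + pm_extend \<phi> b"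
proof -
  have "\<phi> w 0 = 0" for w using add[of w 0 0] by simp
  thus ?thesis unfolding pm_extend_def by (intro setsum_keys_plus_distrib) (auto simp: add)
qed

lemma pm_extend_0: "pm_extend \<phi> 0 = 0"
  by (simp add: pm_extend_def)

lemma pm_extend_diff: "pm_extend \<phi> (a - b) = pm_extend \<phi> a - pm_extend \<phi> b"
  using pm_extend_add[of "a - b" b] by (simp add: algebra_simps)

lemma pm_extend_single: "pm_extend \<phi> (Poly_Mapping.single w c) = \<phi> w c"
proof -
  have "\<phi> w 0 = 0" for w using add[of w 0 0] by simp
  thus ?thesis by (simp add: pm_extend_def)
qed

end

section \<open>Free associative algebras\<close>

lemma list_plus [simp]: "(v :: 'g list) + w = v @ w" and list_zero [simp]: "(0 :: 'g list) = []"
  by (simp_all add: plus_list_def zero_list_def)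

lemma fmap_pm_extend: "fmap_algebra f = pm_extend (\<lambda>w c. Poly_Mapping.single (map f w) c)"
  by (rule ext) (simp add: fmap_algebra_def pm_extend_def)

lemma fmap_simps:
  "fmap_algebra f (a + b) = fmap_algebra f a + fmap_algebra f b"
  "fmap_algebra f (a - b) = fmap_algebra f a - fmap_algebra f b"
  "fmap_algebra f 0 = 0"
  "fmap_algebra f (Poly_Mapping.single w c) = Poly_Mapping.single (map f w) c"
  by (simp_all add: fmap_pm_extend pm_extend_add pm_extend_diff pm_extend_0 pm_extend_single single_add)

lemma fmap_mult: "fmap_algebra f (a * b) = fmap_algebra f a * fmap_algebra f b"
proof (induction a rule: poly_mapping_induct)
  case (single w c)
  show ?case
    by (induction b rule: poly_mapping_induct)
      (simp_all add: fmap_simps mult_single distrib_left)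
qed (simp_all add: fmap_simps distrib_right)

lemma fmap_generators:
  "fmap_algebra f (fgen x) = fgen (f x)" "fmap_algebra f (fscal c) = fscal c" "fmap_algebra f 1 = 1"
  unfolding fgen_def fscal_def single_one[symmetric] by (simp_all only: fmap_simps list_zero list.map)

lemma fmap_power: "fmap_algebra f (a ^ n) = fmap_algebra f a ^ n"
  by (induction n) (simp_all add: fmap_generators fmap_mult)

lemma fmap_id: "fmap_algebra (\<lambda>x. x) a = a"
  by (induction a rule: poly_mapping_induct) (simp_all add: fmap_simps)

lemma free_algebra_simps [simp]:
  "monoid.mult (free_algebra S) = (*)" "monoid.one (free_algebra S) = 1"
  "ring.zero (free_algebra S) = 0" "ring.add (free_algebra S) = (+)"
  by (simp_all add: free_algebra_def)

lemma free_carrier: "a \<in> carrier (free_algebra S) \<longleftrightarrow> Poly_Mapping.keys a \<subseteq> lists S"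
  by (simp add: free_algebra_def)

lemma free_closed [simp]:
  "a \<in> carrier (free_algebra S) \<Longrightarrow> b \<in> carrier (free_algebra S) \<Longrightarrow> a + b \<in> carrier (free_algebra S)"
  "a \<in> carrier (free_algebra S) \<Longrightarrow> b \<in> carrier (free_algebra S) \<Longrightarrow> a - b \<in> carrier (free_algebra S)"
  "a \<in> carrier (free_algebra S) \<Longrightarrow> b \<in> carrier (free_algebra S) \<Longrightarrow> a * b \<in> carrier (free_algebra S)"
  "a \<in> carrier (free_algebra S) \<Longrightarrow> - a \<in> carrier (free_algebra S)"
  "0 \<in> carrier (free_algebra S)" "1 \<in> carrier (free_algebra S)"
  "fscal c \<in> carrier (free_algebra S)" "x \<in> S \<Longrightarrow> fgen x \<in> carrier (free_algebra S)"
proof -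
  assume ab: "a \<in> carrier (free_algebra S)" "b \<in> carrier (free_algebra S)"
  show "a + b \<in> carrier (free_algebra S)" "a - b \<in> carrier (free_algebra S)"
    using ab keys_add[of a b] keys_diff[of a b] unfolding free_carrier by blast+
  show "a * b \<in> carrier (free_algebra S)"
    using ab keys_mult[of a b] unfolding free_carrier by (force simp: subset_iff)
qed (simp_all add: free_carrier fscal_def fgen_def)

lemma free_power_closed [simp]: "a \<in> carrier (free_algebra S) \<Longrightarrow> a ^ n \<in> carrier (free_algebra S)"
  by (induction n) auto

lemma ring_free_algebra: "ring (free_algebra S)"
proof (intro ringI abelian_groupI monoidI)
  fix a :: "'a list \<Rightarrow>\<^sub>0 'b" assume "a \<in> carrier (free_algebra S)"
  thus "\<exists>y\<in>carrier (free_algebra S). y \<oplus>\<^bsub>free_algebra S\<^esub> a = \<zero>\<^bsub>free_algebra S\<^esub>"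
    by (intro bexI[of _ "- a"]) auto
qed (auto simp: algebra_simps)

lemma free_a_inv:
  assumes "a \<in> carrier (free_algebra S)"
  shows "\<ominus>\<^bsub>free_algebra S\<^esub> a = - a"
proof -
  interpret ring "free_algebra S" by (rule ring_free_algebra)
  show ?thesis using assms by (intro minus_equality) auto
qed

lemma free_pow: "a [^]\<^bsub>free_algebra S\<^esub> (n::nat) = a ^ n"
proof -
  interpret ring "free_algebra S" by (rule ring_free_algebra)
  show ?thesis by (induction n) (simp_all add: power_commutes)
qed

lemma free_induct [consumes 1, case_names scal gen add]:
  assumes "a \<in> carrier (free_algebra S)"
    and scal: "\<And>c. P (fscal c)"
    and gen: "\<And>x a. x \<in> S \<Longrightarrow> a \<in> carrier (free_algebra S) \<Longrightarrow> P a \<Longrightarrow> P (fgen x * a)"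
    and add: "\<And>a b. a \<in> carrier (free_algebra S) \<Longrightarrow> b \<in> carrier (free_algebra S) \<Longrightarrow>
      P a \<Longrightarrow> P b \<Longrightarrow> P (a + b)"
  shows "P (a :: 'g list \<Rightarrow>\<^sub>0 'a::field)"
  using assms(1)[unfolded free_carrier]
proof (induction rule: poly_mapping_induct_add)
  case zero
  show ?case using scal[of 0] by (simp add: fscal_def)
next
  case (single w c)
  thus ?case
  proof (induction w)
    case Nil
    show ?case using scal[of c] by (simp add: fscal_def)
  next
    case (Cons x w)
    have "P (fgen x * Poly_Mapping.single w c)"
      using Cons by (intro gen) (auto simp: free_carrier)
    thus ?case by (simp add: fgen_def mult_single)
  qed
qed (auto intro: add simp: free_carrier)

lemma fscal_commute: "fscal c * a = a * (fscal c :: 'g list \<Rightarrow>\<^sub>0 'a::field)"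
  by (induction a rule: poly_mapping_induct)
    (simp_all add: fscal_def mult_single mult.commute distrib_left distrib_right)

lemma fscal_simps: "fscal (c + d) = fscal c + fscal d" "fscal (c * d) = fscal c * fscal d"
  "fscal 1 = 1" "fscal 0 = 0"
  by (simp_all add: fscal_def single_add mult_single flip: single_one)

section \<open>The algebras U(G) and u(G,0)\<close>

locale rlie =
  fixes G :: "('a::field, 'g) restricted_lie"
  assumes lie_closed: "x \<in> lie_carrier G \<Longrightarrow> y \<in> lie_carrier G \<Longrightarrow> lie_add G x y \<in> lie_carrier G"
      "x \<in> lie_carrier G \<Longrightarrow> lie_scale G c x \<in> lie_carrier G"
      "x \<in> lie_carrier G \<Longrightarrow> y \<in> lie_carrier G \<Longrightarrow> lie_bracket G x y \<in> lie_carrier G"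
      "x \<in> lie_carrier G \<Longrightarrow> lie_pmap G x \<in> lie_carrier G"
begin

abbreviation "FA \<equiv> free_algebra (lie_carrier G) :: ('g list \<Rightarrow>\<^sub>0 'a) ring"

sublocale FA: ring FA by (rule ring_free_algebra)

lemma U_relations_carrier: "U_relations G \<subseteq> carrier FA"
  by (auto simp: U_relations_def lie_closed)

lemma U_ideal: "ideal (U_ideal G) FA"
  unfolding U_ideal_def by (rule FA.genideal_ideal[OF U_relations_carrier])

sublocale UI: ideal "U_ideal G" FA by (rule U_ideal)

lemma ring_U: "ring (U_alg G)"
  unfolding U_alg_def by (rule UI.quotient_is_ring)

sublocale UA: ring "U_alg G" by (rule ring_U)

lemma U_class_fun: "U_class G = (+>\<^bsub>FA\<^esub>) (U_ideal G)"
  by (rule ext) (simp add: U_class_def)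

lemma U_class_hom_ring: "ring_hom_ring FA (U_alg G) (U_class G)"
  unfolding U_alg_def U_class_fun by (rule UI.rcos_ring_hom_ring)

sublocale Uh: ring_hom_ring FA "U_alg G" "U_class G" by (rule U_class_hom_ring)

lemma carrier_U: "carrier (U_alg G) = U_class G ` carrier FA"
  by (auto simp: U_alg_def FactRing_def A_RCOSETS_def' U_class_fun)

lemma u_relations_carrier: "u_relations G \<subseteq> carrier (U_alg G)"
  by (auto simp: u_relations_def lie_closed)

lemma u_ideal: "ideal (u_ideal G) (U_alg G)"
  unfolding u_ideal_def by (rule UA.genideal_ideal[OF u_relations_carrier])

sublocale uI: ideal "u_ideal G" "U_alg G" by (rule u_ideal)

lemma ring_u: "ring (u_alg G)"
  unfolding u_alg_def by (rule uI.quotient_is_ring)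

sublocale uA: ring "u_alg G" by (rule ring_u)

lemma u_proj_hom_ring: "ring_hom_ring (U_alg G) (u_alg G) ((+>\<^bsub>U_alg G\<^esub>) (u_ideal G))"
  unfolding u_alg_def by (rule uI.rcos_ring_hom_ring)

lemma u_class_fun: "u_class G = (+>\<^bsub>U_alg G\<^esub>) (u_ideal G) \<circ> U_class G"
  by (rule ext) (simp add: u_class_def)

lemma u_class_hom_ring: "ring_hom_ring FA (u_alg G) (u_class G)"
proof -
  interpret u: ring_hom_ring "U_alg G" "u_alg G" "(+>\<^bsub>U_alg G\<^esub>) (u_ideal G)"
    by (rule u_proj_hom_ring)
  show ?thesis unfolding u_class_fun
    by (intro ring_hom_ringI2 FA.ring_axioms uA.ring_axioms ring_hom_trans[OF Uh.homh u.homh])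
qed

sublocale uh: ring_hom_ring FA "u_alg G" "u_class G" by (rule u_class_hom_ring)

lemma carrier_u: "carrier (u_alg G) = u_class G ` carrier FA"
  by (auto simp: u_alg_def FactRing_def A_RCOSETS_def' u_class_fun carrier_U)

lemma u_algE:
  assumes "r \<in> carrier (u_alg G)"
  obtains a where "a \<in> carrier FA" "r = u_class G a"
  using assms by (auto simp: carrier_u)

lemma u_class_simps:
  assumes "a \<in> carrier FA" "b \<in> carrier FA"
  shows "u_class G (a + b) = u_class G a \<oplus>\<^bsub>u_alg G\<^esub> u_class G b"
    "u_class G (a * b) = u_class G a \<otimes>\<^bsub>u_alg G\<^esub> u_class G b"
    "u_class G (a - b) = u_class G a \<ominus>\<^bsub>u_alg G\<^esub> u_class G b"
proof -
  have "u_class G (- b) = \<ominus>\<^bsub>u_alg G\<^esub> u_class G b"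
    using uh.hom_a_inv[OF assms(2)] assms(2) by (simp add: free_a_inv)
  thus "u_class G (a - b) = u_class G a \<ominus>\<^bsub>u_alg G\<^esub> u_class G b"
    using uh.hom_add[of a "- b"] assms by (simp add: a_minus_def)
qed (use uh.hom_add[OF assms] uh.hom_mult[OF assms] in auto)

lemma U_class_minus:
  assumes "a \<in> carrier FA" "b \<in> carrier FA"
  shows "U_class G (a - b) = U_class G a \<ominus>\<^bsub>U_alg G\<^esub> U_class G b"
proof -
  have "U_class G (- b) = \<ominus>\<^bsub>U_alg G\<^esub> U_class G b"
    using Uh.hom_a_inv[OF assms(2)] assms(2) by (simp add: free_a_inv)
  thus ?thesis using Uh.hom_add[of a "- b"] assms by (simp add: a_minus_def)
qed

lemma u_class_eqI:
  assumes "a \<in> carrier FA" "b \<in> carrier FA" "a - b \<in> U_ideal G \<or> U_class G (a - b) \<in> u_ideal G"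
  shows "u_class G a = u_class G b"
proof -
  have "U_class G (a - b) \<in> u_ideal G"
    using assms(3)
  proof
    assume "a - b \<in> U_ideal G"
    hence "U_class G (a - b) = \<zero>\<^bsub>U_alg G\<^esub>"
      by (simp add: U_class_def UI.a_rcos_const U_alg_def FactRing_def)
    thus ?thesis using uI.zero_closed by simp
  qed
  hence "u_class G (a - b) = \<zero>\<^bsub>u_alg G\<^esub>"
    by (simp add: u_class_def uI.a_rcos_const u_alg_def FactRing_def)
  thus ?thesis using assms(1,2) by (simp add: u_class_simps uA.r_right_minus_eq)
qed

lemma u_class_relations:
  assumes "x \<in> lie_carrier G" "y \<in> lie_carrier G"
  shows "u_class G (fgen (lie_add G x y)) = u_class G (fgen x + fgen y)"
    "u_class G (fgen (lie_scale G c x)) = u_class G (fscal c * fgen x)"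
    "u_class G (fgen x * fgen y) = u_class G (fgen y * fgen x + fgen (lie_bracket G x y))"
    "u_class G (fgen x ^ CHAR('a)) = u_class G (fgen (lie_pmap G x))"
proof -
  have rel: "r \<in> U_ideal G" if "r \<in> U_relations G" for r
    unfolding U_ideal_def using FA.genideal_self[OF U_relations_carrier] that by blast
  have "fgen (lie_add G x y) - (fgen x + fgen y) \<in> U_ideal G"
    using assms by (intro rel) (auto simp: U_relations_def diff_diff_eq)
  thus "u_class G (fgen (lie_add G x y)) = u_class G (fgen x + fgen y)"
    using assms by (intro u_class_eqI) (auto simp: lie_closed)
  have "fgen (lie_scale G c x) - fscal c * fgen x \<in> U_ideal G"
    using assms by (intro rel) (auto simp: U_relations_def)
  thus "u_class G (fgen (lie_scale G c x)) = u_class G (fscal c * fgen x)"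
    using assms by (intro u_class_eqI) (auto simp: lie_closed)
  have "fgen x * fgen y - (fgen y * fgen x + fgen (lie_bracket G x y)) \<in> U_ideal G"
    using assms by (intro rel) (auto simp: U_relations_def diff_diff_eq)
  thus "u_class G (fgen x * fgen y) = u_class G (fgen y * fgen x + fgen (lie_bracket G x y))"
    using assms by (intro u_class_eqI) (auto simp: lie_closed)
  have "U_class G (fgen x) [^]\<^bsub>U_alg G\<^esub> CHAR('a) \<ominus>\<^bsub>U_alg G\<^esub> U_class G (fgen (lie_pmap G x)) \<in> u_ideal G"
    unfolding u_ideal_def using UA.genideal_self[OF u_relations_carrier] assms
    by (auto simp: u_relations_def)
  moreover have "U_class G (fgen x) [^]\<^bsub>U_alg G\<^esub> CHAR('a) \<ominus>\<^bsub>U_alg G\<^esub> U_class G (fgen (lie_pmap G x))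
      = U_class G (fgen x ^ CHAR('a) - fgen (lie_pmap G x))"
    using assms Uh.hom_nat_pow[of "fgen x" "CHAR('a)"]
    by (simp add: free_pow U_class_minus lie_closed)
  ultimately show "u_class G (fgen x ^ CHAR('a)) = u_class G (fgen (lie_pmap G x))"
    using assms by (intro u_class_eqI) (auto simp: lie_closed)
qed

lemma U_ideal_least:
  assumes "ideal I FA" "U_relations G \<subseteq> I"
  shows "U_ideal G \<subseteq> I"
  unfolding U_ideal_def by (rule FA.genideal_minimal[OF assms])

text \<open>The universal property of \<open>u(G,0)\<close>, in terms of kernels.\<close>

lemma u_kernel_least:
  assumes I: "ideal I FA" and "U_relations G \<subseteq> I"
    and pow: "\<And>x. x \<in> lie_carrier G \<Longrightarrow> fgen x ^ CHAR('a) - fgen (lie_pmap G x) \<in> I"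
    and a: "a \<in> carrier FA" "b \<in> carrier FA" "u_class G a = u_class G b"
  shows "a - b \<in> I"
proof -
  interpret I: ideal I FA by (rule I)
  have UI: "U_ideal G \<subseteq> I" by (rule U_ideal_least[OF assms(1,2)])
  have "ideal (U_class G ` I) (U_alg G)"
    unfolding U_alg_def U_class_fun by (rule FA.ring_ideal_imp_quot_ideal[OF U_ideal I])
  moreover have "u_relations G \<subseteq> U_class G ` I"
  proof
    fix r assume "r \<in> u_relations G"
    then obtain x where x: "x \<in> lie_carrier G"
      "r = U_class G (fgen x) [^]\<^bsub>U_alg G\<^esub> CHAR('a) \<ominus>\<^bsub>U_alg G\<^esub> U_class G (fgen (lie_pmap G x))"
      by (auto simp: u_relations_def)
    hence "r = U_class G (fgen x ^ CHAR('a) - fgen (lie_pmap G x))"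
      using Uh.hom_nat_pow[of "fgen x" "CHAR('a)"]
      by (simp add: free_pow U_class_minus lie_closed)
    thus "r \<in> U_class G ` I" using pow[OF x(1)] by blast
  qed
  ultimately have uI: "u_ideal G \<subseteq> U_class G ` I"
    unfolding u_ideal_def by (rule UA.genideal_minimal)
  have "u_class G (a - b) = \<zero>\<^bsub>u_alg G\<^esub>"
    using a by (simp add: u_class_simps uA.r_right_minus_eq)
  hence "u_ideal G +>\<^bsub>U_alg G\<^esub> U_class G (a - b) = u_ideal G"
    by (simp add: u_class_def u_alg_def FactRing_def)
  hence "U_class G (a - b) \<in> u_ideal G"
    using uI.a_rcos_self[of "U_class G (a - b)"] a by simp
  \<comment> \<open>In the free algebra \<open>a - b\<close> and \<open>c\<close> differ by an
    element of \<open>U_ideal G\<close>, which is contained in \<open>I\<close>.\<close>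
  then obtain c where c: "c \<in> I" "U_class G (a - b) = U_class G c" using uI by auto
  have "a - b \<in> U_ideal G +>\<^bsub>FA\<^esub> c"
    using UI.a_rcos_self[of "a - b"] a c(2) by (simp add: U_class_def)
  then obtain d where "d \<in> U_ideal G" "a - b = d + c"
    by (auto simp: a_r_coset_def')
  thus ?thesis using c(1) UI I.a_closed[of d c] by auto
qed

end

section \<open>Modules over u(G,0)\<close>

locale rmod = rlie G + left_module "u_alg G" M
  for G :: "('a::field, 'g) restricted_lie" and M :: "('a, 'g, 'v) restricted_module"
begin

definition act :: "'g \<Rightarrow> 'v \<Rightarrow> 'v" where
  "act x m = u_class G (fgen x) \<odot>\<^bsub>M\<^esub> m"

definition scal :: "'a \<Rightarrow> 'v \<Rightarrow> 'v" where
  "scal c m = u_class G (fscal c) \<odot>\<^bsub>M\<^esub> m"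

lemma act_closed [simp]:
  "x \<in> lie_carrier G \<Longrightarrow> m \<in> carrier M \<Longrightarrow> act x m \<in> carrier M"
  "m \<in> carrier M \<Longrightarrow> scal c m \<in> carrier M"
  by (simp_all add: act_def scal_def smult_closed)

lemma smult_0: "r \<in> carrier (u_alg G) \<Longrightarrow> r \<odot>\<^bsub>M\<^esub> \<zero>\<^bsub>M\<^esub> = \<zero>\<^bsub>M\<^esub>"
  using smult_r_distr[of r "\<zero>\<^bsub>M\<^esub>" "\<zero>\<^bsub>M\<^esub>"] smult_closed[of r "\<zero>\<^bsub>M\<^esub>"] M.add.r_cancel_one' by force

lemma zero_smult: "m \<in> carrier M \<Longrightarrow> \<zero>\<^bsub>u_alg G\<^esub> \<odot>\<^bsub>M\<^esub> m = \<zero>\<^bsub>M\<^esub>"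
  using smult_l_distr[of "\<zero>\<^bsub>u_alg G\<^esub>" "\<zero>\<^bsub>u_alg G\<^esub>" m] smult_closed[of "\<zero>\<^bsub>u_alg G\<^esub>" m]
    M.add.r_cancel_one' by force

lemma act_linear:
  "x \<in> lie_carrier G \<Longrightarrow> m \<in> carrier M \<Longrightarrow> n \<in> carrier M \<Longrightarrow>
    act x (m \<oplus>\<^bsub>M\<^esub> n) = act x m \<oplus>\<^bsub>M\<^esub> act x n"
  "x \<in> lie_carrier G \<Longrightarrow> act x \<zero>\<^bsub>M\<^esub> = \<zero>\<^bsub>M\<^esub>"
  "x \<in> lie_carrier G \<Longrightarrow> m \<in> carrier M \<Longrightarrow> act x (scal c m) = scal c (act x m)"
proof -
  show "act x (m \<oplus>\<^bsub>M\<^esub> n) = act x m \<oplus>\<^bsub>M\<^esub> act x n"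
    if "x \<in> lie_carrier G" "m \<in> carrier M" "n \<in> carrier M"
    using that by (simp add: act_def smult_r_distr)
  show "act x \<zero>\<^bsub>M\<^esub> = \<zero>\<^bsub>M\<^esub>" if "x \<in> lie_carrier G"
    using that by (simp add: act_def smult_0)
  show "act x (scal c m) = scal c (act x m)" if "x \<in> lie_carrier G" "m \<in> carrier M"
    using that by (simp add: act_def scal_def fscal_commute[of c "fgen x"]
        flip: smult_assoc u_class_simps)
qed

lemma scal_linear:
  "m \<in> carrier M \<Longrightarrow> n \<in> carrier M \<Longrightarrow> scal c (m \<oplus>\<^bsub>M\<^esub> n) = scal c m \<oplus>\<^bsub>M\<^esub> scal c n"
  "scal c \<zero>\<^bsub>M\<^esub> = \<zero>\<^bsub>M\<^esub>"
  "m \<in> carrier M \<Longrightarrow> scal (c + d) m = scal c m \<oplus>\<^bsub>M\<^esub> scal d m"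
  "m \<in> carrier M \<Longrightarrow> scal (c * d) m = scal c (scal d m)"
  "m \<in> carrier M \<Longrightarrow> scal 1 m = m" "m \<in> carrier M \<Longrightarrow> scal 0 m = \<zero>\<^bsub>M\<^esub>"
  using uh.hom_one uh.hom_zero
  by (simp_all add: scal_def smult_r_distr smult_0 smult_l_distr u_class_simps fscal_simps
      smult_assoc smult_one zero_smult)

lemma scal_minus: "m \<in> carrier M \<Longrightarrow> scal (- 1) m = \<ominus>\<^bsub>M\<^esub> m"
proof -
  assume m: "m \<in> carrier M"
  have "scal (- 1) m \<oplus>\<^bsub>M\<^esub> m = scal (- 1 + 1) m"
    unfolding scal_linear(3)[OF m] scal_linear(5)[OF m] ..
  hence "scal (- 1) m \<oplus>\<^bsub>M\<^esub> m = \<zero>\<^bsub>M\<^esub>" using scal_linear(6)[OF m] by simp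
  thus ?thesis using m by (intro M.minus_equality[symmetric]) auto
qed

lemma act_lie_scale:
  assumes "x \<in> lie_carrier G" "m \<in> carrier M"
  shows "act (lie_scale G c x) m = scal c (act x m)"
  using assms unfolding act_def scal_def u_class_relations(2)[OF assms(1,1)]
  by (simp add: u_class_simps smult_assoc)

lemma act_lie:
  assumes "x \<in> lie_carrier G" "y \<in> lie_carrier G" "m \<in> carrier M"
  shows "act (lie_add G x y) m = act x m \<oplus>\<^bsub>M\<^esub> act y m"
    "act x (act y m) = act y (act x m) \<oplus>\<^bsub>M\<^esub> act (lie_bracket G x y) m"
proof -
  note rel = u_class_relations[OF assms(1,2)]
  show "act (lie_add G x y) m = act x m \<oplus>\<^bsub>M\<^esub> act y m"
    using assms unfolding act_def scal_def rel
    by (simp_all add: u_class_simps smult_l_distr smult_assoc)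
  have "act x (act y m) = u_class G (fgen x * fgen y) \<odot>\<^bsub>M\<^esub> m"
    using assms by (simp add: act_def u_class_simps smult_assoc)
  also have "\<dots> = act y (act x m) \<oplus>\<^bsub>M\<^esub> act (lie_bracket G x y) m"
    using assms unfolding rel by (simp add: act_def u_class_simps smult_assoc smult_l_distr lie_closed)
  finally show "act x (act y m) = act y (act x m) \<oplus>\<^bsub>M\<^esub> act (lie_bracket G x y) m" .
qed

lemma act_pow:
  assumes "x \<in> lie_carrier G" "m \<in> carrier M"
  shows "(act x ^^ CHAR('a)) m = act (lie_pmap G x) m"
proof -
  have "(act x ^^ n) m = u_class G (fgen x ^ n) \<odot>\<^bsub>M\<^esub> m" for n
    using assms uh.hom_one
    by (induction n) (simp_all add: act_def smult_one u_class_simps smult_assoc)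
  thus ?thesis using assms by (simp add: act_def u_class_relations)
qed

text \<open>Scalars and elements of G generate u(G,0), so closure under these is closure under the
  whole algebra; negatives come from the scalar -1.\<close>

lemma submoduleI_act:
  assumes N: "N \<subseteq> carrier M" "\<zero>\<^bsub>M\<^esub> \<in> N" "\<And>m n. m \<in> N \<Longrightarrow> n \<in> N \<Longrightarrow> m \<oplus>\<^bsub>M\<^esub> n \<in> N"
    and act: "\<And>x m. x \<in> lie_carrier G \<Longrightarrow> m \<in> N \<Longrightarrow> act x m \<in> N"
    and scal: "\<And>c m. m \<in> N \<Longrightarrow> scal c m \<in> N"
  shows "submodule N (u_alg G) M"
proof (intro submodule.intro submodule_axioms.intro M.add.subgroupI)
  fix m assume m: "m \<in> N"
  have "\<ominus>\<^bsub>M\<^esub> m \<in> N" using scal[OF m, of "- 1"] scal_minus[of m] m N(1) by auto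
  thus "\<ominus>\<^bsub>M\<^esub> m \<in> N" .
next
  fix r m assume r: "r \<in> carrier (u_alg G)" and m: "m \<in> N"
  from r obtain a where a: "a \<in> carrier FA" "r = u_class G a" by (rule u_algE)
  have "u_class G a \<odot>\<^bsub>M\<^esub> m \<in> N" using a(1)
  proof (induction a rule: free_induct)
    case (gen x a)
    thus ?case using act[of x "u_class G a \<odot>\<^bsub>M\<^esub> m"] m N(1)
      by (auto simp: act_def u_class_simps smult_assoc)
  next
    case (add a b)
    thus ?case using N m by (auto simp: u_class_simps smult_l_distr)
  qed (use scal[OF m] in \<open>simp add: scal_def\<close>)
  thus "r \<odot>\<^bsub>M\<^esub> m \<in> N" using a by simp
qed (use N in auto)

end

section \<open>Functoriality\<close>

locale rlie_hom = K: rlie K + G: rlie G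
  for K :: "('a::field, 'k) restricted_lie" and G :: "('a, 'g) restricted_lie" +
  fixes f :: "'k \<Rightarrow> 'g"
  assumes hom_carrier: "x \<in> lie_carrier K \<Longrightarrow> f x \<in> lie_carrier G"
    and hom_simps: "x \<in> lie_carrier K \<Longrightarrow> y \<in> lie_carrier K \<Longrightarrow> f (lie_add K x y) = lie_add G (f x) (f y)"
      "x \<in> lie_carrier K \<Longrightarrow> f (lie_scale K c x) = lie_scale G c (f x)"
      "x \<in> lie_carrier K \<Longrightarrow> y \<in> lie_carrier K \<Longrightarrow> f (lie_bracket K x y) = lie_bracket G (f x) (f y)"
      "x \<in> lie_carrier K \<Longrightarrow> f (lie_pmap K x) = lie_pmap G (f x)"
begin

lemma fmap_carrier:
  assumes "a \<in> carrier (free_algebra (lie_carrier K))"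
  shows "fmap_algebra f a \<in> carrier (free_algebra (lie_carrier G))"
  using assms by (induction rule: free_induct)
    (simp_all add: fmap_generators fmap_mult fmap_simps hom_carrier)

lemma fmap_hom_ring: "ring_hom_ring K.FA G.FA (fmap_algebra f)"
  by (rule ring_hom_ringI) 
    (simp_all add: K.FA.ring_axioms G.FA.ring_axioms fmap_carrier fmap_mult fmap_simps fmap_generators)

lemma fmap_U_relations: "fmap_algebra f ` U_relations K \<subseteq> U_relations G"
proof
  fix r assume "r \<in> fmap_algebra f ` U_relations K"
  then obtain s where r: "r = fmap_algebra f s" and "s \<in> U_relations K" by blast
  then consider x y where "x \<in> lie_carrier K" "y \<in> lie_carrier K" "s = fgen (lie_add K x y) - fgen x - fgen y"
    | c x where "x \<in> lie_carrier K" "s = fgen (lie_scale K c x) - fscal c * fgen x"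
    | x y where "x \<in> lie_carrier K" "y \<in> lie_carrier K"
        "s = fgen x * fgen y - fgen y * fgen x - fgen (lie_bracket K x y)"
    unfolding U_relations_def by blast
  thus "r \<in> U_relations G"
    by cases (use hom_carrier in \<open>auto simp: U_relations_def r fmap_simps fmap_generators fmap_mult hom_simps\<close>)
qed

text \<open>The point is that \<open>coset_map\<close> does not depend on the representative: the
  preimage of \<open>U_ideal G\<close> is an ideal that contains the relations of K.\<close>

lemma U_map_class:
  assumes a: "a \<in> carrier K.FA"
  shows "U_map G f (U_class K a) = U_class G (fmap_algebra f a)"
proof -
  interpret h: ring_hom_ring K.FA G.FA "fmap_algebra f" by (rule fmap_hom_ring)
  have sub: "U_ideal K \<subseteq> {r \<in> carrier K.FA. fmap_algebra f r \<in> U_ideal G}"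
  proof (rule K.U_ideal_least[OF h.ideal_vimage[OF G.U_ideal]])
    have "U_relations G \<subseteq> U_ideal G"
      unfolding U_ideal_def by (rule G.FA.genideal_self[OF G.U_relations_carrier])
    thus "U_relations K \<subseteq> {r \<in> carrier K.FA. fmap_algebra f r \<in> U_ideal G}"
      using fmap_U_relations K.U_relations_carrier by blast
  qed
  have "U_ideal G +>\<^bsub>G.FA\<^esub> fmap_algebra f r = U_class G (fmap_algebra f a)" if "r \<in> U_class K a" for r
  proof -
    from that obtain i where i: "i \<in> U_ideal K" "r = i + a"
      by (auto simp: U_class_def a_r_coset_def')
    hence fi: "fmap_algebra f i \<in> U_ideal G" using sub by auto
    hence "U_class G (fmap_algebra f i) = \<zero>\<^bsub>U_alg G\<^esub>"
      by (simp add: U_class_def G.UI.a_rcos_const U_alg_def FactRing_def)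
    moreover have "fmap_algebra f i \<in> carrier G.FA" using fi G.UI.a_Hcarr by blast
    ultimately have "U_class G (fmap_algebra f r) = U_class G (fmap_algebra f a)"
      using G.Uh.hom_add[of "fmap_algebra f i" "fmap_algebra f a"] fmap_carrier[OF a]
      by (simp add: i fmap_simps)
    thus ?thesis by (simp add: U_class_def)
  qed
  moreover have "a \<in> U_class K a" using K.UI.a_rcos_self[OF a] by (simp add: U_class_def)
  ultimately have "(\<lambda>r. U_ideal G +>\<^bsub>G.FA\<^esub> fmap_algebra f r) ` U_class K a = {U_class G (fmap_algebra f a)}"
    by auto
  thus ?thesis by (simp add: U_map_def coset_map_def)
qed

text \<open>Independence of representatives for \<open>u_map\<close>: the kernel of the composite
  map to u(G,0) contains all defining relations of u(K,0), so \<open>u_kernel_least\<close>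
  applies.\<close>

lemma u_class_fmap_cong:
  assumes "a \<in> carrier K.FA" "b \<in> carrier K.FA" "u_class K a = u_class K b"
  shows "u_class G (fmap_algebra f a) = u_class G (fmap_algebra f b)"
proof -
  let ?h = "u_class G \<circ> fmap_algebra f"
  interpret h: ring_hom_ring K.FA "u_alg G" ?h
    by (intro ring_hom_ringI2 K.FA.ring_axioms G.uA.ring_axioms
        ring_hom_trans[OF ring_hom_ring.homh[OF fmap_hom_ring] G.uh.homh])
  have ker: "r \<in> a_kernel K.FA (u_alg G) ?h \<longleftrightarrow> r \<in> carrier K.FA \<and> ?h r = \<zero>\<^bsub>u_alg G\<^esub>" for r
    unfolding a_kernel_def' by blast
  have "a - b \<in> a_kernel K.FA (u_alg G) ?h"
  proof (rule K.u_kernel_least[OF h.kernel_is_ideal])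
    have "u_class G r = \<zero>\<^bsub>u_alg G\<^esub>" if "r \<in> U_relations G" for r
    proof -
      have "r \<in> U_ideal G" unfolding U_ideal_def
        using G.FA.genideal_self[OF G.U_relations_carrier] that by blast
      thus ?thesis using G.u_class_eqI[of r 0] G.uh.hom_zero G.U_relations_carrier that by auto
    qed
    hence "?h r = \<zero>\<^bsub>u_alg G\<^esub>" if "r \<in> U_relations K" for r
      using fmap_U_relations that unfolding o_def by blast
    thus "U_relations K \<subseteq> a_kernel K.FA (u_alg G) ?h"
      using K.U_relations_carrier ker by blast
  next
    fix x assume x: "x \<in> lie_carrier K"
    thus "fgen x ^ CHAR('a) - fgen (lie_pmap K x) \<in> a_kernel K.FA (u_alg G) ?h"
      using G.u_class_relations(4)[of "f x" "f x"]
      unfolding ker by (simp add: K.lie_closed G.lie_closed hom_carrier fmap_simps fmap_power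
          fmap_generators hom_simps G.u_class_simps)
  qed (use assms in auto)
  thus ?thesis using assms unfolding ker by (simp add: fmap_carrier fmap_simps G.u_class_simps)
qed

lemma u_map_class:
  assumes a: "a \<in> carrier K.FA"
  shows "u_map G f (u_class K a) = u_class G (fmap_algebra f a)"
proof -
  have "u_ideal G +>\<^bsub>U_alg G\<^esub> U_map G f C = u_class G (fmap_algebra f a)" if "C \<in> u_class K a" for C
  proof -
    have Ccar: "C \<in> carrier (U_alg K)"
      using that K.uI.a_elemrcos_carrier[of "U_class K a" C] a by (simp add: u_class_def)
    then obtain b where b: "b \<in> carrier K.FA" "C = U_class K b" by (auto simp: K.carrier_U)
    have "u_class K a = u_class K b"
      using that K.uI.a_repr_independence'[of C "U_class K a"] a b by (simp add: u_class_def)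
    hence "u_class G (fmap_algebra f a) = u_class G (fmap_algebra f b)"
      using a b by (intro u_class_fmap_cong)
    thus ?thesis using b by (simp add: U_map_class u_class_def)
  qed
  moreover have "U_class K a \<in> u_class K a"
    using K.uI.a_rcos_self[of "U_class K a"] a by (simp add: u_class_def)
  ultimately have "(\<lambda>C. u_ideal G +>\<^bsub>U_alg G\<^esub> U_map G f C) ` u_class K a = {u_class G (fmap_algebra f a)}"
    by auto
  thus ?thesis by (simp add: u_map_def coset_map_def)
qed

end

section \<open>\<open>L\<close>, \<open>L\<^sub>(\<^sub>0\<^sub>)\<close> and the linear part\<close>

lemma W2_sub_simps [simp]:
  "lie_carrier (W2_sub S) = S" "lie_add (W2_sub S) = vadd" "lie_scale (W2_sub S) = vscale"
  "lie_bracket (W2_sub S) = lie" "lie_pmap (W2_sub S :: ('a::field, 'a vfield) restricted_lie) = (\<lambda>D. D ^^ CHAR('a))"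
  by (simp_all add: W2_sub_def W2_def)

lemma W2_filt_0:
  "D \<in> W2_filt 0 \<longleftrightarrow> D \<in> W_carrier \<and> coeff2 (D varx) 0 0 = 0 \<and> coeff2 (D vary) 0 0 = 0"
proof
  assume "D \<in> W2_filt 0"
  then obtain f g where D: "D = vf f g"
    and "\<forall>i j. int i + int j - 1 < 0 \<longrightarrow> coeff2 f i j = 0 \<and> coeff2 g i j = 0"
    unfolding W2_filt_def by blast
  from this(2)[rule_format, of 0 0] show "D \<in> W_carrier \<and> coeff2 (D varx) 0 0 = 0 \<and> coeff2 (D vary) 0 0 = 0"
    using D by auto
next
  assume *: "D \<in> W_carrier \<and> coeff2 (D varx) 0 0 = 0 \<and> coeff2 (D vary) 0 0 = 0"
  then obtain f g where D: "D = vf f g" by blast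
  have "coeff2 f i j = 0 \<and> coeff2 g i j = 0" if "int i + int j - 1 < 0" for i j
  proof -
    have "i = 0" "j = 0" using that by auto
    thus ?thesis using * D by simp
  qed
  thus "D \<in> W2_filt 0" unfolding W2_filt_def D by blast
qed

lemma coeff2_mult_00:
  fixes f g :: "'a::field O2"
  assumes "CHAR('a) > 0"
  shows "coeff2 (f * g) 0 0 = coeff2 f 0 0 * coeff2 g 0 0"
  using assms by (simp add: coeff2_times)

lemma coeff2_mult_linear:
  fixes f g :: "'a::field O2"
  assumes "CHAR('a) > 1"
  shows "coeff2 (f * g) (Suc 0) 0 = coeff2 f 0 0 * coeff2 g 1 0 + coeff2 f 1 0 * coeff2 g 0 0"
    "coeff2 (f * g) 0 (Suc 0) = coeff2 f 0 0 * coeff2 g 0 1 + coeff2 f 0 1 * coeff2 g 0 0"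
  using assms by (simp_all add: coeff2_times)

context char_gt3
begin

lemma L_W: "D \<in> L_carrier \<Longrightarrow> (D :: 'a vfield) \<in> W_carrier"
  by (simp add: L_iff)

lemma L_closed:
  fixes D E :: "'a vfield"
  assumes "D \<in> L_carrier" "E \<in> L_carrier"
  shows "vadd D E \<in> L_carrier" "vscale c D \<in> L_carrier" "lie D E \<in> L_carrier" "D ^^ CHAR('a) \<in> L_carrier"
proof -
  have D: "D \<in> W_carrier" "theta D Lam_inv = 0" and E: "E \<in> W_carrier" "theta E Lam_inv = 0"
    using assms unfolding L_iff by blast+
  have "vadd D E \<in> W_carrier" "vscale c D \<in> W_carrier"
    using D E by (auto simp: vadd_vf vscale_vf) blast+
  thus "vadd D E \<in> L_carrier" "vscale c D \<in> L_carrier"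
    unfolding L_iff theta_vadd theta_vscale using D E by auto
  show "lie D E \<in> L_carrier"
    unfolding L_iff theta_lie[OF D(1) E(1)] D(2) E(2)
    using lie_W[OF D(1) E(1)] theta_linear(3)[OF D(1)] theta_linear(3)[OF E(1)] by simp
  have "(theta D ^^ Suc n) Lam_inv = 0" for n
    by (induction n) (simp_all add: D theta_linear(3)[OF D(1)])
  from this[of "CHAR('a) - 1"] have "(theta D ^^ CHAR('a)) Lam_inv = 0" using p0 by simp
  thus "D ^^ CHAR('a) \<in> L_carrier"
    unfolding L_iff theta_power[OF p0 D(1)] using W_power[OF p0 D(1)] by simp
qed

sublocale L: rlie "L_alg :: ('a, 'a vfield) restricted_lie"
  by unfold_locales (simp_all add: L_alg_def L_closed)

section \<open>The subalgebra L_(0)\<close>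

lemma L0_iff: "(D :: 'a vfield) \<in> L_filt 0 \<longleftrightarrow>
    D \<in> L_carrier \<and> coeff2 (D varx) 0 0 = 0 \<and> coeff2 (D vary) 0 0 = 0"
  unfolding L_filt_def Int_iff W2_filt_0 using L_W by blast

lemma L0_L: "D \<in> L_filt 0 \<Longrightarrow> (D :: 'a vfield) \<in> L_carrier"
  by (simp add: L0_iff)

lemma L0_W: "D \<in> L_filt 0 \<Longrightarrow> (D :: 'a vfield) \<in> W_carrier"
  using L0_L L_W by blast

text \<open>A field that vanishes at the origin maps all functions into the maximal ideal. Closure
  of L_(0) under brackets and p-th powers is then immediate.\<close>

lemma L0_max_ideal:
  assumes "D \<in> L_filt 0"
  shows "coeff2 (D (h :: 'a O2)) 0 0 = 0"
proof -
  obtain f g where "D = vf f g" using L0_W[OF assms] by blast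
  thus ?thesis using assms p0 by (simp add: L0_iff, simp add: vf_def coeff2_mult_00)
qed

lemma L0_closed:
  fixes D E :: "'a vfield"
  assumes "D \<in> L_filt 0" "E \<in> L_filt 0"
  shows "vadd D E \<in> L_filt 0" "vscale c D \<in> L_filt 0" "lie D E \<in> L_filt 0" "D ^^ CHAR('a) \<in> L_filt 0"
proof -
  note [simp] = L_closed[OF assms[THEN L0_L]] L0_max_ideal[OF assms(1)] L0_max_ideal[OF assms(2)]
  show "vadd D E \<in> L_filt 0" "vscale c D \<in> L_filt 0"
    unfolding L0_iff by (simp, simp add: vadd_def vscale_def)+
  have "coeff2 (lie D E h) 0 0 = 0" for h by simp
  thus "lie D E \<in> L_filt 0"
    unfolding L0_iff using L_closed(3)[OF assms[THEN L0_L]] by blast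
  have "coeff2 ((D ^^ CHAR('a)) h) 0 0 = 0" for h
    using p0 by (cases "CHAR('a)") simp_all
  thus "D ^^ CHAR('a) \<in> L_filt 0" unfolding L0_iff by simp
qed

sublocale L0: rlie "L0_alg :: ('a, 'a vfield) restricted_lie"
  by unfold_locales (simp_all add: L0_alg_def L0_closed)

sublocale incl: rlie_hom "L0_alg :: ('a, 'a vfield) restricted_lie" L_alg "\<lambda>x. x"
  by unfold_locales (simp_all add: L0_alg_def L_alg_def L0_L)

lemma L_vf_iff: "vf f g \<in> L_carrier \<longleftrightarrow> dx (Lam_inv * f) + dy (Lam_inv * g) = (0 :: 'a O2)"
  unfolding L_iff theta_vf by blast

text \<open>\<open>Lam_inv\<close> differs from 1 only in degree 2p - 2, so the constant term of the
  closedness condition is the trace of the linear part. This forces linear parts into sl2.\<close>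

lemma divergence_00:
  assumes "D \<in> L_carrier"
  shows "coeff2 (D varx) (Suc 0) 0 + coeff2 (D vary) 0 (Suc 0) = (0 :: 'a)"
proof -
  obtain f g where D: "D = vf f g" using L_W[OF assms] by blast
  have "coeff2 (dx (Lam_inv * f) + dy (Lam_inv * g)) 0 0 = (0 :: 'a)"
    using assms unfolding D L_vf_iff by simp
  thus ?thesis using char
    by (simp add: D Lam_inv_def distrib_right coeff2_monom2_mult)
qed

section \<open>The projection of L_(0) onto sl2\<close>

lemma linear_part_eq: "linear_part (h :: 'a O2) =
    scale2 (coeff2 h (Suc 0) 0) varx + scale2 (coeff2 h 0 (Suc 0)) vary"
proof (rule O2_eqI)
  fix i j assume "i < CHAR('a)" "j < CHAR('a)"
  show "coeff2 (linear_part h) i j =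
    coeff2 (scale2 (coeff2 h (Suc 0) 0) varx + scale2 (coeff2 h 0 (Suc 0)) vary) i j"
    using char by (cases i; cases j) (auto simp: coeff2_monom2)
qed

text \<open>D kills constants and preserves the square of the maximal ideal, so the linear part of D
  h depends on that of h alone. The homomorphism property of \<open>deg0_part\<close> follows from
  this.\<close>

lemma linear_part_comm:
  assumes "D \<in> L_filt 0"
  shows "linear_part (D h) = deg0_part D (linear_part (h :: 'a O2))"
proof -
  obtain f g where D: "D = vf f g" using L0_W[OF assms] by blast
  have 0: "coeff2 f 0 0 = 0" "coeff2 g 0 0 = 0" using assms by (simp_all add: L0_iff D)
  have h: "deg0_part D (linear_part h) =
      scale2 (coeff2 h (Suc 0) 0) (linear_part f) + scale2 (coeff2 h 0 (Suc 0)) (linear_part g)"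
    by (simp add: deg0_part_def D linear_part_eq[of h])
  show ?thesis
  proof (rule O2_eqI)
    fix i j assume "i < CHAR('a)" "j < CHAR('a)"
    show "coeff2 (linear_part (D h)) i j = coeff2 (deg0_part D (linear_part h)) i j"
      unfolding h
    proof (cases "i + j = 1")
      case True
      then consider "i = 1" "j = 0" | "i = 0" "j = 1" by linarith
      thus "coeff2 (linear_part (D h)) i j = coeff2 (scale2 (coeff2 h (Suc 0) 0) (linear_part f)
            + scale2 (coeff2 h 0 (Suc 0)) (linear_part g)) i j"
        using char 0 by cases (simp_all add: D vf_def coeff2_mult_linear)
    qed simp
  qed
qed

lemma deg0_W: "deg0_part D \<in> W_carrier"
  by (auto simp: deg0_part_def)

lemma deg0_var: "deg0_part D varx = linear_part (D varx)" "deg0_part D vary = linear_part (D vary)"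
  by (simp_all add: deg0_part_def)

lemma linear_part_simps: "linear_part (f + g) = linear_part f + linear_part g"
  "linear_part (f - g) = linear_part f - linear_part g"
  "linear_part (scale2 c f) = scale2 c (linear_part f)"
  by (rule O2_eqI; simp)+

lemma linear_part_var: "linear_part varx = (varx :: 'a O2)" "linear_part vary = (vary :: 'a O2)"
  by (rule O2_eqI; auto simp: coeff2_monom2)+

lemma deg0_eq:
  assumes "D \<in> L_filt 0"
  shows "deg0_part D = vadd (vscale (coeff2 (D varx) 0 (Suc 0)) sl2_e)
    (vadd (vscale (coeff2 (D vary) 0 (Suc 0)) sl2_h) (vscale (coeff2 (D vary) (Suc 0) 0 :: 'a) sl2_f))"
proof -
  have "coeff2 (D varx) (Suc 0) 0 = - coeff2 (D vary) 0 (Suc 0)"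
    using divergence_00[OF L0_L[OF assms]] by (simp add: add_eq_0_iff)
  thus ?thesis
    unfolding deg0_part_def sl2_e_def sl2_f_def sl2_h_def vscale_vf vadd_vf linear_part_eq
    by (simp add: vf_inject algebra_simps) (rule O2_eqI, simp)
qed

lemma sl2_L0: "sl2_e \<in> (L_filt 0 :: 'a vfield set)" "sl2_h \<in> (L_filt 0 :: 'a vfield set)" "sl2_f \<in> (L_filt 0 :: 'a vfield set)"
  unfolding L0_iff sl2_e_def sl2_h_def sl2_f_def L_vf_iff
  by (simp_all add: Lam_mult_monom2 coeff2_monom2)

lemma deg0_sl2: "deg0_part sl2_e = (sl2_e :: 'a vfield)" "deg0_part sl2_h = (sl2_h :: 'a vfield)" "deg0_part sl2_f = (sl2_f :: 'a vfield)"
proof -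
  have "linear_part (- varx) = (- varx :: 'a O2)" "linear_part 0 = (0 :: 'a O2)"
    by (rule O2_eqI; auto simp: coeff2_monom2)+
  thus "deg0_part sl2_e = (sl2_e :: 'a vfield)" "deg0_part sl2_h = (sl2_h :: 'a vfield)" "deg0_part sl2_f = (sl2_f :: 'a vfield)"
    using linear_part_var by (simp_all add: deg0_part_def sl2_e_def sl2_h_def sl2_f_def)
qed

lemma deg0_hom:
  fixes D E :: "'a vfield"
  assumes D: "D \<in> L_filt 0" and E: "E \<in> L_filt 0"
  shows "deg0_part (vadd D E) = vadd (deg0_part D) (deg0_part E)"
    "deg0_part (vscale c D) = vscale c (deg0_part D)"
    "deg0_part (lie D E) = lie (deg0_part D) (deg0_part E)"
    "deg0_part (D ^^ CHAR('a)) = deg0_part D ^^ CHAR('a)"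
proof -
  show "deg0_part (vadd D E) = vadd (deg0_part D) (deg0_part E)"
    "deg0_part (vscale c D) = vscale c (deg0_part D)"
    by (simp_all add: deg0_part_def vadd_vf vscale_vf) (simp_all add: vadd_def vscale_def linear_part_simps)
  show "deg0_part (lie D E) = lie (deg0_part D) (deg0_part E)"
    by (rule W_eqI[OF deg0_W lie_W[OF deg0_W deg0_W]])
      (simp_all only: deg0_var linear_part_simps linear_part_comm[OF D] linear_part_comm[OF E])
  have "linear_part ((D ^^ n) h) = (deg0_part D ^^ n) (linear_part h)" for n h
    by (induction n) (simp_all add: linear_part_comm[OF D])
  thus "deg0_part (D ^^ CHAR('a)) = deg0_part D ^^ CHAR('a)"
    by (intro W_eqI[OF deg0_W W_power[OF p0 deg0_W]]) (simp_all only: deg0_var linear_part_var)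
qed

text \<open>Since sl2 lies in L_(0) and is fixed by \<open>deg0_part\<close>, it is the image of
  L_(0). Closure under brackets and p-th powers is thus inherited, with no computation in
  sl2.\<close>

lemma sl2_carrier: "lie_carrier sl2_alg = deg0_part ` (L_filt 0 :: 'a vfield set)"
proof
  show "deg0_part ` L_filt 0 \<subseteq> lie_carrier (sl2_alg :: ('a, 'a vfield) restricted_lie)"
    unfolding sl2_alg_def W2_sub_simps using deg0_eq by blast
  show "lie_carrier (sl2_alg :: ('a, 'a vfield) restricted_lie) \<subseteq> deg0_part ` L_filt 0"
  proof
    fix D :: "'a vfield" assume "D \<in> lie_carrier sl2_alg"
    then obtain a b c where D: "D = vadd (vscale a sl2_e) (vadd (vscale b sl2_h) (vscale c sl2_f))"
      unfolding sl2_alg_def W2_sub_simps by blast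
    have "D \<in> L_filt 0" "deg0_part D = D"
      unfolding D using L0_closed(2)[of E E for E] deg0_hom(2)[of E E for E]
      by (simp_all add: L0_closed(1) sl2_L0 deg0_hom(1) deg0_sl2)
    thus "D \<in> deg0_part ` L_filt 0" by (metis imageI)
  qed
qed

lemma sl2_simps [simp]:
  "lie_add (sl2_alg :: ('a, 'a vfield) restricted_lie) = vadd"
  "lie_scale (sl2_alg :: ('a, 'a vfield) restricted_lie) = vscale"
  "lie_bracket (sl2_alg :: ('a, 'a vfield) restricted_lie) = lie"
  "lie_pmap (sl2_alg :: ('a, 'a vfield) restricted_lie) = (\<lambda>D. D ^^ CHAR('a))"
  by (simp_all add: sl2_alg_def)

sublocale sl2: rlie "sl2_alg :: ('a, 'a vfield) restricted_lie"
  by unfold_locales (auto simp: sl2_carrier deg0_hom(1,2)[symmetric] deg0_hom(3,4)[symmetric] L0_closed)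

sublocale deg0: rlie_hom "L0_alg :: ('a, 'a vfield) restricted_lie" sl2_alg deg0_part
  by unfold_locales (auto simp: sl2_carrier L0_alg_def deg0_hom)

end

section \<open>The module of symmetric forms\<close>

text \<open>The action of the free algebra, defined on arbitrary coefficient functions;
  \<open>ev_cong\<close> shows that on \<open>Sym l\<close> it factors through u(L,0).\<close>

definition ev :: "nat \<Rightarrow> ('a vfield list \<Rightarrow>\<^sub>0 'a::field) \<Rightarrow> 'a form \<Rightarrow> 'a form" where
  "ev l a s = pm_extend (\<lambda>w c. scT c (foldr (rho l) w s)) a"

lemma ev_simps:
  "ev l (a + b) s = ev l a s + ev l b s" "ev l (a - b) s = ev l a s - ev l b s" "ev l 0 s = 0"
  "ev l (Poly_Mapping.single w c) s = scT c (foldr (rho l) w s)"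
  unfolding ev_def by (simp_all only: pm_extend_add pm_extend_diff pm_extend_0 pm_extend_single scT_left)

lemma ev_fscal: "ev l (fscal c) s = scT c s"
  by (simp add: fscal_def ev_simps)

lemma ev_one: "ev l 1 s = s"
  by (simp add: ev_simps flip: single_one)

lemma ev_gen_mult:
  assumes "D \<in> W_carrier"
  shows "ev l (fgen D * a) s = rho l D (ev l a s)"
  by (induction a rule: poly_mapping_induct)
    (simp_all add: fgen_def mult_single distrib_left ev_simps rho_linear[OF assms] del: plus_fun_apply zero_fun_apply)

lemma ev_gen: "D \<in> W_carrier \<Longrightarrow> ev l (fgen D) s = rho l D s"
  using ev_gen_mult[of D l 1 s] by (simp add: ev_one)

lemma ev_fscal_mult: "ev l (fscal c * a) s = scT c (ev l a s)"
  by (induction a rule: poly_mapping_induct)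
    (simp_all add: fscal_def mult_single distrib_left ev_simps del: plus_fun_apply zero_fun_apply)

definition ordT :: "nat \<Rightarrow> 'a::field form \<Rightarrow> bool" where
  "ordT d s \<longleftrightarrow> (\<forall>k. ordge d (s k))"

lemma ordTD: "ordT d s \<Longrightarrow> i + j < d \<Longrightarrow> coeff2 (s k) i j = 0"
  by (auto simp: ordT_def ordge_def)

lemma ordT_shift: "ordT d s \<Longrightarrow> ordge d (shift s k)"
  by (cases k) (auto simp: ordT_def)

definition XX :: "'a::field vfield" where "XX = vf Lam 0"
definition YY :: "'a::field vfield" where "YY = vf 0 Lam"

definition XY :: "nat \<Rightarrow> nat \<Rightarrow> nat \<Rightarrow> 'a::field form \<Rightarrow> 'a form" where
  "XY l a b s = (rho l XX ^^ a) ((rho l YY ^^ b) s)"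

definition tp :: "(nat \<Rightarrow> 'a) \<Rightarrow> 'a::field form" where
  "tp c = (\<lambda>k. scale2 (c k) (monom2 (CHAR('a) - 1) (CHAR('a) - 1)))"

lemma tp_linear: "tp (\<lambda>k. c k + d k) = tp c + tp d" "tp (\<lambda>k. r * c k) = scT r (tp c)" "tp (\<lambda>k. 0) = 0"
  by (auto simp: tp_def scT_def scale2_left)

lemma XX_W: "XX \<in> W_carrier" and YY_W: "YY \<in> W_carrier"
  unfolding XX_def YY_def by blast+

lemma XY_0: "XY l a b 0 = 0"
proof -
  have "(rho l D ^^ n) 0 = 0" if "D \<in> W_carrier" for D :: "'a vfield" and n
    by (induction n) (simp_all add: rho_linear(3)[OF that] del: zero_fun_apply)
  from this[OF XX_W] this[OF YY_W] show ?thesis unfolding XY_def by simp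
qed

text \<open>The product (i + 1) ... (i + a), which is the coefficient of x^i in the a-th derivative
  of x^{i+a}.\<close>

definition rise :: "nat \<Rightarrow> nat \<Rightarrow> 'a::field" where
  "rise a i = (\<Prod>t<a. of_nat (Suc (i + t)))"

lemma rise_Suc: "rise (Suc a) i = of_nat (Suc i) * rise a (Suc i)"
  unfolding rise_def by (subst prod.lessThan_Suc_shift) simp

abbreviation grid :: "nat \<Rightarrow> (nat \<times> nat) set" where
  "grid n \<equiv> {..<n} \<times> {..<n}"

context char_gt3
begin

lemma of_nat_nz: "0 < n \<Longrightarrow> n < CHAR('a) \<Longrightarrow> of_nat n \<noteq> (0::'a)"
  by (simp add: of_nat_eq_0_iff_char_dvd nat_dvd_not_less)

lemma rise_nz: "i + a < CHAR('a) \<Longrightarrow> rise a i \<noteq> (0::'a)"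
  using of_nat_nz[of "Suc (i + t)" for t] unfolding rise_def by (auto simp del: of_nat_Suc)

lemma ev_mult:
  assumes "a \<in> carrier L.FA"
  shows "ev l (a * b) s = ev l a (ev l b s)"
  using assms
proof (induction a rule: free_induct)
  case (gen D a)
  hence "D \<in> W_carrier" using L_W by (simp add: L_alg_def)
  thus ?case using gen by (simp add: mult.assoc ev_gen_mult)
qed (simp_all add: ev_fscal ev_fscal_mult ev_simps distrib_right)

lemma ev_Sym:
  assumes "a \<in> carrier L.FA" "s \<in> Sym l"
  shows "ev l a s \<in> Sym l"
  using assms(1)
proof (induction a rule: free_induct)
  case (gen D a)
  hence "D \<in> W_carrier" using L_W by (simp add: L_alg_def)
  thus ?case using gen by (simp add: ev_gen_mult rho_Sym)
qed (simp_all add: ev_fscal ev_simps assms del: plus_fun_apply)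

lemma ev_linear:
  assumes "a \<in> carrier L.FA"
  shows "ev l a (s + t) = ev l a s + ev l a t" "ev l a (scT c s) = scT c (ev l a s)" "ev l a 0 = 0"
    "ev l a (s - t) = ev l a s - ev l a t"
proof -
  show add: "ev l a (s + t) = ev l a s + ev l a t" for s t
    using assms
  proof (induction a rule: free_induct)
    case (gen D a)
    hence "D \<in> W_carrier" using L_W by (simp add: L_alg_def)
    thus ?case using gen by (simp only: ev_gen_mult rho_linear)
  qed (simp_all only: ev_fscal scT_simps ev_simps add_ac)
  show "ev l a (scT c s) = scT c (ev l a s)"
    using assms
  proof (induction a rule: free_induct)
    case (gen D a)
    hence "D \<in> W_carrier" using L_W by (simp add: L_alg_def)
    thus ?case using gen by (simp only: ev_gen_mult rho_linear)
  qed (simp_all only: ev_fscal scT_simps ev_simps mult.commute)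
  show "ev l a 0 = 0" using add[of 0 0] by simp
  show "ev l a (s - t) = ev l a s - ev l a t" using add[of "s - t" t] by (simp add: algebra_simps)
qed

text \<open>An annihilator is two-sided as soon as the annihilated set is stable under the action,
  which is \<open>ev_Sym\<close>.\<close>

lemma ev_kernel_ideal: "ideal {a \<in> carrier L.FA. \<forall>s\<in>Sym l. ev l a s = 0} L.FA"
proof (intro idealI L.FA.ring_axioms L.FA.add.subgroupI)
  fix a assume "a \<in> {a \<in> carrier L.FA. \<forall>s\<in>Sym l. ev l a s = 0}"
  moreover have "ev l (- a) s = - ev l a s" for s
    using ev_simps(2)[of l 0 a s] by (simp add: ev_simps)
  ultimately show "\<ominus>\<^bsub>L.FA\<^esub> a \<in> {a \<in> carrier L.FA. \<forall>s\<in>Sym l. ev l a s = 0}"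
    by (simp add: free_a_inv)
qed (auto simp: ev_simps ev_mult ev_Sym ev_linear(3) intro!: exI[of _ 0])

text \<open>The annihilator of \<open>Sym l\<close> contains all defining relations because
  \<open>rho\<close> respects sums, scalars, brackets and p-th powers; \<open>u_kernel_least\<close>
  does the rest.\<close>

lemma ev_cong:
  assumes "a \<in> carrier L.FA" "b \<in> carrier L.FA" "u_class L_alg a = u_class L_alg b" "s \<in> Sym l"
  shows "ev l a s = ev l b s"
proof -
  let ?I = "{a \<in> carrier L.FA. \<forall>s\<in>Sym l. ev l a s = 0}"
  have W: "D \<in> W_carrier" if "D \<in> lie_carrier L_alg" for D :: "'a vfield"
    using L_W that by (simp add: L_alg_def)
  have sub: "U_relations L_alg \<subseteq> ?I"
  proof
    fix r :: "'a vfield list \<Rightarrow>\<^sub>0 'a" assume r: "r \<in> U_relations L_alg"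
    hence "r \<in> carrier L.FA" using L.U_relations_carrier by blast
    from r consider D E where "D \<in> L_carrier" "E \<in> L_carrier" "r = fgen (vadd D E) - fgen D - fgen E"
      | c D where "D \<in> L_carrier" "r = fgen (vscale c D) - fscal c * fgen D"
      | D E where "D \<in> L_carrier" "E \<in> L_carrier" "r = fgen D * fgen E - fgen E * fgen D - fgen (lie D E)"
      unfolding U_relations_def L_alg_def W2_sub_simps by blast
    hence "\<forall>s\<in>Sym l. ev l r s = 0"
    proof cases
      case 1
      note gen = ev_gen[OF L_W[OF 1(1)]] ev_gen[OF L_W[OF 1(2)]] ev_gen[OF L_W[OF L_closed(1)[OF 1(1,2)]]]
      show ?thesis unfolding 1(3) ev_simps gen rho_vadd by simp
    next
      case 2
      note gen = ev_gen[OF L_W[OF 2(1)]] ev_gen[OF L_W[OF L_closed(2)[OF 2(1) 2(1)]]]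
      show ?thesis unfolding 2(2) ev_simps ev_fscal_mult gen rho_vscale by simp
    next
      case 3
      note W = L_W[OF 3(1)] L_W[OF 3(2)]
      note gen = ev_gen[OF W(1)] ev_gen[OF W(2)] ev_gen[OF lie_W[OF W]]
        ev_gen_mult[OF W(1)] ev_gen_mult[OF W(2)]
      show ?thesis using rho_lie[OF W] unfolding 3(3) ev_simps gen by simp
    qed
    thus "r \<in> ?I" using \<open>r \<in> carrier L.FA\<close> by blast
  qed
  have pow: "fgen D ^ CHAR('a) - fgen (lie_pmap L_alg D) \<in> ?I" if D: "D \<in> lie_carrier L_alg" for D :: "'a vfield"
  proof -
    have "ev l (fgen D ^ n) s = (rho l D ^^ n) s" for n s
      by (induction n) (simp_all add: ev_one ev_gen_mult[OF W[OF D]])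
    moreover have "ev l (fgen (lie_pmap L_alg D)) s = (rho l D ^^ CHAR('a)) s" if "s \<in> Sym l" for s
      using that by (simp add: L_alg_def ev_gen[OF W_power[OF p0 W[OF D]]] rho_power[OF p0 W[OF D]])
    ultimately show ?thesis using D by (simp add: ev_simps L.lie_closed)
  qed
  have "a - b \<in> ?I" by (rule L.u_kernel_least[OF ev_kernel_ideal sub pow assms(1-3)])
  thus ?thesis using assms(4) by (simp add: ev_simps)
qed

section \<open>Leading terms\<close>

text \<open>This is where the factor \<open>Lam\<close> is needed: \<open>Lam_inv * Lam\<close> is
  constant, so the closedness condition is trivial.\<close>

lemma XX_L: "XX \<in> (L_carrier :: 'a vfield set)" and YY_L: "YY \<in> (L_carrier :: 'a vfield set)"
  by (simp_all add: XX_def YY_def L_vf_iff Lam_inv)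

text \<open>The correction x^{p-1} y^{p-1} raises degrees by 2p - 2 and its derivatives raise them
  by 2p - 3. Up to degree d neither can contribute.\<close>

lemma Lam_error:
  fixes h :: "'a O2"
  assumes "ordge d h" "i + j \<le> d"
  shows "coeff2 (Lam * dx h) i j = coeff2 (dx h) i j" "coeff2 (Lam * dy h) i j = coeff2 (dy h) i j"
    "coeff2 (dx Lam * h) i j = 0" "coeff2 (dy Lam * h) i j = 0"
proof -
  let ?m = "monom2 (CHAR('a) - 1) (CHAR('a) - 1) :: 'a O2"
  have m: "ordge (2 * CHAR('a) - 2) ?m" by (rule ordge_monom2) auto
  have "ordge (Suc d) (?m * dx h)" "ordge (Suc d) (?m * dy h)"
    by (rule ordge_mult[OF m ordge_dx[OF assms(1)]] ordge_mult[OF m ordge_dy[OF assms(1)]],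
        use char in linarith)+
  hence "coeff2 (?m * dx h) i j = 0" "coeff2 (?m * dy h) i j = 0"
    using assms(2) by (auto intro: ordgeD)
  thus "coeff2 (Lam * dx h) i j = coeff2 (dx h) i j" "coeff2 (Lam * dy h) i j = coeff2 (dy h) i j"
    by (simp_all add: Lam_def left_diff_distrib)
  have "ordge (Suc d) (dx ?m * h)" "ordge (Suc d) (dy ?m * h)"
    by (rule ordge_mult[OF ordge_dx[OF m] assms(1)] ordge_mult[OF ordge_dy[OF m] assms(1)],
        use char in linarith)+
  hence "coeff2 (dx ?m * h) i j = 0" "coeff2 (dy ?m * h) i j = 0"
    using assms(2) by (auto intro: ordgeD)
  thus "coeff2 (dx Lam * h) i j = 0" "coeff2 (dy Lam * h) i j = 0"
    by (simp_all add: Lam_def)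
qed

lemma rho_XX_coeff:
  assumes "ordT d s" "i + j \<le> d"
  shows "coeff2 (rho l XX s k) i j = of_nat (Suc i) * coeff2 (s k :: 'a O2) (Suc i) j"
    "coeff2 (rho l YY s k) i j = of_nat (Suc j) * coeff2 (s k :: 'a O2) i (Suc j)"
proof -
  have s: "ordge d (s k)" "ordge d (shift s k)" "ordge d (s (Suc k))" for k
    using assms(1) ordT_shift[OF assms(1)] by (auto simp: ordT_def)
  note e = Lam_error[OF s(1) assms(2)] Lam_error[OF s(2) assms(2)] Lam_error[OF s(3) assms(2)]
  have "XX (s k) = Lam * dx (s k)" "YY (s k) = Lam * dy (s k)"
    by (simp_all add: XX_def YY_def vf_def)
  thus "coeff2 (rho l XX s k) i j = of_nat (Suc i) * coeff2 (s k :: 'a O2) (Suc i) j"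
    "coeff2 (rho l YY s k) i j = of_nat (Suc j) * coeff2 (s k :: 'a O2) i (Suc j)"
    using e by (simp_all add: rho_def, simp_all add: XX_def YY_def)
qed

lemma rho_XX_ordT:
  assumes "ordT d s"
  shows "ordT (d - 1) (rho l XX (s :: 'a form))" "ordT (d - 1) (rho l YY (s :: 'a form))"
  using rho_XX_coeff[OF assms] ordTD[OF assms] unfolding ordT_def ordge_def by force+

text \<open>Each of X and Y lowers the order by at most one and acts on the lowest degree like a
  partial derivative; \<open>rise\<close> collects the resulting factors.\<close>

lemma XY_lead:
  fixes s :: "'a form"
  assumes "ordT d s" "a + b \<le> d"
  shows "ordT (d - (a + b)) (XY l a b s)"
    "i + j \<le> d - (a + b) \<Longrightarrow>
      coeff2 (XY l a b s k) i j = rise a i * rise b j * coeff2 (s k) (i + a) (j + b)"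
proof -
  have Y: "ordT (d - b) ((rho l YY ^^ b) s) \<and> (\<forall>i j. i + j \<le> d - b \<longrightarrow>
      coeff2 ((rho l YY ^^ b) s k) i j = rise b j * coeff2 (s k) i (j + b))" if "b \<le> d" for b
    using that
  proof (induction b)
    case (Suc b)
    hence IH: "ordT (d - b) ((rho l YY ^^ b) s)"
      "\<And>i j. i + j \<le> d - b \<Longrightarrow> coeff2 ((rho l YY ^^ b) s k) i j = rise b j * coeff2 (s k) i (j + b)"
      by auto
    show ?case using rho_XX_ordT(2)[OF IH(1)] rho_XX_coeff(2)[OF IH(1)] IH(2) Suc.prems
      by (auto simp: rise_Suc simp del: of_nat_Suc)
  qed (use assms in \<open>simp add: rise_def\<close>)
  have "ordT (d - (a + b)) (XY l a b s) \<and> (\<forall>i j. i + j \<le> d - (a + b) \<longrightarrow>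
      coeff2 (XY l a b s k) i j = rise a i * rise b j * coeff2 (s k) (i + a) (j + b))"
    using assms(2)
  proof (induction a)
    case 0
    thus ?case using Y[of b] by (simp add: XY_def rise_def)
  next
    case (Suc a)
    hence IH: "ordT (d - (a + b)) (XY l a b s)"
      "\<And>i j. i + j \<le> d - (a + b) \<Longrightarrow>
        coeff2 (XY l a b s k) i j = rise a i * rise b j * coeff2 (s k) (i + a) (j + b)"
      by auto
    have "XY l (Suc a) b s = rho l XX (XY l a b s)" by (simp add: XY_def)
    thus ?case using rho_XX_ordT(1)[OF IH(1)] rho_XX_coeff(1)[OF IH(1)] IH(2) Suc.prems
      by (auto simp: rise_Suc simp del: of_nat_Suc)
  qed
  thus "ordT (d - (a + b)) (XY l a b s)"
    "i + j \<le> d - (a + b) \<Longrightarrow>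
      coeff2 (XY l a b s k) i j = rise a i * rise b j * coeff2 (s k) (i + a) (j + b)" by auto
qed

lemma ordT_tp: "ordT (2 * (CHAR('a) - 1)) (tp c :: 'a form)"
  by (auto simp: ordT_def tp_def intro!: ordge_scale2 ordge_monom2)

text \<open>Among the nonzero terms choose one with a + b maximal, hence with leading degree
  minimal. Terms with the same a + b have different leading monomials x^{p-1-a} y^{p-1-b}, so one
  coefficient isolates the chosen term.\<close>

lemma XY_tp_independent:
  fixes c :: "nat \<Rightarrow> nat \<Rightarrow> nat \<Rightarrow> 'a"
  assumes "(\<Sum>(a, b)\<in>grid CHAR('a). XY l a b (tp (c a b))) = 0"
    and "a < CHAR('a)" "b < CHAR('a)"
  shows "c a b k = 0"
proof (rule ccontr)
  let ?p = "CHAR('a)"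
  define S where "S = {(a, b) \<in> grid ?p. \<exists>k. c a b k \<noteq> 0}"
  assume "c a b k \<noteq> 0"
  moreover have "S \<subseteq> grid ?p" by (auto simp: S_def)
  ultimately have "S \<noteq> {}" "finite S"
    using assms finite_subset[of S "grid ?p"] by (auto simp: S_def)
  hence "Max ((\<lambda>q. fst q + snd q) ` S) \<in> (\<lambda>q. fst q + snd q) ` S" by (intro Max_in) auto
  then obtain ab where "ab \<in> S" "fst ab + snd ab = Max ((\<lambda>q. fst q + snd q) ` S)" by auto
  hence max: "fst q + snd q \<le> fst ab + snd ab" if "q \<in> S" for q
    using that \<open>finite S\<close> by simp
  from \<open>ab \<in> S\<close> obtain a0 b0 k0 where ab: "ab = (a0, b0)" "a0 < ?p" "b0 < ?p" "c a0 b0 k0 \<noteq> 0"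
    by (auto simp: S_def)
  define i where "i = ?p - 1 - a0"
  define j where "j = ?p - 1 - b0"
  have trm: "coeff2 (XY l a b (tp (c a b)) k0) i j =
      (if (a, b) = (a0, b0) then rise a i * rise b j * c a b k0 else 0)"
    if "a < ?p" "b < ?p" for a b
  proof -
    have le: "a + b \<le> 2 * (?p - 1)" using that by simp
    note lead = XY_lead[OF ordT_tp[of "c a b"] le, where l = l]
    \<comment> \<open>A larger sum is excluded by maximality, a smaller sum gives an order too high
      to reach (i, j), and for equal sums the leading monomials decide.\<close>
    consider "a + b > a0 + b0" | "a + b < a0 + b0" | "a + b = a0 + b0" by linarith
    thus ?thesis
    proof cases
      case 1
      hence "(a, b) \<notin> S" using max[of "(a, b)"] ab by auto
      hence c0: "c a b = (\<lambda>_. 0)" using that by (auto simp: S_def)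
      have "XY l a b (tp (c a b)) = 0" unfolding c0 tp_linear(3) XY_0 ..
      moreover have "(a, b) \<noteq> (a0, b0)" using 1 by auto
      ultimately show ?thesis by auto
    next
      case 2
      hence "i + j < 2 * (?p - 1) - (a + b)" using ab that by (simp add: i_def j_def)
      thus ?thesis using ordTD[OF lead(1)] 2 by auto
    next
      case 3
      hence "i + j \<le> 2 * (?p - 1) - (a + b)" using ab that by (simp add: i_def j_def)
      thus ?thesis using lead(2)[of i j k0] 3 ab that
        by (auto simp: tp_def coeff2_monom2 i_def j_def)
    qed
  qed
  have app: "coeff2 ((sum F A) k) i j = (\<Sum>q\<in>A. coeff2 (F q k) i j)" for F :: "nat \<times> nat \<Rightarrow> 'a form" and A k
    by (induction A rule: infinite_finite_induct) auto
  have "0 = (\<Sum>q\<in>grid ?p. coeff2 ((case q of (a, b) \<Rightarrow> XY l a b (tp (c a b))) k0) i j)"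
    using assms(1) app[of "\<lambda>(a, b). XY l a b (tp (c a b))", symmetric] by simp
  also have "\<dots> = (\<Sum>q\<in>grid ?p. if q = (a0, b0) then rise a0 i * rise b0 j * c a0 b0 k0 else 0)"
    by (intro sum.cong refl) (auto simp: trm split: if_splits)
  also have "\<dots> = rise a0 i * rise b0 j * c a0 b0 k0"
    using ab by simp
  finally show False
    using ab rise_nz[of i a0] rise_nz[of j b0] by (simp add: i_def j_def)
qed

section \<open>Irreducibility of the module of symmetric forms\<close>

lemma top_mult: "(h :: 'a O2) * monom2 (CHAR('a) - 1) (CHAR('a) - 1) =
    scale2 (coeff2 h 0 0) (monom2 (CHAR('a) - 1) (CHAR('a) - 1))"
  by (subst mult.commute, rule O2_eqI) (auto simp: coeff2_monom2_mult coeff2_monom2)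

lemma of_nat_p1: "of_nat (CHAR('a) - 1) = (- 1 :: 'a)" "of_nat (CHAR('a) - 2) = (- 2 :: 'a)"
  "of_nat (CHAR('a) - Suc 0) = (- 1 :: 'a)"
  using char by (simp_all add: of_nat_diff)

text \<open>D multiplies the top monomial by minus the trace of its linear part, and this is 0 by
  \<open>divergence_00\<close>. Otherwise a character would twist the copy of V(lambda) in
  T.\<close>

lemma top_invariant:
  assumes "D \<in> L_filt 0"
  shows "D (monom2 (CHAR('a) - 1) (CHAR('a) - 1)) = (0 :: 'a O2)"
proof -
  obtain f g where D: "D = vf f g" using L0_W[OF assms] by blast
  have div: "coeff2 f (Suc 0) 0 + coeff2 g 0 (Suc 0) = 0"
    using divergence_00[OF L0_L[OF assms]] by (simp add: D)
  have 0: "coeff2 f 0 0 = 0" "coeff2 g 0 0 = 0" using assms by (simp_all add: L0_iff D)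
  have "f * monom2 (CHAR('a) - 2) (CHAR('a) - 1) = scale2 (coeff2 f (Suc 0) 0) (monom2 (CHAR('a) - 1) (CHAR('a) - 1))"
    "g * monom2 (CHAR('a) - 1) (CHAR('a) - 2) = scale2 (coeff2 g 0 (Suc 0)) (monom2 (CHAR('a) - 1) (CHAR('a) - 1))"
  proof -
    have r: "i \<in> {q - 2, q - 1}" if "i < q" "q - 2 \<le> i" for i q :: nat using that by auto
    show "f * monom2 (CHAR('a) - 2) (CHAR('a) - 1) = scale2 (coeff2 f (Suc 0) 0) (monom2 (CHAR('a) - 1) (CHAR('a) - 1))"
      using char 0 by (subst mult.commute, intro O2_eqI)
        (auto simp: coeff2_monom2_mult coeff2_monom2 Suc_diff_Suc dest!: r)
    show "g * monom2 (CHAR('a) - 1) (CHAR('a) - 2) = scale2 (coeff2 g 0 (Suc 0)) (monom2 (CHAR('a) - 1) (CHAR('a) - 1))"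
      using char 0 by (subst mult.commute, intro O2_eqI)
        (auto simp: coeff2_monom2_mult coeff2_monom2 Suc_diff_Suc dest!: r)
  qed
  hence "D (monom2 (CHAR('a) - 1) (CHAR('a) - 1)) =
      scale2 (- (coeff2 f (Suc 0) 0 + coeff2 g 0 (Suc 0))) (monom2 (CHAR('a) - 1) (CHAR('a) - 1))"
    using char by (simp add: D vf_def dx_monom2 dy_monom2 of_nat_p1 numeral_2_eq_2 scale2_left)
      (simp add: scale2_left(2)[of 0, simplified] algebra_simps)
  thus ?thesis by (simp add: div)
qed

text \<open>The operators of e, h, f on coefficients of binary forms in dx, dy: e replaces a dx by
  dy, f replaces a dy by dx, and h has weight 2k - l on dx^{l-k} dy^k. Thus dy^l is the highest
  weight vector.\<close>

definition cE :: "nat \<Rightarrow> (nat \<Rightarrow> 'a) \<Rightarrow> nat \<Rightarrow> 'a" where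
  "cE l c k = (of_nat l + 1 - of_nat k) * (case k of 0 \<Rightarrow> 0 | Suc n \<Rightarrow> c n)"
definition cH :: "nat \<Rightarrow> (nat \<Rightarrow> 'a) \<Rightarrow> nat \<Rightarrow> 'a" where
  "cH l c k = (2 * of_nat k - of_nat l) * c k"
definition cF :: "(nat \<Rightarrow> 'a) \<Rightarrow> nat \<Rightarrow> 'a" where
  "cF c k = (of_nat k + 1) * c (Suc k)"

text \<open>D kills the top monomial, and a product with that monomial sees only constant terms. So
  D acts through its linear part, as in the inflated module.\<close>

lemma rho_tp:
  assumes D: "D \<in> L_filt 0"
  shows "rho l D (tp c) = tp (\<lambda>k. coeff2 (D varx) 0 (Suc 0) * cE l c k
    + coeff2 (D vary) 0 (Suc 0) * cH l c k + coeff2 (D vary) (Suc 0) 0 * cF c k)"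
proof -
  have div: "coeff2 (D varx) (Suc 0) 0 = - coeff2 (D vary) 0 (Suc 0)"
    using divergence_00[OF L0_L[OF D]] by (simp add: add_eq_0_iff)
  have D0: "D (scale2 r (monom2 (CHAR('a) - 1) (CHAR('a) - 1))) = 0" for r
  proof -
    obtain f g where "D = vf f g" using L0_W[OF D] by blast
    thus ?thesis using top_invariant[OF D] by simp
  qed
  have sh: "shift (tp c) k = scale2 (case k of 0 \<Rightarrow> 0 | Suc n \<Rightarrow> c n) (monom2 (CHAR('a) - 1) (CHAR('a) - 1))" for k
    by (cases k) (simp_all add: tp_def)
  have "rho l D (tp c) k = tp (\<lambda>k. coeff2 (D varx) 0 (Suc 0) * cE l c k
    + coeff2 (D vary) 0 (Suc 0) * cH l c k + coeff2 (D vary) (Suc 0) 0 * cF c k) k" for k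
    unfolding rho_def sh
    by (simp only: tp_def D0 scale2_mult top_mult coeff2_simps scale2_simps scale2_left(1)[symmetric] div
        add_0_left)
      (simp add: cE_def cH_def cF_def algebra_simps)
  thus ?thesis by (rule ext)
qed

text \<open>In a monomial of lowest degree in s, X and Y act like partial derivatives, and
  differentiating it away leaves a nonzero multiple of a product of factorials below p.\<close>

lemma generate_const_term:
  fixes s :: "'a form"
  assumes "s \<noteq> 0"
  obtains i j k where "coeff2 (XY l i j s k) 0 0 \<noteq> 0" 
proof -
  let ?P = "\<lambda>d. \<exists>i j k. i + j = d \<and> coeff2 (s k) i j \<noteq> 0"
  obtain k where "s k \<noteq> 0" using assms by (auto simp: fun_eq_iff)
  then obtain i j where "coeff2 (s k) i j \<noteq> 0" by (metis O2_eqI coeff2_simps(1))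
  hence ex: "\<exists>d. ?P d" by blast
  define d where "d = (LEAST d. ?P d)"
  have "?P d" unfolding d_def by (rule LeastI_ex[OF ex])
  then obtain i j k where ijk: "i + j = d" "coeff2 (s k) i j \<noteq> 0" by blast
  have "\<not> ?P e" if "e < d" for e
    using that unfolding d_def by (rule not_less_Least)
  hence "ordT d s" unfolding ordT_def ordge_def by blast
  hence "coeff2 (XY l i j s k) 0 0 = rise i 0 * rise j 0 * coeff2 (s k) i j"
    using XY_lead(2)[of d s i j 0 0] ijk by simp
  moreover have "i < CHAR('a)" "j < CHAR('a)" using ijk coeff2_eq_0[of i j "s k"] by auto
  ultimately have "coeff2 (XY l i j s k) 0 0 \<noteq> 0"
    using rise_nz[of 0 i] rise_nz[of 0 j] ijk by auto
  thus ?thesis by (rule that)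
qed

text \<open>\<open>D1\<close> is \<open>D_Lam\<close> of x^4/4 and \<open>D2\<close> is
  \<open>D_Lam\<close> of x^{p-1} y^{p-1}. Their degrees 2 and 2p - 4 add up to the degree 2p - 2 of
  the top monomial.\<close>

definition D1 :: "'a vfield" where "D1 = vf 0 (monom2 3 0)"
definition D2 :: "'a vfield" where
  "D2 = vf (monom2 (CHAR('a) - 1) (CHAR('a) - 2)) (- monom2 (CHAR('a) - 2) (CHAR('a) - 1))"

lemma D12_L: "D1 \<in> L_carrier" "D2 \<in> L_carrier"
  using char by (simp_all add: D1_def D2_def L_vf_iff Lam_mult_monom2 dx_monom2 dy_monom2 numeral_2_eq_2)

text \<open>The operator \<open>rho D2 \<circ> rho D1\<close> has degree \<open>2 p - 2\<close>, so it only sees the constant terms, on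
  which it acts through \<open>F\<^sup>2\<close>.  This is where \<open>\<lambda> \<ge> 2\<close> is needed.\<close>

lemma rho_D2_D1:
  fixes s :: "'a form"
  shows "rho l D2 (rho l D1 s) =
    tp (\<lambda>k. 6 * of_nat (Suc k) * of_nat (Suc (Suc k)) * coeff2 (s (Suc (Suc k))) 0 0)"
proof -
  let ?p = "CHAR('a)"
  define t where "t = rho l D1 s"
  have tk: "t k = monom2 3 0 * dy (s k) + scale2 (3 * of_nat (Suc k)) (monom2 2 0 * s (Suc k))" for k
  proof -
    have v: "D1 varx = 0" "D1 vary = monom2 3 0" "D1 (s k) = monom2 3 0 * dy (s k)"
      by (simp_all add: D1_def) (simp add: vf_def)
    show ?thesis
      unfolding t_def rho_def v by (simp add: dx_monom2 dy_monom2) (simp add: algebra_simps)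
  qed
  have t: "coeff2 (t k) i j = 0" if "i < 2" for i j k
    using that by (simp add: tk coeff2_monom2_mult)
  have t2: "coeff2 (t k) 2 0 = 3 * of_nat (Suc k) * coeff2 (s (Suc k)) 0 0" for k
    using char by (simp add: tk coeff2_monom2_mult)
  have sh: "coeff2 (shift t k) i j = 0" if "i < 2" for i j k
    using t that by (cases k) auto
  have "rho l D2 t k = tp (\<lambda>k. 6 * of_nat (Suc k) * of_nat (Suc (Suc k)) * coeff2 (s (Suc (Suc k))) 0 0) k" for k
  proof (rule O2_eqI)
    fix i j assume ij: "i < ?p" "j < ?p"
    have [simp]: "of_nat (?p - 3) = (- 3 :: 'a)" using char by (simp add: of_nat_diff)
    have D2: "D2 (t k) = monom2 (?p - 1) (?p - 2) * dx (t k) - monom2 (?p - 2) (?p - 1) * dy (t k)"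
      by (simp add: D2_def vf_def)
    have f: "dx (D2 varx) = scale2 (-1) (monom2 (?p - 2) (?p - 2))"
      "dy (D2 varx) = scale2 (-2) (monom2 (?p - 1) (?p - 3))"
      "dx (D2 vary) = scale2 2 (monom2 (?p - 3) (?p - 1))"
      "dy (D2 vary) = monom2 (?p - 2) (?p - 2)"
      using char by (simp_all add: D2_def dx_monom2 dy_monom2 of_nat_p1 numeral_2_eq_2 numeral_3_eq_3)
        (rule O2_eqI, simp)+
    \<comment> \<open>\<open>t k\<close> is divisible by x^2 and its x-derivative by x, so these
      products all contain x^p.\<close>
    have c: "coeff2 (monom2 (?p - 1) (?p - 2) * dx (t k)) i j = 0"
      "coeff2 (monom2 (?p - 2) (?p - 1) * dy (t k)) i j = 0"
      "coeff2 (monom2 (?p - 2) (?p - 2) * t k) i j = 0"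
      "coeff2 (monom2 (?p - 1) (?p - 3) * shift t k) i j = 0"
      using ij char by (auto simp: coeff2_monom2_mult intro!: t sh)
    \<comment> \<open>The only surviving term pairs x^{p-3} y^{p-1} with the coefficient of x^2. The
      factor 2 from \<open>D2\<close> and the factor 3 from \<open>t2\<close> make up the constant
      6.\<close>
    have last: "coeff2 (monom2 (?p - 3) (?p - 1) * t (Suc k)) i j =
       (if i = ?p - 1 \<and> j = ?p - 1 then coeff2 (t (Suc k)) 2 0 else 0)"
    proof (cases "i = ?p - 1 \<and> j = ?p - 1")
      case True
      have "?p - 1 - (?p - 3) = 2" using char by simp
      thus ?thesis using True ij char by (simp add: coeff2_monom2_mult)
    next
      case False
      thus ?thesis using ij char by (auto simp: coeff2_monom2_mult intro!: t)
    qed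
    show "coeff2 (rho l D2 t k) i j = coeff2 (tp (\<lambda>k. 6 * of_nat (Suc k) * of_nat (Suc (Suc k)) *
        coeff2 (s (Suc (Suc k))) 0 0) k) i j"
      unfolding rho_def D2 f scale2_mult coeff2_simps c last
      using ij by (simp add: tp_def coeff2_monom2 t2) (simp add: algebra_simps)
  qed
  thus ?thesis unfolding t_def by (rule ext)
qed

lemma sl2_values: 
  "coeff2 (sl2_e varx) 0 (Suc 0) = (1 :: 'a)" "coeff2 (sl2_e vary) i j = (0 :: 'a)"
  "coeff2 (sl2_h varx) 0 (Suc 0) = (0 :: 'a)" "coeff2 (sl2_h vary) 0 (Suc 0) = (1 :: 'a)"
  "coeff2 (sl2_h vary) (Suc 0) 0 = (0 :: 'a)" 
  "coeff2 (sl2_f varx) i j = (0 :: 'a)" "coeff2 (sl2_f vary) 0 (Suc 0) = (0 :: 'a)"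
  "coeff2 (sl2_f vary) (Suc 0) 0 = (1 :: 'a)"
  using char by (simp_all add: sl2_e_def sl2_h_def sl2_f_def coeff2_monom2)

lemma rho_sl2_tp: "rho l sl2_e (tp c) = tp (cE l c)" "rho l sl2_h (tp c) = tp (cH l c)"
  "rho l sl2_f (tp c) = tp (cF c)"
  by (simp_all add: rho_tp sl2_L0 sl2_values del: One_nat_def)

lemma rho_e_const:
  "coeff2 (rho l sl2_e s k) 0 0 = cE l (\<lambda>k. coeff2 (s k) 0 0) k"
  using char by (cases k) (simp_all add: rho_def sl2_e_def vf_def coeff2_monom2_mult cE_def)

text \<open>Reaching the top forms is enough: they are the images of the elements
  \<open>t v\<close>, which generate the induced module.\<close>

proposition symmetric_forms_irreducible:
  assumes l: "2 \<le> l" "l < CHAR('a)"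
    and U: "U \<subseteq> Sym l" "\<And>s t. s \<in> U \<Longrightarrow> t \<in> U \<Longrightarrow> s + t \<in> U" "\<And>r s. s \<in> U \<Longrightarrow> scT r s \<in> U"
    and rho: "\<And>D s. D \<in> L_carrier \<Longrightarrow> s \<in> U \<Longrightarrow> rho l D s \<in> U"
    and s: "s \<in> U" "s \<noteq> (0 :: 'a form)"
    and c: "\<And>k. k > l \<Longrightarrow> c k = 0"
  shows "tp c \<in> U"
proof -
  have e: "rho l sl2_e s \<in> U" and f: "rho l sl2_f s \<in> U" if "s \<in> U" for s
    using rho that L0_L sl2_L0 by auto
  obtain i j k where "coeff2 (XY l i j s k) 0 0 \<noteq> 0"
    using generate_const_term[OF s(2)] by blast
  moreover have "XY l i j s \<in> U"
  proof -
    have pow: "(rho l D ^^ n) s \<in> U" if "D \<in> L_carrier" "s \<in> U" for D n s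
      using that by (induction n) (auto intro: rho)
    show ?thesis unfolding XY_def by (intro pow XX_L YY_L s)
  qed
  ultimately obtain s k where s: "s \<in> U" "coeff2 (s k) 0 0 \<noteq> 0" by blast
  \<comment> \<open>f^2 only sees constant terms containing dy at least twice. If there is none yet,
    e creates one, with factors l and l - 1 that are nonzero because 2 <= l < p.\<close>
  obtain s k where s: "s \<in> U" "coeff2 (s (Suc (Suc k))) 0 0 \<noteq> 0"
  proof -
    have nz: "of_nat l \<noteq> (0::'a)" "of_nat l - 1 \<noteq> (0::'a)"
      using of_nat_nz[of l] of_nat_nz[of "l - 1"] l by (auto simp: of_nat_diff)
    consider m where "k = Suc (Suc m)" | "k = 1" | "k = 0" by (cases k; cases "k - 1") auto
    thus ?thesis
    proof cases
      case 1
      thus ?thesis using s that by blast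
    next
      case 2
      hence "coeff2 (rho l sl2_e s 2) 0 0 \<noteq> 0" using s nz
        by (simp add: rho_e_const cE_def numeral_2_eq_2)
      thus ?thesis using e[OF s(1)] that[of _ 0] by (simp add: numeral_2_eq_2)
    next
      case 3
      hence "coeff2 (rho l sl2_e (rho l sl2_e s) 2) 0 0 \<noteq> 0" using s nz
        by (simp add: rho_e_const cE_def numeral_2_eq_2)
      thus ?thesis using e[OF e[OF s(1)]] that[of _ 0] by (simp add: numeral_2_eq_2)
    qed
  qed
  define c1 where "c1 = (\<lambda>k. 6 * of_nat (Suc k) * of_nat (Suc (Suc k)) * coeff2 (s (Suc (Suc k))) 0 0 :: 'a)"
  have k: "Suc (Suc k) \<le> l" using s U(1) by (metis SymD coeff2_simps(1) not_le subsetD)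
  \<comment> \<open>As p > 3, both factors of 6 are invertible.\<close>
  have six: "6 = (of_nat 2 * of_nat 3 :: 'a)" by simp
  have "c1 k \<noteq> 0"
    unfolding c1_def six using s(2) k l char
      of_nat_nz[of "Suc k"] of_nat_nz[of "Suc (Suc k)"] of_nat_nz[of 2] of_nat_nz[of 3]
    by (simp del: of_nat_Suc of_nat_numeral)
  moreover have "tp c1 \<in> U"
    using rho[OF D12_L(2) rho[OF D12_L(1) s(1)]] unfolding rho_D2_D1 c1_def .
  moreover have "c1 k = 0" if "k > l" for k
    using that s(1) U(1) SymD[of s l "Suc (Suc k)"] by (auto simp: c1_def)
  ultimately obtain K where K: "c1 K \<noteq> 0" "\<And>k. k > K \<Longrightarrow> c1 k = 0" "K \<le> l"
  proof -
    assume that: "\<And>K. c1 K \<noteq> 0 \<Longrightarrow> (\<And>k. K < k \<Longrightarrow> c1 k = 0) \<Longrightarrow> K \<le> l \<Longrightarrow> thesis"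
      and *: "c1 k \<noteq> 0" "\<And>k. l < k \<Longrightarrow> c1 k = 0"
    let ?K = "GREATEST k. c1 k \<noteq> 0"
    have b: "c1 k \<noteq> 0 \<Longrightarrow> k \<le> l" for k using *(2)[of k] by (meson not_le)
    have "c1 ?K \<noteq> 0" by (rule GreatestI_nat[where P = "\<lambda>k. c1 k \<noteq> 0", OF *(1) b])
    moreover have "c1 k = 0" if "?K < k" for k
      using Greatest_le_nat[where P = "\<lambda>k. c1 k \<noteq> 0", OF _ b] that by (meson not_le)
    ultimately show thesis using that b by blast
  qed
  \<comment> \<open>K-fold application of f reduces a vector with top index K to a nonzero multiple
    of dx^l, from which e recovers all monomials.\<close>
  have low: "\<exists>c0. tp c0 \<in> U \<and> c0 0 \<noteq> 0 \<and> (\<forall>k>0. c0 k = 0)"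
    if "tp c1 \<in> U" "c1 K \<noteq> 0" "\<And>k. k > K \<Longrightarrow> c1 k = 0" "K \<le> l" for c1 K
    using that
  proof (induction K arbitrary: c1)
    case (Suc K)
    have "tp (cF c1) \<in> U" using f[OF Suc.prems(1)] by (simp add: rho_sl2_tp)
    moreover have "cF c1 K \<noteq> 0"
      using Suc.prems(2,4) l of_nat_nz[of "Suc K"] by (simp add: cF_def add.commute)
    moreover have "cF c1 k = 0" if "k > K" for k using Suc.prems(3)[of "Suc k"] that by (simp add: cF_def)
    ultimately show ?case using Suc.IH[of "cF c1"] Suc.prems(4) by auto
  qed auto
  obtain c0 where c0: "tp c0 \<in> U" "c0 0 \<noteq> 0" "\<And>k. k > 0 \<Longrightarrow> c0 k = 0"
    using low[OF \<open>tp c1 \<in> U\<close> K] by blast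
  define \<epsilon> :: "nat \<Rightarrow> nat \<Rightarrow> 'a" where "\<epsilon> n k = (if k = n then 1 else 0)" for n k
  have basis: "tp (\<epsilon> n) \<in> U" if "n \<le> l" for n
    using that
  proof (induction n)
    case 0
    have "(\<lambda>k. inverse (c0 0) * c0 k) = \<epsilon> 0" using c0 by (auto simp: \<epsilon>_def fun_eq_iff)
    thus ?case using U(3)[OF c0(1), of "inverse (c0 0)"] by (simp flip: tp_linear(2))
  next
    case (Suc n)
    hence "tp (cE l (\<epsilon> n)) \<in> U" using e[of "tp (\<epsilon> n)"] by (simp add: rho_sl2_tp)
    moreover have "(\<lambda>k. inverse (of_nat (l - n)) * cE l (\<epsilon> n) k) = \<epsilon> (Suc n)"
      using Suc.prems l of_nat_nz[of "l - n"]
      by (auto simp: cE_def \<epsilon>_def fun_eq_iff of_nat_diff split: nat.split)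
    ultimately show ?case using U(3)[of "tp (cE l (\<epsilon> n))" "inverse (of_nat (l - n))"]
      by (simp flip: tp_linear(2))
  qed
  have "tp (\<lambda>k. if k < n then c k else 0) \<in> U" if "n \<le> Suc l" for n
    using that
  proof (induction n)
    case 0
    show ?case using U(3)[OF c0(1), of 0]
      unfolding scT_simps by (simp only: tp_linear(3) not_less_zero if_False)
  next
    case (Suc n)
    have "tp (\<lambda>k. (if k < n then c k else 0) + c n * \<epsilon> n k) \<in> U"
      unfolding tp_linear using Suc by (intro U basis) auto
    moreover have "(\<lambda>k. (if k < n then c k else 0) + c n * \<epsilon> n k) = (\<lambda>k. if k < Suc n then c k else 0)"
      by (auto simp: \<epsilon>_def fun_eq_iff less_Suc_eq)
    ultimately show ?case by simp
  qed
  from this[of "Suc l"] have "tp (\<lambda>k. if k < Suc l then c k else 0) \<in> U" by simp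
  moreover have "(\<lambda>k. if k < Suc l then c k else 0) = c" using c by (auto simp: fun_eq_iff)
  ultimately show ?thesis by simp
qed

end

section \<open>Extension of scalars\<close>

locale scalar_extension = A: ring A + V: abelian_group V
  for B :: "('b, 'k) ring_scheme" and A :: "('a, 'l) ring_scheme" and \<phi> :: "'b \<Rightarrow> 'a"
    and V :: "('b, 'v) module" +
  assumes phi_closed: "b \<in> carrier B \<Longrightarrow> \<phi> b \<in> carrier A"
    and V_smult_closed: "b \<in> carrier B \<Longrightarrow> v \<in> carrier V \<Longrightarrow> b \<odot>\<^bsub>V\<^esub> v \<in> carrier V"
begin

abbreviation "F \<equiv> free_Abelian_group (carrier A \<times> carrier V)"
abbreviation "R \<equiv> tensor_relations B A \<phi> V"
abbreviation "M \<equiv> extend_scalars B A \<phi> V"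

definition Rel :: "('a \<times> 'v \<Rightarrow>\<^sub>0 int) set" where "Rel = generate F R"

definition cls :: "('a \<times> 'v \<Rightarrow>\<^sub>0 int) \<Rightarrow> ('a \<times> 'v \<Rightarrow>\<^sub>0 int) set" where
  "cls c = Rel #>\<^bsub>F\<^esub> c"

definition tau :: "'a \<Rightarrow> 'v \<Rightarrow> ('a \<times> 'v \<Rightarrow>\<^sub>0 int) set" where
  "tau a v = cls (frag_of (a, v))"

definition lmul :: "'a \<Rightarrow> ('a \<times> 'v \<Rightarrow>\<^sub>0 int) \<Rightarrow> ('a \<times> 'v \<Rightarrow>\<^sub>0 int)" where
  "lmul r = frag_extend (\<lambda>(a, v). frag_of (r \<otimes>\<^bsub>A\<^esub> a, v))"

sublocale Fg: comm_group F by (rule abelian_free_Abelian_group)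

lemma tensor_relation_cases [consumes 1, case_names left right balanced]:
  assumes "r \<in> R"
  obtains a a' v where "a \<in> carrier A" "a' \<in> carrier A" "v \<in> carrier V"
      "r = frag_of (a \<oplus>\<^bsub>A\<^esub> a', v) - frag_of (a, v) - frag_of (a', v)"
    | a v v' where "a \<in> carrier A" "v \<in> carrier V" "v' \<in> carrier V"
      "r = frag_of (a, v \<oplus>\<^bsub>V\<^esub> v') - frag_of (a, v) - frag_of (a, v')"
    | a b v where "a \<in> carrier A" "b \<in> carrier B" "v \<in> carrier V"
      "r = frag_of (a \<otimes>\<^bsub>A\<^esub> \<phi> b, v) - frag_of (a, b \<odot>\<^bsub>V\<^esub> v)"
  using assms unfolding tensor_relations_def
  by (elim UnE CollectE exE conjE) (rule that; assumption)+

lemma diff_closed: "c \<in> carrier F \<Longrightarrow> d \<in> carrier F \<Longrightarrow> c - d \<in> carrier F"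
  using keys_diff[of c d] by auto

lemma add_closed: "c \<in> carrier F \<Longrightarrow> d \<in> carrier F \<Longrightarrow> c + d \<in> carrier F"
  using keys_add[of c d] by auto

lemma R_carrier: "R \<subseteq> carrier F"
proof
  fix r assume "r \<in> R"
  thus "r \<in> carrier F"
    by (cases rule: tensor_relation_cases)
      (auto intro!: diff_closed simp del: carrier_free_Abelian_group_iff
        simp: phi_closed V_smult_closed)
qed

lemma Rel_subgroup: "subgroup Rel F"
  unfolding Rel_def by (rule Fg.generate_is_subgroup[OF R_carrier])

lemma Rel_normal: "Rel \<lhd> F"
  using Rel_subgroup Fg.normal_iff_subgroup by blast

lemma Rel_diff: "c \<in> Rel \<Longrightarrow> d \<in> Rel \<Longrightarrow> c - d \<in> Rel"
proof -
  assume cd: "c \<in> Rel" "d \<in> Rel"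
  hence "d \<in> carrier F" using subgroup.subset[OF Rel_subgroup] by blast
  hence "- d \<in> Rel"
    using subgroup.m_inv_closed[OF Rel_subgroup cd(2)] by simp
  thus "c - d \<in> Rel" using subgroup.m_closed[OF Rel_subgroup cd(1), of "- d"] by simp
qed

lemma Rel_R: "r \<in> R \<Longrightarrow> r \<in> Rel"
  unfolding Rel_def by (rule generate.incl)

lemma Rel_induct [consumes 1, case_names rel zero add uminus]:
  assumes "c \<in> Rel" and R: "\<And>r. r \<in> R \<Longrightarrow> P r" and 0: "P 0"
    and add: "\<And>c d. P c \<Longrightarrow> P d \<Longrightarrow> P (c + d)" and uminus: "\<And>c. P c \<Longrightarrow> P (- c)"
  shows "P c"
  using assms(1) unfolding Rel_def
proof (induction rule: generate.induct)
  case (inv r)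
  have "r \<in> carrier F" using inv R_carrier by blast
  hence "inv\<^bsub>F\<^esub> r = - r" by simp
  thus ?case using inv R uminus by simp
qed (use R 0 add in auto)

lemma cls_eq_iff:
  assumes "c \<in> carrier F" "d \<in> carrier F"
  shows "cls c = cls d \<longleftrightarrow> c - d \<in> Rel"
proof
  assume "cls c = cls d"
  hence "c \<in> cls d" using Fg.rcos_self[OF assms(1) Rel_subgroup] by (simp add: cls_def)
  then obtain h where "h \<in> Rel" "c = h + d" by (auto simp: cls_def r_coset_def)
  thus "c - d \<in> Rel" by simp
next
  assume "c - d \<in> Rel"
  hence "c \<in> Rel #>\<^bsub>F\<^esub> d" by (auto simp: r_coset_def intro!: bexI[of _ "c - d"])
  thus "cls c = cls d" unfolding cls_def
    using Fg.repr_independence[OF _ assms(2) Rel_subgroup] by simp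
qed

lemma M_carrier: "carrier M = cls ` carrier F"
  by (simp add: extend_scalars_def Let_def carrier_FactGroup cls_def[abs_def] Rel_def)

lemma cls_0: "cls 0 = Rel"
  unfolding cls_def using Fg.coset_mult_one[OF subgroup.subset[OF Rel_subgroup]] by simp

lemma M_zero: "\<zero>\<^bsub>M\<^esub> = cls 0"
  unfolding cls_0 by (simp add: extend_scalars_def Let_def Rel_def)

lemma M_add:
  assumes "c \<in> carrier F" "d \<in> carrier F"
  shows "cls c \<oplus>\<^bsub>M\<^esub> cls d = cls (c + d)"
  using normal.rcos_sum[OF Rel_normal assms]
  by (simp add: extend_scalars_def Let_def cls_def Rel_def)

lemma lmul_simps: "lmul r (c + d) = lmul r c + lmul r d" "lmul r (c - d) = lmul r c - lmul r d"
  "lmul r (- c) = - lmul r c" "lmul r 0 = 0" "lmul r (frag_of (a, v)) = frag_of (r \<otimes>\<^bsub>A\<^esub> a, v)"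
  by (simp_all add: lmul_def frag_extend_add frag_extend_diff frag_extend_minus)

lemma F_induct [consumes 1, case_names gen diff]:
  assumes "c \<in> carrier F"
    and gen: "\<And>a v. a \<in> carrier A \<Longrightarrow> v \<in> carrier V \<Longrightarrow> P (frag_of (a, v))"
    and diff: "\<And>c d. c \<in> carrier F \<Longrightarrow> d \<in> carrier F \<Longrightarrow> P c \<Longrightarrow> P d \<Longrightarrow> P (c - d)"
  shows "P c"
proof (cases "carrier A \<times> carrier V = {}")
  case True
  thus ?thesis using V.zero_closed A.zero_closed by blast
next
  case False
  then obtain a v where av: "a \<in> carrier A" "v \<in> carrier V" by blast
  have "P (frag_of (a, v) - frag_of (a, v))" using av by (intro diff gen) auto
  hence 0: "P 0" by simp
  have "Poly_Mapping.keys c \<subseteq> carrier A \<times> carrier V" using assms(1) by simp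
  hence "c \<in> carrier F \<and> P c"
    by (induction rule: frag_induction) (use 0 gen diff diff_closed in auto)
  thus ?thesis by blast
qed

lemma lmul_closed:
  assumes "r \<in> carrier A" "c \<in> carrier F"
  shows "lmul r c \<in> carrier F"
  using assms(2)
proof (induction rule: F_induct)
  case (diff c d)
  show ?case unfolding lmul_simps using diff by (intro diff_closed)
qed (use assms(1) in \<open>simp add: lmul_simps\<close>)

text \<open>Left multiplication maps each defining relation to a defining relation, so it descends
  to the quotient.\<close>

lemma lmul_Rel:
  assumes r: "r \<in> carrier A" and "c \<in> Rel"
  shows "lmul r c \<in> Rel"
  using assms(2)
proof (induction rule: Rel_induct)
  case (rel s)
  hence "lmul r s \<in> R"
  proof (cases rule: tensor_relation_cases)
    case (left a a' v)
    thus ?thesis unfolding left lmul_simps tensor_relations_def A.r_distr[OF left(1,2) r]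
      using r by blast
  next
    case (right a v v')
    thus ?thesis unfolding right lmul_simps tensor_relations_def using r by blast
  next
    case (balanced a b v)
    have "lmul r s = frag_of ((r \<otimes>\<^bsub>A\<^esub> a) \<otimes>\<^bsub>A\<^esub> \<phi> b, v) - frag_of (r \<otimes>\<^bsub>A\<^esub> a, b \<odot>\<^bsub>V\<^esub> v)"
      using balanced r phi_closed by (simp add: lmul_simps A.m_assoc)
    thus ?thesis unfolding tensor_relations_def using balanced r by blast
  qed
  thus ?case by (rule Rel_R)
qed (use Rel_diff[of 0] Rel_diff subgroup.one_closed[OF Rel_subgroup]
    subgroup.m_closed[OF Rel_subgroup] in \<open>auto simp: lmul_simps\<close>)

lemma M_smult:
  assumes r: "r \<in> carrier A" and c: "c \<in> carrier F"
  shows "r \<odot>\<^bsub>M\<^esub> cls c = cls (lmul r c)"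
proof -
  have "Rel #>\<^bsub>F\<^esub> lmul r d = cls (lmul r c)" if "d \<in> cls c" for d
  proof -
    from that obtain h where h: "h \<in> Rel" "d = h + c" by (auto simp: cls_def r_coset_def)
    hence d: "d \<in> carrier F" using c subgroup.subset[OF Rel_subgroup] add_closed by blast
    have "lmul r d - lmul r c \<in> Rel" using lmul_Rel[OF r h(1)] by (simp add: h lmul_simps)
    thus ?thesis using cls_eq_iff[of "lmul r d" "lmul r c"] lmul_closed[OF r] c d
      by (simp add: cls_def)
  qed
  moreover have "c \<in> cls c" unfolding cls_def by (rule Fg.rcos_self[OF c Rel_subgroup])
  ultimately have "(\<lambda>c. Rel #>\<^bsub>F\<^esub> lmul r c) ` cls c = {cls (lmul r c)}" by auto
  thus ?thesis by (simp add: extend_scalars_def Let_def lmul_def Rel_def)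
qed

lemma cls_closed: "c \<in> carrier F \<Longrightarrow> cls c \<in> carrier M"
  by (auto simp: M_carrier)

lemma M_abelian_group: "abelian_group M"
proof (rule abelian_groupI)
  fix C D assume "C \<in> carrier M" "D \<in> carrier M"
  then obtain c d where cd: "C = cls c" "D = cls d" "c \<in> carrier F" "d \<in> carrier F"
    by (auto simp: M_carrier)
  show "C \<oplus>\<^bsub>M\<^esub> D \<in> carrier M" unfolding cd M_add[OF cd(3,4)] by (intro cls_closed add_closed cd)
  show "C \<oplus>\<^bsub>M\<^esub> D = D \<oplus>\<^bsub>M\<^esub> C" unfolding cd M_add[OF cd(3,4)] M_add[OF cd(4,3)] by (simp add: add.commute)
next
  fix C D E assume "C \<in> carrier M" "D \<in> carrier M" "E \<in> carrier M"
  then obtain c d e where cd: "C = cls c" "D = cls d" "E = cls e"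
    "c \<in> carrier F" "d \<in> carrier F" "e \<in> carrier F" by (auto simp: M_carrier)
  show "C \<oplus>\<^bsub>M\<^esub> D \<oplus>\<^bsub>M\<^esub> E = C \<oplus>\<^bsub>M\<^esub> (D \<oplus>\<^bsub>M\<^esub> E)"
    unfolding cd M_add[OF cd(4,5)] M_add[OF cd(5,6)] M_add[OF cd(4) add_closed[OF cd(5,6)]]
      M_add[OF add_closed[OF cd(4,5)] cd(6)] by (simp add: add.assoc)
next
  have 0: "0 \<in> carrier F" by simp
  show "\<zero>\<^bsub>M\<^esub> \<in> carrier M" unfolding M_zero by (rule cls_closed[OF 0])
  fix C assume "C \<in> carrier M"
  then obtain c where c: "C = cls c" "c \<in> carrier F" by (auto simp: M_carrier)
  show "\<zero>\<^bsub>M\<^esub> \<oplus>\<^bsub>M\<^esub> C = C" unfolding M_zero c M_add[OF 0 c(2)] by simp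
  have m: "- c \<in> carrier F" using c(2) by simp
  show "\<exists>D\<in>carrier M. D \<oplus>\<^bsub>M\<^esub> C = \<zero>\<^bsub>M\<^esub>"
    by (rule bexI[of _ "cls (- c)"], unfold c M_add[OF m c(2)] M_zero) (use cls_closed[OF m] in auto)
qed

lemma cls_eqI: "c \<in> carrier F \<Longrightarrow> d \<in> carrier F \<Longrightarrow> c - d \<in> Rel \<Longrightarrow> cls c = cls d"
  using cls_eq_iff by blast

lemma M_left_module: "left_module A M"
proof (intro left_module.intro left_module_axioms.intro A.ring_axioms M_abelian_group)
  fix r C assume r: "r \<in> carrier A" "C \<in> carrier M"
  then obtain c where c: "C = cls c" "c \<in> carrier F" by (auto simp: M_carrier)
  show "r \<odot>\<^bsub>M\<^esub> C \<in> carrier M"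
    unfolding c M_smult[OF r(1) c(2)] by (intro cls_closed lmul_closed r c)
next
  fix r s C assume r: "r \<in> carrier A" "s \<in> carrier A" "C \<in> carrier M"
  then obtain c where c: "C = cls c" "c \<in> carrier F" by (auto simp: M_carrier)
  have rs: "r \<oplus>\<^bsub>A\<^esub> s \<in> carrier A" "r \<otimes>\<^bsub>A\<^esub> s \<in> carrier A" using r by auto
  have cl: "lmul r c \<in> carrier F" "lmul s c \<in> carrier F" "lmul (r \<oplus>\<^bsub>A\<^esub> s) c \<in> carrier F"
    by (intro lmul_closed r rs c)+
  have "lmul (r \<oplus>\<^bsub>A\<^esub> s) c - (lmul r c + lmul s c) \<in> Rel" using c(2)
  proof (induction rule: F_induct)
    case (gen a v)
    have "frag_of (r \<otimes>\<^bsub>A\<^esub> a \<oplus>\<^bsub>A\<^esub> s \<otimes>\<^bsub>A\<^esub> a, v) - frag_of (r \<otimes>\<^bsub>A\<^esub> a, v) - frag_of (s \<otimes>\<^bsub>A\<^esub> a, v) \<in> R"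
      unfolding tensor_relations_def using gen r by blast
    thus ?case using gen r by (intro Rel_R) (simp add: lmul_simps A.l_distr diff_diff_eq)
  next
    case (diff c d)
    have "lmul (r \<oplus>\<^bsub>A\<^esub> s) (c - d) - (lmul r (c - d) + lmul s (c - d)) =
      (lmul (r \<oplus>\<^bsub>A\<^esub> s) c - (lmul r c + lmul s c)) - (lmul (r \<oplus>\<^bsub>A\<^esub> s) d - (lmul r d + lmul s d))"
      by (simp add: lmul_simps)
    thus ?case using Rel_diff[OF diff(3,4)] by simp
  qed
  thus "(r \<oplus>\<^bsub>A\<^esub> s) \<odot>\<^bsub>M\<^esub> C = r \<odot>\<^bsub>M\<^esub> C \<oplus>\<^bsub>M\<^esub> s \<odot>\<^bsub>M\<^esub> C"
    unfolding c M_smult[OF r(1) c(2)] M_smult[OF r(2) c(2)] M_smult[OF rs(1) c(2)] M_add[OF cl(1,2)]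
    by (intro cls_eqI cl add_closed)
  have "lmul (r \<otimes>\<^bsub>A\<^esub> s) c = lmul r (lmul s c)" using c(2)
    by (induction rule: F_induct) (simp_all add: lmul_simps r A.m_assoc)
  thus "(r \<otimes>\<^bsub>A\<^esub> s) \<odot>\<^bsub>M\<^esub> C = r \<odot>\<^bsub>M\<^esub> (s \<odot>\<^bsub>M\<^esub> C)"
    unfolding c M_smult[OF r(2) c(2)] M_smult[OF rs(2) c(2)] M_smult[OF r(1) cl(2)] by simp
next
  fix r C D assume r: "r \<in> carrier A" and "C \<in> carrier M" "D \<in> carrier M"
  then obtain c d where cd: "C = cls c" "D = cls d" "c \<in> carrier F" "d \<in> carrier F"
    by (auto simp: M_carrier)
  show "r \<odot>\<^bsub>M\<^esub> (C \<oplus>\<^bsub>M\<^esub> D) = r \<odot>\<^bsub>M\<^esub> C \<oplus>\<^bsub>M\<^esub> r \<odot>\<^bsub>M\<^esub> D"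
    unfolding cd M_add[OF cd(3,4)] M_smult[OF r cd(3)] M_smult[OF r cd(4)]
      M_smult[OF r add_closed[OF cd(3,4)]] M_add[OF lmul_closed[OF r cd(3)] lmul_closed[OF r cd(4)]]
    by (simp add: lmul_simps)
next
  fix C assume "C \<in> carrier M"
  then obtain c where c: "C = cls c" "c \<in> carrier F" by (auto simp: M_carrier)
  have "lmul \<one>\<^bsub>A\<^esub> c = c" using c(2)
    by (induction rule: F_induct) (simp_all add: lmul_simps)
  thus "\<one>\<^bsub>A\<^esub> \<odot>\<^bsub>M\<^esub> C = C" unfolding c M_smult[OF A.one_closed c(2)] by simp
qed

sublocale M: left_module A M by (rule M_left_module)

section \<open>Pure tensors and the universal property\<close>

lemma frag_carrier: "a \<in> carrier A \<Longrightarrow> v \<in> carrier V \<Longrightarrow> frag_of (a, v) \<in> carrier F"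
  by simp

lemma tau_closed: "a \<in> carrier A \<Longrightarrow> v \<in> carrier V \<Longrightarrow> tau a v \<in> carrier M"
  unfolding tau_def by (intro cls_closed frag_carrier)

lemma tau_add:
  assumes "a \<in> carrier A" "v \<in> carrier V" "w \<in> carrier V"
  shows "tau a (v \<oplus>\<^bsub>V\<^esub> w) = tau a v \<oplus>\<^bsub>M\<^esub> tau a w"
proof -
  have *: "frag_of (a, v) \<in> carrier F" "frag_of (a, w) \<in> carrier F" "frag_of (a, v \<oplus>\<^bsub>V\<^esub> w) \<in> carrier F"
    using assms by auto
  have "frag_of (a, v \<oplus>\<^bsub>V\<^esub> w) - frag_of (a, v) - frag_of (a, w) \<in> R"
    unfolding tensor_relations_def using assms by blast
  thus ?thesis unfolding tau_def M_add[OF *(1,2)]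
    by (intro cls_eqI * add_closed Rel_R) (simp add: diff_diff_eq)
qed

lemma tau_balanced:
  assumes "a \<in> carrier A" "b \<in> carrier B" "v \<in> carrier V"
  shows "tau (a \<otimes>\<^bsub>A\<^esub> \<phi> b) v = tau a (b \<odot>\<^bsub>V\<^esub> v)"
proof -
  have "frag_of (a \<otimes>\<^bsub>A\<^esub> \<phi> b, v) - frag_of (a, b \<odot>\<^bsub>V\<^esub> v) \<in> R"
    unfolding tensor_relations_def using assms by blast
  thus ?thesis unfolding tau_def using assms
    by (intro cls_eqI frag_carrier Rel_R) (simp_all add: phi_closed V_smult_closed)
qed

lemma smult_tau:
  "r \<in> carrier A \<Longrightarrow> a \<in> carrier A \<Longrightarrow> v \<in> carrier V \<Longrightarrow> r \<odot>\<^bsub>M\<^esub> tau a v = tau (r \<otimes>\<^bsub>A\<^esub> a) v"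
  unfolding tau_def by (simp add: M_smult[OF _ frag_carrier] lmul_simps)

lemma cls_diff:
  assumes "c \<in> carrier F" "d \<in> carrier F"
  shows "cls (c - d) = cls c \<ominus>\<^bsub>M\<^esub> cls d"
proof -
  have "cls (c - d) \<oplus>\<^bsub>M\<^esub> cls d = cls c"
    using M_add[OF diff_closed[OF assms] assms(2)] by simp
  thus ?thesis
    using M.M.add.inv_solve_right[OF cls_closed[OF diff_closed[OF assms]] cls_closed[OF assms(1)]
        cls_closed[OF assms(2)]] by (simp add: a_minus_def)
qed

lemma submodule_eq_carrier:
  assumes "submodule N A M" "\<And>v. v \<in> carrier V \<Longrightarrow> tau \<one>\<^bsub>A\<^esub> v \<in> N"
  shows "N = carrier M"
proof -
  interpret N: submodule N A M by (rule assms)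
  have "cls c \<in> N" if "c \<in> carrier F" for c
    using that
  proof (induction rule: F_induct)
    case (gen a v)
    have "a \<odot>\<^bsub>M\<^esub> tau \<one>\<^bsub>A\<^esub> v \<in> N" using gen assms(2) by blast
    thus ?case using smult_tau[of a "\<one>\<^bsub>A\<^esub>" v] gen by (simp add: tau_def)
  next
    case (diff c d)
    note cls_diff[OF diff(1,2)]
    moreover have "\<ominus>\<^bsub>M\<^esub> cls d \<in> N" using N.m_inv_closed[OF diff(4)] by (simp add: a_inv_def)
    ultimately show ?case using N.m_closed[OF diff(3)] by (simp add: a_minus_def)
  qed
  thus ?thesis using N.subset by (auto simp: M_carrier)
qed

lemma M_induct [consumes 1, case_names gen diff]:
  assumes "m \<in> carrier M"
    and gen: "\<And>a v. a \<in> carrier A \<Longrightarrow> v \<in> carrier V \<Longrightarrow> P (tau a v)"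
    and diff: "\<And>m n. m \<in> carrier M \<Longrightarrow> n \<in> carrier M \<Longrightarrow> P m \<Longrightarrow> P n \<Longrightarrow> P (m \<ominus>\<^bsub>M\<^esub> n)"
  shows "P m"
proof -
  obtain c where c: "m = cls c" "c \<in> carrier F" using assms(1) by (auto simp: M_carrier)
  have "P (cls c)" using c(2)
  proof (induction rule: F_induct)
    case (gen a v)
    thus ?case using assms(2) by (simp add: tau_def)
  next
    case (diff c d)
    thus ?case using cls_diff[OF diff(1,2)] assms(3) cls_closed by simp
  qed
  thus ?thesis by (simp add: c)
qed

text \<open>The target is merely an abelian group, so \<open>sc\<close> supplies its integer
  multiples; for forms these are scalar multiples by \<open>of_int n\<close>.\<close>

lemma extend_universal:
  fixes h :: "'a \<Rightarrow> 'v \<Rightarrow> 't::ab_group_add" and sc :: "int \<Rightarrow> 't \<Rightarrow> 't"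
  assumes sc: "\<And>m n x. sc (m + n) x = sc m x + sc n x" "\<And>x. sc 1 x = x"
    and h: "\<And>a a' v. a \<in> carrier A \<Longrightarrow> a' \<in> carrier A \<Longrightarrow> v \<in> carrier V \<Longrightarrow>
        h (a \<oplus>\<^bsub>A\<^esub> a') v = h a v + h a' v"
      "\<And>a v v'. a \<in> carrier A \<Longrightarrow> v \<in> carrier V \<Longrightarrow> v' \<in> carrier V \<Longrightarrow>
        h a (v \<oplus>\<^bsub>V\<^esub> v') = h a v + h a v'"
      "\<And>a b v. a \<in> carrier A \<Longrightarrow> b \<in> carrier B \<Longrightarrow> v \<in> carrier V \<Longrightarrow>
        h (a \<otimes>\<^bsub>A\<^esub> \<phi> b) v = h a (b \<odot>\<^bsub>V\<^esub> v)"
  obtains g where "\<And>m n. m \<in> carrier M \<Longrightarrow> n \<in> carrier M \<Longrightarrow> g (m \<oplus>\<^bsub>M\<^esub> n) = g m + g n"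
    "\<And>a v. a \<in> carrier A \<Longrightarrow> v \<in> carrier V \<Longrightarrow> g (tau a v) = h a v"
proof
  define H where "H = pm_extend (\<lambda>(a, v) n. sc n (h a v))"
  have H: "H (c + d) = H c + H d" "H (c - d) = H c - H d" "H 0 = 0" "H (frag_of (a, v)) = h a v" for c d a v
    unfolding H_def using sc by (simp_all add: pm_extend_add pm_extend_diff pm_extend_0 pm_extend_single
        split: prod.splits)
  have "H c = 0" if "c \<in> Rel" for c
    using that
  proof (induction rule: Rel_induct)
    case (rel r)
    thus ?case by (cases rule: tensor_relation_cases) (simp_all add: H h)
  next
    case (uminus c)
    thus ?case using H(2)[of 0 c] H(3) by simp
  qed (simp_all add: H)
  hence eq: "H c = H d" if "c \<in> carrier F" "d \<in> carrier F" "cls c = cls d" for c d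
    using cls_eq_iff[of c d] that H(2)[of c d] by auto
  define g where "g m = H (SOME c. c \<in> carrier F \<and> cls c = m)" for m
  have g: "g (cls c) = H c" if "c \<in> carrier F" for c
  proof -
    have "(SOME d. d \<in> carrier F \<and> cls d = cls c) \<in> carrier F \<and>
        cls (SOME d. d \<in> carrier F \<and> cls d = cls c) = cls c"
      by (rule someI[of "\<lambda>d. d \<in> carrier F \<and> cls d = cls c" c]) (use that in blast)
    thus ?thesis unfolding g_def using eq that by blast
  qed
  show "g (tau a v) = h a v" if "a \<in> carrier A" "v \<in> carrier V" for a v
    unfolding tau_def g[OF frag_carrier[OF that]] by (rule H)
  fix m n assume "m \<in> carrier M" "n \<in> carrier M"
  then obtain c d where cd: "m = cls c" "n = cls d" "c \<in> carrier F" "d \<in> carrier F"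
    by (auto simp: M_carrier)
  show "g (m \<oplus>\<^bsub>M\<^esub> n) = g m + g n"
    unfolding cd M_add[OF cd(3,4)] g[OF cd(3)] g[OF cd(4)] g[OF add_closed[OF cd(3,4)]] by (rule H)
qed

end

section \<open>Irreducible restricted modules of \<open>sl\<^sub>2\<close>\<close>

locale weight_module = char_gt3 ty for ty :: "'a::field itself" +
  fixes l :: nat and V :: "('a, 'a vfield, 'v) restricted_module"
  assumes l: "2 \<le> l" "l < CHAR('a)" and is_V: "is_V l V"
begin

sublocale V: rmod "sl2_alg :: ('a, 'a vfield) restricted_lie" V
  using is_V by (intro rmod.intro sl2.rlie_axioms) (simp add: is_V_def irreducible_module_def)

abbreviation "Ve \<equiv> V.act sl2_e"
abbreviation "Vh \<equiv> V.act sl2_h"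
abbreviation "Vf \<equiv> V.act sl2_f"

lemma sl2_mem [simp]: "sl2_e \<in> lie_carrier (sl2_alg :: ('a, 'a vfield) restricted_lie)"
  "sl2_h \<in> lie_carrier (sl2_alg :: ('a, 'a vfield) restricted_lie)"
  "sl2_f \<in> lie_carrier (sl2_alg :: ('a, 'a vfield) restricted_lie)"
  unfolding sl2_carrier using deg0_sl2 sl2_L0 by (metis imageI)+

definition v0 :: 'v where
  "v0 = (SOME v. v \<in> carrier V \<and> v \<noteq> \<zero>\<^bsub>V\<^esub> \<and> Ve v = \<zero>\<^bsub>V\<^esub> \<and> Vh v = V.scal (of_nat l) v)"

lemma v0: "v0 \<in> carrier V" "v0 \<noteq> \<zero>\<^bsub>V\<^esub>" "Ve v0 = \<zero>\<^bsub>V\<^esub>" "Vh v0 = V.scal (of_nat l) v0"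
proof -
  have "\<exists>v. v \<in> carrier V \<and> v \<noteq> \<zero>\<^bsub>V\<^esub> \<and> Ve v = \<zero>\<^bsub>V\<^esub> \<and> Vh v = V.scal (of_nat l) v"
    using is_V unfolding is_V_def V.act_def V.scal_def by blast
  from someI_ex[OF this] show "v0 \<in> carrier V" "v0 \<noteq> \<zero>\<^bsub>V\<^esub>" "Ve v0 = \<zero>\<^bsub>V\<^esub>" "Vh v0 = V.scal (of_nat l) v0"
    unfolding v0_def by blast+
qed

definition u :: "nat \<Rightarrow> 'v" where "u n = (Vf ^^ n) v0"

lemma u_closed [simp]: "u n \<in> carrier V"
  unfolding u_def by (induction n) (simp_all add: v0)

lemma u_simps: "u 0 = v0" "Vf (u n) = u (Suc n)"
  by (simp_all add: u_def)

lemma sl2_brackets: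
  "lie sl2_e sl2_f = (sl2_h :: 'a vfield)" "lie sl2_h sl2_f = vscale (- 2) (sl2_f :: 'a vfield)"
proof -
  have "- varx - varx = scale2 (- 2) (varx :: 'a O2)" by (rule O2_eqI) simp
  thus "lie sl2_e sl2_f = (sl2_h :: 'a vfield)" "lie sl2_h sl2_f = vscale (- 2) (sl2_f :: 'a vfield)"
    unfolding sl2_e_def sl2_f_def sl2_h_def bracket_vf vscale_vf by simp_all
qed

lemma Vh_u: "Vh (u n) = V.scal (of_nat l - 2 * of_nat n) (u n)"
proof (induction n)
  case (Suc n)
  have "Vh (u (Suc n)) = Vf (Vh (u n)) \<oplus>\<^bsub>V\<^esub> V.act (vscale (- 2) sl2_f) (u n)"
    using V.act_lie(2)[of sl2_h sl2_f "u n"] by (simp add: u_simps sl2_brackets)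
  also have "V.act (vscale (- 2) sl2_f) (u n) = V.scal (- 2) (u (Suc n))"
    using V.act_lie_scale[of sl2_f "u n" "- 2"] by (simp add: u_simps)
  also have "Vf (Vh (u n)) = V.scal (of_nat l - 2 * of_nat n) (u (Suc n))"
    using V.act_linear(3)[of sl2_f "u n"] by (simp add: Suc u_simps)
  finally show ?case
    by (simp add: algebra_simps flip: V.scal_linear(3))
qed (simp add: u_simps v0)

lemma Ve_u: "Ve (u (Suc n)) = V.scal (of_nat (Suc n) * (of_nat l - of_nat n)) (u n)"
proof (induction n)
  case 0
  have "Ve (u (Suc 0)) = Vf (Ve (u 0)) \<oplus>\<^bsub>V\<^esub> Vh (u 0)"
    using V.act_lie(2)[of sl2_e sl2_f "u 0"] by (simp add: u_simps(2) sl2_brackets)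
  thus ?case using V.act_linear(2)[of sl2_f] by (simp add: u_simps(1) v0)
next
  case (Suc n)
  have "Ve (u (Suc (Suc n))) = Vf (Ve (u (Suc n))) \<oplus>\<^bsub>V\<^esub> Vh (u (Suc n))"
    using V.act_lie(2)[of sl2_e sl2_f "u (Suc n)"] by (simp add: u_simps sl2_brackets)
  also have "Vf (Ve (u (Suc n))) = V.scal (of_nat (Suc n) * (of_nat l - of_nat n)) (u (Suc n))"
    unfolding Suc using V.act_linear(3)[of sl2_f "u n"] by (simp add: u_simps)
  also have "\<dots> \<oplus>\<^bsub>V\<^esub> Vh (u (Suc n)) = V.scal
      (of_nat (Suc n) * (of_nat l - of_nat n) + (of_nat l - 2 * of_nat (Suc n))) (u (Suc n))"
    unfolding Vh_u by (rule V.scal_linear(3)[symmetric]) simp_all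
  also have "of_nat (Suc n) * (of_nat l - of_nat n) + (of_nat l - 2 * of_nat (Suc n))
      = of_nat (Suc (Suc n)) * (of_nat l - of_nat (Suc n) :: 'a)"
    by (simp add: algebra_simps)
  finally show ?case .
qed

text \<open>f^2 kills x and y, hence f^p = 0 as a vector field, and in a restricted module this
  forces the p-th power of \<open>Vf\<close> to vanish. The zero field is written
  \<open>vscale 0 sl2_f\<close> so that linearity of the action applies.\<close>

lemma u_p: "u (CHAR('a)) = \<zero>\<^bsub>V\<^esub>"
proof -
  let ?f = "sl2_f :: 'a vfield"
  have "CHAR('a) = Suc (Suc (CHAR('a) - 2))" using char by simp
  then obtain n where n: "CHAR('a) = Suc (Suc n)" by blast
  have f: "?f 0 = 0" "?f varx = 0" "?f vary = varx" by (simp_all add: sl2_f_def)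
  have "(?f ^^ m) 0 = 0" for m by (induction m) (simp_all add: f(1))
  hence p: "(?f ^^ CHAR('a)) varx = 0" "(?f ^^ CHAR('a)) vary = 0"
    unfolding n by (simp_all only: funpow_Suc_right o_apply f)
  have W: "?f \<in> W_carrier" "vscale 0 ?f \<in> W_carrier"
    unfolding sl2_f_def vscale_vf by blast+
  have "?f ^^ CHAR('a) = vscale 0 ?f"
    by (rule W_eqI[OF W_power[OF p0 W(1)] W(2)]) (simp_all only: p vscale_def scale2_simps)
  hence "u (CHAR('a)) = V.act (vscale 0 ?f) v0"
    using V.act_pow[of sl2_f v0] v0(1) by (simp add: u_def)
  thus ?thesis using V.act_lie_scale[of sl2_f v0 0] v0(1) V.scal_linear(6) by simp
qed

primrec comb :: "nat \<Rightarrow> (nat \<Rightarrow> 'a) \<Rightarrow> 'v" where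
  "comb 0 c = \<zero>\<^bsub>V\<^esub>"
| "comb (Suc n) c = comb n c \<oplus>\<^bsub>V\<^esub> V.scal (c n) (u n)"

lemma comb_closed [simp]: "comb n c \<in> carrier V"
  by (induction n) simp_all

lemma comb_zero: "(\<And>k. k < n \<Longrightarrow> c k = 0 \<or> u k = \<zero>\<^bsub>V\<^esub>) \<Longrightarrow> comb n c = \<zero>\<^bsub>V\<^esub>"
proof (induction n)
  case (Suc n)
  hence "c n = 0 \<or> u n = \<zero>\<^bsub>V\<^esub>" by blast
  hence "V.scal (c n) (u n) = \<zero>\<^bsub>V\<^esub>"
    using V.scal_linear(2,6) by auto
  thus ?case using Suc by simp
qed simp

lemma comb_cong: "(\<And>k. k < n \<Longrightarrow> c k = d k) \<Longrightarrow> comb n c = comb n d"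
  by (induction n) simp_all

lemma comb_add: "comb n (\<lambda>k. c k + d k) = comb n c \<oplus>\<^bsub>V\<^esub> comb n d"
proof (induction n)
  case (Suc n)
  have "V.scal (c n + d n) (u n) = V.scal (c n) (u n) \<oplus>\<^bsub>V\<^esub> V.scal (d n) (u n)"
    by (rule V.scal_linear(3)) simp_all
  thus ?case using Suc by (simp add: V.M.a_ac)
qed simp

lemma comb_scale: "comb n (\<lambda>k. r * c k) = V.scal r (comb n c)"
proof (induction n)
  case 0
  show ?case using V.scal_linear(2) v0 by simp
next
  case (Suc n)
  have "V.scal (r * c n) (u n) = V.scal r (V.scal (c n) (u n))"
    by (rule V.scal_linear(4)) simp_all
  thus ?case using Suc V.scal_linear(1)[of "comb n c" "V.scal (c n) (u n)" r] by simp
qed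

lemma comb_extend: "n \<le> m \<Longrightarrow> (\<And>k. n \<le> k \<Longrightarrow> k < m \<Longrightarrow> c k = 0 \<or> u k = \<zero>\<^bsub>V\<^esub>) \<Longrightarrow> comb m c = comb n c"
proof (induction m rule: dec_induct)
  case (step m)
  hence "c m = 0 \<or> u m = \<zero>\<^bsub>V\<^esub>" by simp
  hence "V.scal (c m) (u m) = \<zero>\<^bsub>V\<^esub>"
    using V.scal_linear(2,6) by auto
  thus ?case using step by simp
qed simp

text \<open>The action on coordinates with respect to the vectors \<open>u k\<close>, as opposed to
  \<open>cE\<close>, \<open>cH\<close>, \<open>cF\<close>, which refer to monomials in dx and
  dy.\<close>

definition sE :: "(nat \<Rightarrow> 'a) \<Rightarrow> nat \<Rightarrow> 'a" where
  "sE c k = of_nat (Suc k) * (of_nat l - of_nat k) * c (Suc k)"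
definition sH :: "(nat \<Rightarrow> 'a) \<Rightarrow> nat \<Rightarrow> 'a" where
  "sH c k = (of_nat l - 2 * of_nat k) * c k"
definition sF :: "(nat \<Rightarrow> 'a) \<Rightarrow> nat \<Rightarrow> 'a" where
  "sF c k = (case k of 0 \<Rightarrow> 0 | Suc n \<Rightarrow> c n)"

lemma scal_scal: "m \<in> carrier V \<Longrightarrow> V.scal r (V.scal s m) = V.scal (r * s) m"
  using V.scal_linear(4) by simp

lemma act_scal: "D \<in> lie_carrier sl2_alg \<Longrightarrow> m \<in> carrier V \<Longrightarrow> V.act D (V.scal r m) = V.scal r (V.act D m)"
  using V.act_linear(3) by blast

lemma Ve_comb: "Ve (comb (Suc n) c) = comb n (sE c)"
proof (induction n)
  case 0
  show ?case using v0 V.scal_linear(2) by (simp add: u_simps act_scal)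
next
  case (Suc n)
  have "Ve (V.scal (c (Suc n)) (u (Suc n))) = V.scal (sE c n) (u n)"
    by (simp add: act_scal Ve_u scal_scal sE_def mult_ac del: of_nat_Suc)
  thus ?case
    using Suc V.act_linear(1)[of sl2_e "comb (Suc n) c" "V.scal (c (Suc n)) (u (Suc n))"] by simp
qed

lemma Vf_comb: "Vf (comb n c) = comb (Suc n) (sF c)"
proof (induction n)
  case 0
  show ?case using V.act_linear(2)[of sl2_f] V.scal_linear(6)[of v0] v0
    by (simp add: sF_def u_simps)
next
  case (Suc n)
  have "Vf (V.scal (c n) (u n)) = V.scal (sF c (Suc n)) (u (Suc n))"
    by (simp add: act_scal u_simps sF_def)
  thus ?case using Suc V.act_linear(1)[of sl2_f "comb n c" "V.scal (c n) (u n)"] by simp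
qed

lemma Vh_comb: "Vh (comb n c) = comb n (sH c)"
proof (induction n)
  case 0
  show ?case using V.act_linear(2)[of sl2_h] v0 by simp
next
  case (Suc n)
  have "Vh (V.scal (c n) (u n)) = V.scal (sH c n) (u n)"
    by (simp add: act_scal Vh_u scal_scal sH_def mult_ac)
  thus ?case using Suc V.act_linear(1)[of sl2_h "comb n c" "V.scal (c n) (u n)"] by simp
qed

lemma act_sl2:
  assumes "m \<in> carrier V"
  shows "V.act (vadd (vscale a sl2_e) (vadd (vscale b sl2_h) (vscale c sl2_f))) m =
     V.scal a (Ve m) \<oplus>\<^bsub>V\<^esub> (V.scal b (Vh m) \<oplus>\<^bsub>V\<^esub> V.scal c (Vf m))"
proof -
  have s: "vscale r D \<in> lie_carrier sl2_alg" "V.act (vscale r D) m = V.scal r (V.act D m)"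
    if "D \<in> lie_carrier (sl2_alg :: ('a, 'a vfield) restricted_lie)" for r D
    using V.act_lie_scale[OF that assms] sl2.lie_closed(2)[OF that] by simp_all
  have "V.act (vadd D E) m = V.act D m \<oplus>\<^bsub>V\<^esub> V.act E m" "vadd D E \<in> lie_carrier sl2_alg"
    if "D \<in> lie_carrier (sl2_alg :: ('a, 'a vfield) restricted_lie)"
      "E \<in> lie_carrier (sl2_alg :: ('a, 'a vfield) restricted_lie)" for D E
    using V.act_lie(1)[OF that assms] sl2.lie_closed(1)[OF that] by simp_all
  thus ?thesis by (simp add: s)
qed

lemma submodule_sl2:
  assumes N: "N \<subseteq> carrier V" "\<zero>\<^bsub>V\<^esub> \<in> N" "\<And>m n. m \<in> N \<Longrightarrow> n \<in> N \<Longrightarrow> m \<oplus>\<^bsub>V\<^esub> n \<in> N"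
    and act: "\<And>m. m \<in> N \<Longrightarrow> Ve m \<in> N" "\<And>m. m \<in> N \<Longrightarrow> Vh m \<in> N" "\<And>m. m \<in> N \<Longrightarrow> Vf m \<in> N"
    and scal: "\<And>r m. m \<in> N \<Longrightarrow> V.scal r m \<in> N"
  shows "N = {\<zero>\<^bsub>V\<^esub>} \<or> N = carrier V"
proof -
  have "submodule N (u_alg sl2_alg) V"
  proof (rule V.submoduleI_act)
    fix D m assume D: "D \<in> lie_carrier (sl2_alg :: ('a, 'a vfield) restricted_lie)" and m: "m \<in> N"
    from D obtain a b c where "D = vadd (vscale a sl2_e) (vadd (vscale b sl2_h) (vscale c sl2_f))"
      unfolding sl2_alg_def W2_sub_simps by blast
    moreover have "m \<in> carrier V" using m N(1) by blast
    ultimately show "V.act D m \<in> N"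
      using m by (simp add: act_sl2 N act scal)
  qed (use N scal in auto)
  thus ?thesis using is_V by (simp add: is_V_def irreducible_module_def)
qed

text \<open>Length p produces no boundary terms: e would bring in the factor p = 0, and f the vector
  \<open>u p\<close>, which is zero.\<close>

lemma comb_p: "Ve (comb (CHAR('a)) c) = comb (CHAR('a)) (sE c)"
  "Vf (comb (CHAR('a)) c) = comb (CHAR('a)) (sF c)"
proof -
  obtain n where n: "CHAR('a) = Suc n" using p0 by (cases "CHAR('a)") auto
  hence "of_nat (Suc n) = (0::'a)" by (metis of_nat_CHAR)
  hence "V.scal (sE c n) (u n) = \<zero>\<^bsub>V\<^esub>"
    using V.scal_linear(6)[of "u n"] by (simp add: sE_def)
  thus "Ve (comb (CHAR('a)) c) = comb (CHAR('a)) (sE c)" by (simp add: n Ve_comb del: comb.simps) simp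
  have "V.scal r (u (CHAR('a))) = \<zero>\<^bsub>V\<^esub>" for r
    using V.scal_linear(2) v0 by (simp add: u_p)
  thus "Vf (comb (CHAR('a)) c) = comb (CHAR('a)) (sF c)" by (simp add: Vf_comb)
qed

definition delta :: "nat \<Rightarrow> nat \<Rightarrow> 'a" where "delta n k = (if k = n then 1 else 0)"

lemma comb_delta:
  assumes "n < m"
  shows "comb m (delta n) = u n"
proof -
  have "comb m (delta n) = comb (Suc n) (delta n)"
    using assms by (intro comb_extend) (auto simp: delta_def)
  also have "comb n (delta n) = \<zero>\<^bsub>V\<^esub>" by (rule comb_zero) (simp add: delta_def)
  hence "comb (Suc n) (delta n) = u n" using V.scal_linear(5)[of "u n"] by (simp add: delta_def)
  finally show ?thesis .
qed

text \<open>The vectors \<open>u k\<close> with \<open>k > l\<close> span a submodule, and it cannot contain \<open>v0\<close> because \<open>f\<close> acts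
  nilpotently.\<close>

lemma u_zero:
  assumes "l < n"
  shows "u n = \<zero>\<^bsub>V\<^esub>"
proof -
  let ?p = "CHAR('a)"
  define N where "N = {comb ?p c | c. \<forall>k\<le>l. c k = 0}"
  have "N = {\<zero>\<^bsub>V\<^esub>} \<or> N = carrier V"
  proof (rule submodule_sl2)
    show "N \<subseteq> carrier V" by (auto simp: N_def)
    show "\<zero>\<^bsub>V\<^esub> \<in> N" using comb_zero[of ?p "\<lambda>_. 0"] by (auto simp: N_def intro!: exI[of _ "\<lambda>_. 0"])
  next
    fix m n assume "m \<in> N" "n \<in> N"
    then obtain c d where c: "m = comb ?p c" "\<forall>k\<le>l. c k = 0" and d: "n = comb ?p d" "\<forall>k\<le>l. d k = 0"
      unfolding N_def by blast
    have "m \<oplus>\<^bsub>V\<^esub> n = comb ?p (\<lambda>k. c k + d k)" by (simp add: c d comb_add)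
    thus "m \<oplus>\<^bsub>V\<^esub> n \<in> N" unfolding N_def using c d by auto
  next
    fix m r assume "m \<in> N"
    then obtain c where c: "m = comb ?p c" "\<forall>k\<le>l. c k = 0" unfolding N_def by blast
    \<comment> \<open>Only e could lead from indices above l down to l, and there its factor l - k
      is 0.\<close>
    have "sE c k = 0" "sH c k = 0" "sF c k = 0" if "k \<le> l" for k
      using that c(2) by (cases "k = l"; auto simp: sE_def sH_def sF_def split: nat.split)+
    thus "Ve m \<in> N" "Vh m \<in> N" "Vf m \<in> N"
      unfolding c comb_p Vh_comb N_def by blast+
    have "V.scal r m = comb ?p (\<lambda>k. r * c k)" by (simp add: c comb_scale)
    thus "V.scal r m \<in> N" unfolding N_def using c by auto
  qed
  moreover have "N \<noteq> carrier V"
  proof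
    assume "N = carrier V"
    then obtain c where c: "v0 = comb ?p c" "\<And>k. k \<le> l \<Longrightarrow> c k = 0" using v0 unfolding N_def by blast
    have uj: "u j = comb ?p ((sF ^^ j) c) \<and> (\<forall>k\<le>j. (sF ^^ j) c k = 0)" for j
    proof (induction j)
      case 0
      show ?case using c by (simp add: u_simps)
    next
      case (Suc j)
      hence "u (Suc j) = comb ?p ((sF ^^ Suc j) c)" using comb_p(2) u_simps(2)[of j] by simp
      moreover have "(sF ^^ Suc j) c k = 0" if "k \<le> Suc j" for k
        using Suc that by (cases k) (simp_all add: sF_def[of "(sF ^^ j) c"])
      ultimately show ?case by blast
    qed
    \<comment> \<open>Descending from \<open>u p\<close>: each \<open>u j\<close> is a combination
      of vectors with larger index, all of which are already zero. The last case is
      \<open>v0\<close> itself.\<close>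
    have "u (?p - i) = \<zero>\<^bsub>V\<^esub>" for i
    proof (induction i rule: less_induct)
      case (less i)
      have "comb ?p ((sF ^^ (?p - i)) c) = \<zero>\<^bsub>V\<^esub>"
      proof (rule comb_zero)
        fix k assume "k < ?p"
        show "(sF ^^ (?p - i)) c k = 0 \<or> u k = \<zero>\<^bsub>V\<^esub>"
        proof (cases "k \<le> ?p - i")
          case False
          hence "?p - k < i" using \<open>k < ?p\<close> by linarith
          from less[OF this] show ?thesis using \<open>k < ?p\<close> by simp
        qed (use uj in blast)
      qed
      thus ?case using uj by simp
    qed
    from this[of ?p] show False using v0 by (simp add: u_simps)
  qed
  ultimately have "N = {\<zero>\<^bsub>V\<^esub>}" by blast
  moreover have "u n \<in> N" if "n < ?p"
  proof -
    have "\<forall>k\<le>l. delta n k = 0" using assms by (auto simp: delta_def)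
    thus ?thesis unfolding N_def comb_delta[OF that, symmetric] by blast
  qed
  moreover have "u (?p + i) = \<zero>\<^bsub>V\<^esub>" for i
  proof (induction i)
    case (Suc i)
    show ?case using u_simps(2)[of "?p + i"] Suc V.act_linear(2)[of sl2_f] v0 by simp
  qed (simp add: u_p)
  ultimately show ?thesis by (metis le_add_diff_inverse not_less singletonD)
qed

lemma Vf_comb_l: "Vf (comb (Suc l) c) = comb (Suc l) (sF c)"
  unfolding Vf_comb by (rule comb_extend) (auto simp: u_zero)

lemma Ve_comb_l: "Ve (comb (Suc l) c) = comb (Suc l) (sE c)"
  unfolding Ve_comb by (rule comb_extend[symmetric]) (auto simp: sE_def le_less_Suc_eq)

lemma comb_surj:
  assumes "v \<in> carrier V"
  obtains c where "v = comb (Suc l) c"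
proof -
  let ?N = "range (comb (Suc l))"
  have "?N = {\<zero>\<^bsub>V\<^esub>} \<or> ?N = carrier V"
  proof (rule submodule_sl2)
    show "\<zero>\<^bsub>V\<^esub> \<in> ?N" using comb_zero[of "Suc l" "\<lambda>_. 0"] by (metis rangeI)
  qed (auto simp: Ve_comb_l Vf_comb_l Vh_comb simp del: comb.simps simp flip: comb_add comb_scale)
  moreover have "v0 \<in> ?N" using comb_delta[of 0 "Suc l"] u_simps(1) by (metis rangeI zero_less_Suc)
  ultimately show thesis using assms v0(2) that by auto
qed

text \<open>Induction on a bound K for the indices that occur: e lowers the bound by one and
  multiplies by (k + 1)(l - k), which is nonzero for k < l < p.\<close>

lemma comb_inj:
  assumes "comb (Suc l) c = \<zero>\<^bsub>V\<^esub>" "k \<le> l"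
  shows "c k = 0"
proof -
  have "c k = 0" if "K \<le> l" "comb (Suc l) c = \<zero>\<^bsub>V\<^esub>" "\<And>k. K < k \<Longrightarrow> k \<le> l \<Longrightarrow> c k = 0" "k \<le> l" for K c k
    using that
  proof (induction K arbitrary: c k)
    case 0
    have "comb (Suc l) c = comb (Suc 0) c" using 0 by (intro comb_extend) auto
    hence *: "V.scal (c 0) v0 = \<zero>\<^bsub>V\<^esub>" using 0 v0 by (simp add: u_simps)
    have "c 0 = 0"
    proof (rule ccontr)
      assume "c 0 \<noteq> 0"
      hence "V.scal (inverse (c 0)) (V.scal (c 0) v0) = v0"
        using v0 V.scal_linear(5)[of v0] by (simp add: scal_scal)
      thus False using * v0 V.scal_linear(2) by simp
    qed
    thus ?case using 0 by (cases k) auto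
  next
    case (Suc K)
    have z: "comb (Suc l) (sE c) = \<zero>\<^bsub>V\<^esub>"
      using Ve_comb_l[of c] Suc.prems V.act_linear(2)[of sl2_e] v0 by simp
    have "sE c k = 0" if "k \<le> l" for k
    proof (rule Suc.IH[OF _ z])
      fix k assume "K < k" "k \<le> l"
      thus "sE c k = 0" using Suc.prems(3)[of "Suc k"] by (cases "k = l") (simp_all add: sE_def)
    qed (use Suc.prems that in auto)
    hence s: "c (Suc k) = 0" if "Suc k \<le> l" for k
    proof -
      have "of_nat (Suc k) * of_nat (l - k) * c (Suc k) = 0"
        using \<open>\<And>k. k \<le> l \<Longrightarrow> sE c k = 0\<close>[of k] that by (simp add: sE_def of_nat_diff del: of_nat_Suc)
      moreover have "of_nat (Suc k) \<noteq> (0::'a)" "of_nat (l - k) \<noteq> (0::'a)"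
        using that l by (intro of_nat_nz; simp)+
      ultimately show ?thesis by (simp del: of_nat_Suc)
    qed
    have "c j = 0" if "K < j" "j \<le> l" for j
      using s[of "j - 1"] that by simp
    thus ?case using Suc.IH[of c k] Suc.prems by simp
  qed
  from this[of l c k] assms show ?thesis by simp
qed

text \<open>The coordinates with respect to the basis of \<open>V\<close> that corresponds to the monomials
  \<open>dx\<^sup>l\<^sup>-\<^sup>k dy\<^sup>k\<close>.\<close>

abbreviation fct :: "nat \<Rightarrow> 'a" where "fct k \<equiv> of_nat (fact k)"

text \<open>If \<open>v0\<close> stands for dy^l, then \<open>u m\<close> is f^m dy^l = l!/(l-m)!
  dx^m dy^{l-m}. This accounts for the quotient of factorials and the reversed index.\<close>

definition vec :: "(nat \<Rightarrow> 'a) \<Rightarrow> 'v" where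
  "vec c = comb (Suc l) (\<lambda>m. c (l - m) * (fct (l - m) / fct l))"

lemma fct_nz: "k \<le> l \<Longrightarrow> fct k \<noteq> 0"
proof (induction k)
  case (Suc k)
  moreover have "fct (Suc k) = of_nat (Suc k) * fct k"
    by (simp only: fact_Suc of_nat_mult of_nat_id)
  ultimately show ?case using of_nat_nz[of "Suc k"] l by simp
qed simp

definition bounded :: "(nat \<Rightarrow> 'a) \<Rightarrow> bool" where
  "bounded c \<longleftrightarrow> (\<forall>k>l. c k = 0)"

lemma vec_closed [simp]: "vec c \<in> carrier V"
  unfolding vec_def by simp

lemma vec_linear: "vec (\<lambda>k. c k + d k) = vec c \<oplus>\<^bsub>V\<^esub> vec d" "vec (\<lambda>k. r * c k) = V.scal r (vec c)"
  unfolding vec_def comb_add[symmetric] comb_scale[symmetric]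
  by (intro comb_cong; simp add: algebra_simps add_divide_distrib)+

lemma vec_inj:
  assumes "vec c = \<zero>\<^bsub>V\<^esub>" "bounded c"
  shows "c = (\<lambda>_. 0)"
proof
  fix k
  show "c k = 0"
  proof (cases "k \<le> l")
    case True
    have "c (l - (l - k)) * (fct (l - (l - k)) / fct l) = 0"
      using assms(1) unfolding vec_def by (rule comb_inj) simp
    thus ?thesis using True fct_nz by auto
  qed (use assms(2) in \<open>auto simp: bounded_def\<close>)
qed

lemma vec_surj:
  assumes "v \<in> carrier V"
  obtains c where "v = vec c" "bounded c"
proof -
  obtain d where d: "v = comb (Suc l) d" using comb_surj[OF assms] .
  let ?c = "\<lambda>k. if k \<le> l then d (l - k) * (fct l / fct k) else 0"
  have "v = vec ?c" unfolding d vec_def using fct_nz by (intro comb_cong) auto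
  thus thesis by (rule that) (simp add: bounded_def)
qed

lemma vec_act:
  shows "Ve (vec c) = vec (cE l c)" "Vh (vec c) = vec (cH l c)"
    "bounded c \<Longrightarrow> Vf (vec c) = vec (cF c)"
proof -
  show "Ve (vec c) = vec (cE l c)"
    unfolding vec_def Ve_comb_l
  proof (rule comb_cong)
    fix m assume "m < Suc l"
    show "sE (\<lambda>m. c (l - m) * (fct (l - m) / fct l)) m = cE l c (l - m) * (fct (l - m) / fct l)"
    proof (cases "m = l")
      case False
      hence m: "m < l" using \<open>m < Suc l\<close> by simp
      then obtain n where n: "l - m = Suc n" "l - Suc m = n" by (metis Suc_diff_Suc)
      have "of_nat l = (of_nat m + of_nat (Suc n) :: 'a)" using m n by (metis le_add_diff_inverse less_imp_le of_nat_add)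
      thus ?thesis unfolding sE_def cE_def n by (simp add: algebra_simps add_divide_distrib)
    qed (simp add: sE_def cE_def)
  qed
  show "Vh (vec c) = vec (cH l c)"
    unfolding vec_def Vh_comb
    by (rule comb_cong) (simp add: sH_def cH_def of_nat_diff algebra_simps add_divide_distrib diff_divide_distrib)
  assume c: "bounded c"
  show "Vf (vec c) = vec (cF c)"
    unfolding vec_def Vf_comb_l
  proof (rule comb_cong)
    fix m assume m: "m < Suc l"
    show "sF (\<lambda>m. c (l - m) * (fct (l - m) / fct l)) m = cF c (l - m) * (fct (l - m) / fct l)"
    proof (cases m)
      case 0
      thus ?thesis using c by (simp add: sF_def cF_def bounded_def)
    next
      case (Suc n)
      hence n: "l - n = Suc (l - m)" using m by simp
      have "sF (\<lambda>m. c (l - m) * (fct (l - m) / fct l)) m = c (l - n) * (fct (l - n) / fct l)"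
        by (simp add: sF_def Suc)
      moreover obtain r where r: "l - m = r" by blast
      ultimately show ?thesis unfolding n cF_def r by (simp add: algebra_simps add_divide_distrib)
    qed
  qed
qed

lemma bounded_act:
  assumes "bounded c"
  shows "bounded (cE l c)" "bounded (cH l c)" "bounded (cF c)"
proof -
  show "bounded (cE l c)" unfolding bounded_def
  proof safe
    fix k assume k: "l < k"
    show "cE l c k = 0"
    proof (cases "k = Suc l")
      case False
      thus ?thesis using assms k by (auto simp: cE_def bounded_def split: nat.split)
    qed (simp add: cE_def)
  qed
qed (use assms in \<open>auto simp: bounded_def cH_def cF_def\<close>)

section \<open>The embedding of V into the symmetric forms\<close>

definition coords :: "'v \<Rightarrow> nat \<Rightarrow> 'a" where
  "coords v = (SOME c. v = vec c \<and> bounded c)"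

lemma coords:
  assumes "v \<in> carrier V"
  shows "vec (coords v) = v" "bounded (coords v)"
proof -
  have "\<exists>c. v = vec c \<and> bounded c" using vec_surj[OF assms] by blast
  from someI_ex[OF this] show "vec (coords v) = v" "bounded (coords v)" unfolding coords_def by auto
qed

lemma coords_vec:
  assumes "bounded c"
  shows "coords (vec c) = c"
proof -
  let ?d = "coords (vec c)"
  have d: "vec ?d = vec c" "bounded ?d" using coords[of "vec c"] by auto
  have "vec (\<lambda>k. c k + (- 1) * ?d k) = vec c \<oplus>\<^bsub>V\<^esub> V.scal (- 1) (vec c)"
    by (simp only: vec_linear d)
  also have "\<dots> = \<zero>\<^bsub>V\<^esub>" by (simp add: V.scal_minus V.M.r_neg)
  finally have "(\<lambda>k. c k + (- 1) * ?d k) = (\<lambda>_. 0)"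
    by (rule vec_inj) (use assms d in \<open>auto simp: bounded_def\<close>)
  hence "c k + (- 1) * ?d k = 0" for k by (rule fun_cong)
  thus ?thesis by (auto simp: fun_eq_iff)
qed

definition iota :: "'v \<Rightarrow> 'a form" where "iota v = tp (coords v)"

lemma iota_Sym: "v \<in> carrier V \<Longrightarrow> iota v \<in> Sym l"
  using coords(2)[of v] by (auto simp: iota_def tp_def Sym_def bounded_def)

lemma iota_linear:
  assumes "v \<in> carrier V" "w \<in> carrier V"
  shows "iota (v \<oplus>\<^bsub>V\<^esub> w) = iota v + iota w" "iota (V.scal r v) = scT r (iota v)"
proof -
  have "bounded (\<lambda>k. coords v k + coords w k)" "bounded (\<lambda>k. r * coords v k)"
    using coords(2)[OF assms(1)] coords(2)[OF assms(2)] by (auto simp: bounded_def)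
  from this[THEN coords_vec] show "iota (v \<oplus>\<^bsub>V\<^esub> w) = iota v + iota w" "iota (V.scal r v) = scT r (iota v)"
    by (simp_all add: iota_def vec_linear coords(1) assms flip: tp_linear)
qed

text \<open>On both sides D acts through the same three entries of its linear part, with
  \<open>cE\<close>, \<open>cH\<close>, \<open>cF\<close> as the operators of e, h, f.\<close>

lemma iota_act:
  assumes D: "D \<in> L_filt 0" and v: "v \<in> carrier V"
  shows "iota (V.act (deg0_part D) v) = rho l D (iota v)"
proof -
  note c = coords[OF v]
  have act: "V.act (deg0_part D) v = vec (\<lambda>k. coeff2 (D varx) 0 (Suc 0) * cE l (coords v) k
     + (coeff2 (D vary) 0 (Suc 0) * cH l (coords v) k + coeff2 (D vary) (Suc 0) 0 * cF (coords v) k))"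
    unfolding deg0_eq[OF D] act_sl2[OF v] vec_linear using vec_act[of "coords v"] c by simp
  have "bounded (\<lambda>k. coeff2 (D varx) 0 (Suc 0) * cE l (coords v) k
     + (coeff2 (D vary) 0 (Suc 0) * cH l (coords v) k + coeff2 (D vary) (Suc 0) 0 * cF (coords v) k))"
    using bounded_act[OF c(2)] by (simp add: bounded_def)
  thus ?thesis unfolding act iota_def rho_tp[OF D] by (simp add: coords_vec add.assoc)
qed

end

section \<open>The induced module\<close>

lemma inflate_simps [simp]:
  "carrier (inflate G f V) = carrier V" "ring.add (inflate G f V) = ring.add V"
  "ring.zero (inflate G f V) = ring.zero V" "r \<odot>\<^bsub>inflate G f V\<^esub> v = u_map G f r \<odot>\<^bsub>V\<^esub> v"
  by (simp_all add: inflate_def)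

context weight_module
begin

abbreviation "VI \<equiv> inflate sl2_alg deg0_part V"

lemma VI_abelian_group: "abelian_group VI"
  using V.M.abelian_group_axioms
  unfolding abelian_group_def abelian_monoid_def abelian_group_axioms_def by simp

lemma incl_class: "a \<in> carrier L0.FA \<Longrightarrow> u_map L_alg (\<lambda>x. x) (u_class L0_alg a) = u_class L_alg a"
  using incl.u_map_class by (simp add: fmap_id)

lemma L0_FA: "a \<in> carrier L0.FA \<Longrightarrow> a \<in> carrier L.FA"
  using incl.fmap_carrier by (simp add: fmap_id)

lemma VI_smult: "a \<in> carrier L0.FA \<Longrightarrow>
    u_class L0_alg a \<odot>\<^bsub>VI\<^esub> v = u_class sl2_alg (fmap_algebra deg0_part a) \<odot>\<^bsub>V\<^esub> v"
  by (simp add: deg0.u_map_class)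

sublocale E: scalar_extension "u_alg L0_alg :: ('a vfield list \<Rightarrow>\<^sub>0 'a) set set ring" "u_alg L_alg"
    "u_map L_alg (\<lambda>x. x)" VI
proof (intro scalar_extension.intro scalar_extension_axioms.intro L.ring_u VI_abelian_group)
  fix b :: "('a vfield list \<Rightarrow>\<^sub>0 'a) set set" assume "b \<in> carrier (u_alg L0_alg)"
  then obtain a where a: "a \<in> carrier L0.FA" "b = u_class L0_alg a" by (rule L0.u_algE)
  show "u_map L_alg (\<lambda>x. x) b \<in> carrier (u_alg L_alg)"
    unfolding a(2) incl_class[OF a(1)] by (rule L.uh.hom_closed[OF L0_FA[OF a(1)]])
  fix v assume "v \<in> carrier VI"
  thus "b \<odot>\<^bsub>VI\<^esub> v \<in> carrier VI"
    unfolding a(2) VI_smult[OF a(1)]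
    using V.smult_closed[OF sl2.uh.hom_closed[OF deg0.fmap_carrier[OF a(1)]]] by simp
qed

lemma M_mod_eq: "M_mod V = E.M"
  by (simp add: M_mod_def Ind_def)

sublocale M: rmod "L_alg :: ('a, 'a vfield) restricted_lie" "E.M"
  by (intro rmod.intro L.rlie_axioms E.M_left_module)

definition t :: "'v \<Rightarrow> (('a vfield list \<Rightarrow>\<^sub>0 'a) set set \<times> 'v \<Rightarrow>\<^sub>0 int) set" where
  "t v = E.tau \<one>\<^bsub>u_alg L_alg\<^esub> v"

lemma t_closed [simp]: "v \<in> carrier V \<Longrightarrow> t v \<in> carrier E.M"
  unfolding t_def by (rule E.tau_closed) auto

lemma t_add: "v \<in> carrier V \<Longrightarrow> w \<in> carrier V \<Longrightarrow> t (v \<oplus>\<^bsub>V\<^esub> w) = t v \<oplus>\<^bsub>E.M\<^esub> t w"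
  unfolding t_def using E.tau_add[of "\<one>\<^bsub>u_alg L_alg\<^esub>" v w] by simp

text \<open>Balancedness of the tensor product lets elements of u(L_(0),0) cross to the right
  factor, where they act through sl2.\<close>

lemma smult_t:
  assumes a: "a \<in> carrier L0.FA" and v: "v \<in> carrier V"
  shows "u_class L_alg a \<odot>\<^bsub>E.M\<^esub> t v = t (u_class sl2_alg (fmap_algebra deg0_part a) \<odot>\<^bsub>V\<^esub> v)"
proof -
  let ?one = "\<one>\<^bsub>u_alg L_alg\<^esub> :: ('a vfield list \<Rightarrow>\<^sub>0 'a) set set"
  have r: "u_class L_alg a \<in> carrier (u_alg L_alg)" by (rule L.uh.hom_closed[OF L0_FA[OF a]])
  have "u_class L_alg a \<odot>\<^bsub>E.M\<^esub> t v = E.tau (u_class L_alg a \<otimes>\<^bsub>u_alg L_alg\<^esub> ?one) v"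
    unfolding t_def by (rule E.smult_tau) (use r v in auto)
  also have "u_class L_alg a \<otimes>\<^bsub>u_alg L_alg\<^esub> ?one
      = ?one \<otimes>\<^bsub>u_alg L_alg\<^esub> u_map L_alg (\<lambda>x. x) (u_class L0_alg a)"
    using r by (simp add: incl_class[OF a])
  also have "E.tau \<dots> v = E.tau ?one (u_class L0_alg a \<odot>\<^bsub>VI\<^esub> v)"
    by (rule E.tau_balanced) (use a v L0.uh.hom_closed in auto)
  finally show ?thesis unfolding VI_smult[OF a] t_def .
qed

lemma t_act:
  assumes "D \<in> L_filt 0" "v \<in> carrier V"
  shows "M.act D (t v) = t (V.act (deg0_part D) v)"
proof -
  have "fgen D \<in> carrier L0.FA" using assms by (simp add: L0_alg_def)
  from smult_t[OF this assms(2)] show ?thesis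
    by (simp add: M.act_def V.act_def fmap_generators)
qed

lemma t_scal: "v \<in> carrier V \<Longrightarrow> M.scal c (t v) = t (V.scal c v)"
  using smult_t[of "fscal c" v] by (simp add: M.scal_def V.scal_def fmap_generators)

lemma t_zero: "t \<zero>\<^bsub>V\<^esub> = \<zero>\<^bsub>E.M\<^esub>"
  using t_scal[of v0 0] v0 M.scal_linear(6)[of "t v0"] V.scal_linear(6)[of v0] by simp

subsection \<open>A spanning family\<close>

lemma L_lie_carrier [simp]: "lie_carrier (L_alg :: ('a, 'a vfield) restricted_lie) = L_carrier"
  by (simp add: L_alg_def)

lemma L_alg_simps [simp]: 
  "lie_add (L_alg :: ('a, 'a vfield) restricted_lie) = vadd"
  "lie_scale (L_alg :: ('a, 'a vfield) restricted_lie) = vscale"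
  "lie_bracket (L_alg :: ('a, 'a vfield) restricted_lie) = lie"
  "lie_pmap (L_alg :: ('a, 'a vfield) restricted_lie) = (\<lambda>D. D ^^ CHAR('a))"
  by (simp_all add: L_alg_def)

definition G :: "nat \<Rightarrow> nat \<Rightarrow> 'v \<Rightarrow> (('a vfield list \<Rightarrow>\<^sub>0 'a) set set \<times> 'v \<Rightarrow>\<^sub>0 int) set" where
  "G a b v = (M.act XX ^^ a) ((M.act YY ^^ b) (t v))"

lemma act_funpow:
  assumes "D \<in> L_carrier"
  shows "m \<in> carrier E.M \<Longrightarrow> (M.act D ^^ n) m \<in> carrier E.M"
    "m \<in> carrier E.M \<Longrightarrow> m' \<in> carrier E.M \<Longrightarrow>
      (M.act D ^^ n) (m \<oplus>\<^bsub>E.M\<^esub> m') = (M.act D ^^ n) m \<oplus>\<^bsub>E.M\<^esub> (M.act D ^^ n) m'"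
    "(M.act D ^^ n) \<zero>\<^bsub>E.M\<^esub> = \<zero>\<^bsub>E.M\<^esub>"
    "m \<in> carrier E.M \<Longrightarrow> (M.act D ^^ n) (M.scal c m) = M.scal c ((M.act D ^^ n) m)"
proof -
  show c: "(M.act D ^^ n) m \<in> carrier E.M" if "m \<in> carrier E.M" for m n
    using assms that by (induction n) simp_all
  show "(M.act D ^^ n) (m \<oplus>\<^bsub>E.M\<^esub> m') = (M.act D ^^ n) m \<oplus>\<^bsub>E.M\<^esub> (M.act D ^^ n) m'"
    if "m \<in> carrier E.M" "m' \<in> carrier E.M"
    using assms that c by (induction n) (simp_all add: M.act_linear(1))
  show "(M.act D ^^ n) \<zero>\<^bsub>E.M\<^esub> = \<zero>\<^bsub>E.M\<^esub>"
    using assms by (induction n) (simp_all add: M.act_linear(2))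
  show "(M.act D ^^ n) (M.scal c m) = M.scal c ((M.act D ^^ n) m)" if "m \<in> carrier E.M"
    using assms that c by (induction n) (simp_all add: M.act_linear(3))
qed

lemma G_closed [simp]: "v \<in> carrier V \<Longrightarrow> G a b v \<in> carrier E.M"
  unfolding G_def by (intro act_funpow XX_L YY_L t_closed)

lemma G_add: "v \<in> carrier V \<Longrightarrow> w \<in> carrier V \<Longrightarrow> G a b (v \<oplus>\<^bsub>V\<^esub> w) = G a b v \<oplus>\<^bsub>E.M\<^esub> G a b w"
  unfolding G_def by (simp add: act_funpow XX_L YY_L t_add)

lemma G_scal: "v \<in> carrier V \<Longrightarrow> M.scal c (G a b v) = G a b (V.scal c v)"
  unfolding G_def t_scal[symmetric] by (simp add: act_funpow XX_L YY_L)

lemma G_zero: "G a b \<zero>\<^bsub>V\<^esub> = \<zero>\<^bsub>E.M\<^esub>"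
  unfolding G_def t_zero by (simp add: act_funpow XX_L YY_L)

text \<open>The bound on a + b is the filtration along which \<open>span_act\<close> proceeds:
  elements of L raise it by at most one, elements of L_(0) not at all.\<close>

inductive_set span :: "nat \<Rightarrow> (('a vfield list \<Rightarrow>\<^sub>0 'a) set set \<times> 'v \<Rightarrow>\<^sub>0 int) set set" for n where
  zero: "\<zero>\<^bsub>E.M\<^esub> \<in> span n"
| add: "m \<in> span n \<Longrightarrow> a < CHAR('a) \<Longrightarrow> b < CHAR('a) \<Longrightarrow> a + b \<le> n \<Longrightarrow> v \<in> carrier V \<Longrightarrow>
    m \<oplus>\<^bsub>E.M\<^esub> G a b v \<in> span n"

lemma span_closed: "m \<in> span n \<Longrightarrow> m \<in> carrier E.M"
  by (induction rule: span.induct) auto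

lemma span_mono: "m \<in> span n \<Longrightarrow> n \<le> k \<Longrightarrow> m \<in> span k"
  by (induction rule: span.induct) (auto intro: span.intros)

lemma span_gen:
  assumes "a < CHAR('a)" "b < CHAR('a)" "a + b \<le> n" "v \<in> carrier V"
  shows "G a b v \<in> span n"
  using span.add[OF span.zero assms] assms by simp

lemma span_add: "m' \<in> span n \<Longrightarrow> m \<in> span n \<Longrightarrow> m \<oplus>\<^bsub>E.M\<^esub> m' \<in> span n"
proof (induction rule: span.induct)
  case (add m' a b v)
  have "m \<oplus>\<^bsub>E.M\<^esub> (m' \<oplus>\<^bsub>E.M\<^esub> G a b v) = (m \<oplus>\<^bsub>E.M\<^esub> m') \<oplus>\<^bsub>E.M\<^esub> G a b v"
    using add span_closed by (simp add: E.M.M.a_assoc)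
  thus ?case using add by (simp add: span.add)
qed (simp add: span_closed)

lemma span_scal: "m \<in> span n \<Longrightarrow> M.scal c m \<in> span n"
proof (induction rule: span.induct)
  case (add m a b v)
  thus ?case
    using M.scal_linear(1)[of m "G a b v" c] span_closed by (simp add: G_scal span.add)
qed (simp add: M.scal_linear(2) span.zero)

lemma act_span:
  assumes D: "D \<in> L_carrier"
    and gen: "\<And>a b v. a < CHAR('a) \<Longrightarrow> b < CHAR('a) \<Longrightarrow> a + b \<le> n \<Longrightarrow> v \<in> carrier V \<Longrightarrow>
      M.act D (G a b v) \<in> span k"
  shows "m \<in> span n \<Longrightarrow> M.act D m \<in> span k"
proof (induction rule: span.induct)
  case zero
  show ?case using M.act_linear(2)[of D] D span.zero by simp
next
  case (add m a b v)
  thus ?case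
    using M.act_linear(1)[of D m "G a b v"] D gen span_add span_closed by simp
qed

text \<open>X^p x = X^{p-1} Lam = - X^{p-1} (x^{p-1} y^{p-1}) has order at least p - 1, so it
  vanishes at the origin, and X^p y = 0. The same holds for Y with x and y exchanged.\<close>

lemma XX_pow_L0: "XX ^^ CHAR('a) \<in> (L_filt 0 :: 'a vfield set)" "YY ^^ CHAR('a) \<in> (L_filt 0 :: 'a vfield set)"
proof -
  let ?p = "CHAR('a)" and ?m = "monom2 (CHAR('a) - 1) (CHAR('a) - 1) :: 'a O2"
  have step: "ordge (d - 1) (XX h)" "ordge (d - 1) (YY h)" if "ordge d h" for d and h :: "'a O2"
    unfolding XX_def YY_def vf_def using ordge_dx[OF that] ordge_dy[OF that]
    by (auto intro!: ordge_mult[where d = 0])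
  have pow: "ordge (d - n) ((XX ^^ n) h) \<and> ordge (d - n) ((YY ^^ n) h)" if "ordge d h" for d n and h :: "'a O2"
  proof (induction n)
    case (Suc n)
    thus ?case using step[of "d - n"] by simp
  qed (use that in simp)
  have m: "ordge (2 * ?p - 2) (- ?m)" by (intro ordge_uminus ordge_monom2) auto
  have "?p = Suc (Suc (?p - 2))" using char by simp
  then obtain n where n: "?p = Suc (Suc n)" by blast
  have pw: "(D ^^ ?p) h = (D ^^ n) (D (D h))" for D and h :: "'a O2"
    by (simp only: n funpow_Suc_right o_apply)
  have Lam: "XX Lam = XX (- ?m)" "YY Lam = YY (- ?m)"
    by (simp_all add: Lam_def XX_def YY_def)
  have var: "XX varx = Lam" "XX vary = (0 :: 'a O2)" "YY vary = Lam" "YY varx = (0 :: 'a O2)"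
    "XX 0 = (0 :: 'a O2)" "YY 0 = (0 :: 'a O2)"
    by (simp_all add: XX_def YY_def)
  have z: "(XX ^^ k) 0 = (0 :: 'a O2)" "(YY ^^ k) 0 = (0 :: 'a O2)" for k
    by (induction k) (simp_all add: XX_def YY_def)
  have "(XX ^^ ?p) varx = (XX ^^ Suc n) (- ?m)" "(YY ^^ ?p) vary = (YY ^^ Suc n) (- ?m)"
    by (simp_all only: pw var Lam funpow_Suc_right o_apply)
  moreover have "coeff2 ((XX ^^ Suc n) (- ?m)) 0 0 = 0" "coeff2 ((YY ^^ Suc n) (- ?m)) 0 0 = 0"
    using pow[OF m, of "Suc n"] n by (auto intro!: ordgeD[of "2 * ?p - 2 - Suc n"])
  moreover have "(XX ^^ ?p) vary = (0 :: 'a O2)" "(YY ^^ ?p) varx = (0 :: 'a O2)"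
    by (simp_all only: pw var z)
  ultimately show "XX ^^ ?p \<in> (L_filt 0 :: 'a vfield set)" "YY ^^ ?p \<in> (L_filt 0 :: 'a vfield set)"
    unfolding L0_iff using L_closed(4)[OF XX_L XX_L] L_closed(4)[OF YY_L YY_L] by simp_all
qed

text \<open>\<open>Lam\<close> has constant term 1, so suitable multiples of X and Y cancel the
  value of D at the origin.\<close>

lemma L_decompose:
  assumes "D \<in> L_carrier"
  obtains D0 a b where "D0 \<in> L_filt 0" "D = vadd D0 (vadd (vscale a XX) (vscale b (YY :: 'a vfield)))"
proof -
  obtain f g where D: "D = vf f g" using L_W[OF assms] by blast
  let ?a = "coeff2 f 0 0" and ?b = "coeff2 g 0 0"
  let ?D0 = "vadd D (vadd (vscale (- ?a) XX) (vscale (- ?b) YY))"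
  have L: "?D0 \<in> L_carrier" by (intro L_closed(1) L_closed(2)[of E E for E] assms XX_L YY_L)
  have 00: "coeff2 (Lam :: 'a O2) 0 0 = 1"
    using char by (simp add: Lam_def one_O2_def coeff2_monom2)
  have "coeff2 (?D0 varx) 0 0 = 0" "coeff2 (?D0 vary) 0 0 = 0"
    by (simp_all add: D XX_def YY_def vadd_vf vscale_vf 00)
  hence "?D0 \<in> L_filt 0" using L by (simp add: L0_iff)
  moreover have "D = vadd ?D0 (vadd (vscale ?a XX) (vscale ?b YY))"
    unfolding vadd_def vscale_def
    by (rule ext) (simp add: algebra_simps, rule O2_eqI, simp add: algebra_simps)
  ultimately show thesis by (rule that)
qed

lemma act_decompose:
  assumes D: "D \<in> L_carrier" and m: "m \<in> span n"
    and "\<And>D. D \<in> L_filt 0 \<Longrightarrow> M.act D m \<in> span n" "M.act XX m \<in> span n" "M.act YY m \<in> span n"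
  shows "M.act D m \<in> span n"
proof -
  obtain D0 a b where D0: "D0 \<in> L_filt 0" "D = vadd D0 (vadd (vscale a XX) (vscale b YY))"
    using L_decompose[OF D] .
  have mc: "m \<in> carrier E.M" by (rule span_closed[OF m])
  have L: "vscale a XX \<in> L_carrier" "vscale b YY \<in> (L_carrier :: 'a vfield set)"
    by (intro L_closed(2)[of E E for E] XX_L YY_L)+
  have "M.act D m = M.act D0 m \<oplus>\<^bsub>E.M\<^esub> (M.scal a (M.act XX m) \<oplus>\<^bsub>E.M\<^esub> M.scal b (M.act YY m))"
    unfolding D0(2)
    using M.act_lie(1)[of D0 "vadd (vscale a XX) (vscale b YY)" m] M.act_lie(1)[of "vscale a XX" "vscale b YY" m]
      M.act_lie_scale[of XX m a] M.act_lie_scale[of YY m b] mc L L0_L[OF D0(1)] XX_L YY_L L_closed(1)[OF L]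
    by simp
  thus ?thesis using assms(3)[OF D0(1)] assms(4,5) by (simp add: span_add span_scal)
qed

text \<open>Moving \<open>D \<in> L\<close> past \<open>X\<close> and \<open>Y\<close> costs a commutator of lower filtration degree, and \<open>X\<^sup>p\<close>,
  \<open>Y\<^sup>p\<close> lie in \<open>L\<^sub>(\<^sub>0\<^sub>)\<close>.\<close>

lemma span_act:
  "(\<forall>D\<in>L_filt 0. \<forall>m\<in>span n. M.act D m \<in> span n) \<and> (\<forall>D\<in>L_carrier. \<forall>m\<in>span n. M.act D m \<in> span (Suc n))"
proof (induction n)
  case 0
  have G0: "G 0 0 v = t v" for v by (simp add: G_def)
  have L0: "M.act D m \<in> span 0" if D: "D \<in> L_filt 0" and m: "m \<in> span 0" for D m
  proof (rule act_span[OF L0_L[OF D] _ m])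
    fix a b :: nat and v assume "a + b \<le> 0" "v \<in> carrier V"
    moreover have "deg0_part D \<in> lie_carrier sl2_alg" using D by (simp add: sl2_carrier)
    ultimately show "M.act D (G a b v) \<in> span 0"
      using span_gen[of 0 0 0 "V.act (deg0_part D) v"] p0 by (simp add: G0 t_act[OF D])
  qed
  have X: "M.act XX m \<in> span (Suc 0)" "M.act YY m \<in> span (Suc 0)" if m: "m \<in> span 0" for m
  proof -
    have "M.act XX (G 0 0 v) = G 1 0 v" "M.act YY (G 0 0 v) = G 0 1 v" for v by (simp_all add: G_def)
    thus "M.act XX m \<in> span (Suc 0)" "M.act YY m \<in> span (Suc 0)"
      by (auto intro!: act_span[OF XX_L _ m] act_span[OF YY_L _ m] span_gen simp: char[THEN order_less_trans[rotated]])
  qed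
  show ?case
    using L0 X act_decompose[of _ _ "Suc 0"] span_mono[of _ 0 "Suc 0"] by blast
next
  case (Suc n)
  hence IH0: "M.act D m \<in> span n" if "D \<in> L_filt 0" "m \<in> span n" for D m using that by blast
  from Suc have IH: "M.act D m \<in> span (Suc n)" if "D \<in> L_carrier" "m \<in> span n" for D m using that by blast
  note IHX = IH[OF XX_L] and IHY = IH[OF YY_L]
  have swap: "M.act D (M.act E m) \<in> span k"
    if "D \<in> L_carrier" "E \<in> L_carrier" "m \<in> span n" "M.act E (M.act D m) \<in> span k" "Suc n \<le> k" for D E m k
  proof -
    have "M.act (lie D E) m \<in> span k"
      using IH[OF L_closed(3)[OF that(1,2)] that(3)] that(5) span_mono by blast
    thus ?thesis using M.act_lie(2)[of D E m] that span_closed span_add by simp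
  qed
  have GX: "G (Suc a) b v = M.act XX (G a b v)" and GY: "G 0 (Suc b) v = M.act YY (G 0 b v)" for a b v
    by (simp_all add: G_def)
  have L0: "M.act D m \<in> span (Suc n)" if D: "D \<in> L_filt 0" and m: "m \<in> span (Suc n)" for D m
  proof (rule act_span[OF L0_L[OF D] _ m])
    fix a b v assume ab: "a < CHAR('a)" "b < CHAR('a)" "a + b \<le> Suc n" and v: "v \<in> carrier V"
    consider a' where "a = Suc a'" | b' where "a = 0" "b = Suc b'" | "a + b \<le> n" by (cases a; cases b) auto
    thus "M.act D (G a b v) \<in> span (Suc n)"
    proof cases
      case 1
      hence g: "G a' b v \<in> span n" using ab v by (intro span_gen) auto
      show ?thesis unfolding 1 GX by (rule swap[OF L0_L[OF D] XX_L g IHX[OF IH0[OF D g]]]) simp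
    next
      case 2
      hence g: "G 0 b' v \<in> span n" using ab v by (intro span_gen) auto
      show ?thesis unfolding 2 GY by (rule swap[OF L0_L[OF D] YY_L g IHY[OF IH0[OF D g]]]) simp
    next
      case 3
      thus ?thesis using IH[OF L0_L[OF D] span_gen[of a b n v]] ab v by simp
    qed
  qed
  have X: "M.act XX m \<in> span (Suc (Suc n))" if m: "m \<in> span (Suc n)" for m
  proof (rule act_span[OF XX_L _ m])
    fix a b v assume ab: "a < CHAR('a)" "b < CHAR('a)" "a + b \<le> Suc n" and v: "v \<in> carrier V"
    show "M.act XX (G a b v) \<in> span (Suc (Suc n))"
    proof (cases "Suc a = CHAR('a)")
      \<comment> \<open>X^p acts as an element of L_(0), and \<open>L0\<close> has already settled
        those at this level.\<close>
      case True
      have "M.act XX (G a b v) = (M.act XX ^^ CHAR('a)) (G 0 b v)"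
        by (simp add: G_def flip: True)
      also have "\<dots> = M.act (XX ^^ CHAR('a)) (G 0 b v)"
        using M.act_pow[of XX "G 0 b v"] XX_L v by simp
      also have "\<dots> \<in> span (Suc n)"
        using ab v p0 by (intro L0 XX_pow_L0 span_gen) auto
      finally show ?thesis by (rule span_mono) simp
    next
      case False
      thus ?thesis using ab v by (simp add: span_gen flip: GX)
    qed
  qed
  \<comment> \<open>X had to be treated first: Y X g = X Y g + [Y, X] g, where Y g already has level
    n + 1.\<close>
  have Y: "M.act YY m \<in> span (Suc (Suc n))" if m: "m \<in> span (Suc n)" for m
  proof (rule act_span[OF YY_L _ m])
    fix a b v assume ab: "a < CHAR('a)" "b < CHAR('a)" "a + b \<le> Suc n" and v: "v \<in> carrier V"
    have "Suc b = CHAR('a) \<or> Suc b < CHAR('a)" using ab(2) by linarith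
    then consider a' where "a = Suc a'" | "a = 0" "Suc b = CHAR('a)" | "a = 0" "Suc b < CHAR('a)"
      by (cases a) blast+
    thus "M.act YY (G a b v) \<in> span (Suc (Suc n))"
    proof cases
      case 1
      hence g: "G a' b v \<in> span n" using ab v by (intro span_gen) auto
      show ?thesis unfolding 1 GX by (rule swap[OF YY_L XX_L g X[OF IHY[OF g]]]) simp
    next
      case 2
      have "M.act YY (G a b v) = (M.act YY ^^ CHAR('a)) (G 0 0 v)"
        by (simp add: G_def 2(1) flip: 2(2))
      also have "\<dots> = M.act (YY ^^ CHAR('a)) (G 0 0 v)"
        using M.act_pow[of YY "G 0 0 v"] YY_L v by simp
      also have "\<dots> \<in> span (Suc n)"
        using ab v p0 by (intro L0 XX_pow_L0 span_gen) auto
      finally show ?thesis by (rule span_mono) simp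
    next
      case 3
      thus ?thesis using ab v p0 by (simp add: span_gen flip: GY)
    qed
  qed
  have "M.act D m \<in> span (Suc (Suc n))" if "D \<in> L_carrier" "m \<in> span (Suc n)" for D m
  proof (rule act_decompose[OF that(1)])
    show "m \<in> span (Suc (Suc n))" using that(2) by (rule span_mono) simp
    show "M.act D m \<in> span (Suc (Suc n))" if "D \<in> L_filt 0" for D
      using L0[OF that \<open>m \<in> span (Suc n)\<close>] by (rule span_mono) simp
  qed (use that(2) X Y in blast)+
  thus ?case using L0 by blast
qed

lemma span_carrier:
  assumes "m \<in> carrier E.M"
  obtains n where "m \<in> span n"
proof -
  have "submodule (\<Union>n. span n) (u_alg L_alg) E.M"
  proof (rule M.submoduleI_act)
    fix m m' assume "m \<in> (\<Union>n. span n)" "m' \<in> (\<Union>n. span n)"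
    then obtain n k where "m \<in> span n" "m' \<in> span k" by blast
    hence "m \<in> span (n + k)" "m' \<in> span (n + k)" using span_mono by auto
    thus "m \<oplus>\<^bsub>E.M\<^esub> m' \<in> (\<Union>n. span n)" using span_add by blast
  next
    fix D m assume "D \<in> lie_carrier (L_alg :: ('a, 'a vfield) restricted_lie)" "m \<in> (\<Union>n. span n)"
    then obtain n where "D \<in> L_carrier" "m \<in> span n" by auto
    hence "M.act D m \<in> span (Suc n)" using span_act by blast
    thus "M.act D m \<in> (\<Union>n. span n)" by blast
  next
    fix c m assume "m \<in> (\<Union>n. span n)"
    thus "M.scal c m \<in> (\<Union>n. span n)" using span_scal by auto
  qed (use span_closed span.zero in auto)
  hence "(\<Union>n. span n) = carrier E.M"
  proof (rule E.submodule_eq_carrier)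
    fix v assume "v \<in> carrier VI"
    hence "G 0 0 v \<in> span 0" using p0 by (intro span_gen) auto
    thus "E.tau \<one>\<^bsub>u_alg L_alg\<^esub> v \<in> (\<Union>n. span n)" by (auto simp: G_def t_def)
  qed
  thus thesis using assms that by blast
qed

text \<open>Additivity of \<open>G\<close> in its last argument merges repeated pairs (a, b),
  leaving exactly one summand per pair, as \<open>XY_tp_independent\<close> expects.\<close>

lemma span_finsum:
  assumes "m \<in> span n"
  obtains w where "\<And>q. w q \<in> carrier V" "m = (\<Oplus>\<^bsub>E.M\<^esub>q\<in>grid CHAR('a). G (fst q) (snd q) (w q))"
proof -
  have "\<exists>w. (\<forall>q. w q \<in> carrier V) \<and> m = (\<Oplus>\<^bsub>E.M\<^esub>q\<in>grid CHAR('a). G (fst q) (snd q) (w q))"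
    using assms
  proof (induction rule: span.induct)
    case zero
    show ?case by (rule exI[of _ "\<lambda>_. \<zero>\<^bsub>V\<^esub>"]) (simp add: G_zero)
  next
    case (add m a b v)
    then obtain w where w: "\<And>q. w q \<in> carrier V" "m = (\<Oplus>\<^bsub>E.M\<^esub>q\<in>grid CHAR('a). G (fst q) (snd q) (w q))" by blast
    define d where "d q = (if (a, b) = q then v else \<zero>\<^bsub>V\<^esub>)" for q
    have d: "d q \<in> carrier V" for q using add by (simp add: d_def)
    have "(\<Oplus>\<^bsub>E.M\<^esub>q\<in>grid CHAR('a). G (fst q) (snd q) (d q)) =
        (\<Oplus>\<^bsub>E.M\<^esub>q\<in>grid CHAR('a). if (a, b) = q then G (fst q) (snd q) v else \<zero>\<^bsub>E.M\<^esub>)"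
      using add by (intro E.M.M.finsum_cong') (auto simp: d_def G_zero)
    also have "\<dots> = G a b v"
      using add E.M.M.finsum_singleton[of "(a, b)" "grid (CHAR('a))" "\<lambda>q. G (fst q) (snd q) v"] by auto
    finally have "(\<Oplus>\<^bsub>E.M\<^esub>q\<in>grid CHAR('a). G (fst q) (snd q) (w q \<oplus>\<^bsub>V\<^esub> d q)) = m \<oplus>\<^bsub>E.M\<^esub> G a b v"
      unfolding w(2) using w(1) d by (simp add: G_add E.M.M.finsum_addf)
    thus ?case using w(1) d by (intro exI[of _ "\<lambda>q. w q \<oplus>\<^bsub>V\<^esub> d q"]) auto
  qed
  thus thesis using that by blast
qed

subsection \<open>The comparison map and irreducibility\<close>

definition rep :: "('a vfield list \<Rightarrow>\<^sub>0 'a) set set \<Rightarrow> 'a form \<Rightarrow> 'a form" where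
  "rep r = ev l (SOME a. a \<in> carrier L.FA \<and> u_class L_alg a = r)"

lemma rep_class:
  assumes "a \<in> carrier L.FA" "s \<in> Sym l"
  shows "rep (u_class L_alg a) s = ev l a s"
proof -
  let ?b = "SOME b. b \<in> carrier L.FA \<and> u_class L_alg b = u_class L_alg a"
  have "?b \<in> carrier L.FA \<and> u_class L_alg ?b = u_class L_alg a"
    by (rule someI[of "\<lambda>b. b \<in> carrier L.FA \<and> u_class L_alg b = u_class L_alg a" a]) (use assms in blast)
  thus ?thesis unfolding rep_def using ev_cong[OF _ assms(1) _ assms(2)] by blast
qed

text \<open>Extends \<open>iota_act\<close> from L_(0) to products of its elements; this is the
  balancedness that the comparison map needs.\<close>

lemma iota_ev:
  assumes "a \<in> carrier L0.FA" and v: "v \<in> carrier V"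
  shows "iota (u_class sl2_alg (fmap_algebra deg0_part a) \<odot>\<^bsub>V\<^esub> v) = ev l a (iota v)"
  using assms(1)
proof (induction a rule: free_induct)
  case (scal c)
  show ?case using iota_linear(2)[OF v v] by (simp add: fmap_generators ev_fscal V.scal_def)
next
  case (gen D a)
  hence D: "D \<in> L_filt 0" by (simp add: L0_alg_def)
  have mem: "deg0_part D \<in> lie_carrier sl2_alg" using D by (simp add: sl2_carrier)
  have a: "fmap_algebra deg0_part a \<in> carrier sl2.FA" by (rule deg0.fmap_carrier[OF gen(2)])
  let ?w = "u_class sl2_alg (fmap_algebra deg0_part a) \<odot>\<^bsub>V\<^esub> v"
  have w: "?w \<in> carrier V" using V.smult_closed[OF sl2.uh.hom_closed[OF a] v] .
  have "u_class sl2_alg (fmap_algebra deg0_part (fgen D * a)) \<odot>\<^bsub>V\<^esub> v = V.act (deg0_part D) ?w"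
    using mem a v by (simp add: fmap_mult fmap_generators sl2.u_class_simps V.smult_assoc V.act_def)
  thus ?case using iota_act[OF D w] gen ev_gen_mult[OF L0_W[OF D]] by simp
next
  case (add a b)
  note c = deg0.fmap_carrier[OF add(1)] deg0.fmap_carrier[OF add(2)]
  have "u_class sl2_alg (fmap_algebra deg0_part (a + b)) \<odot>\<^bsub>V\<^esub> v =
      u_class sl2_alg (fmap_algebra deg0_part a) \<odot>\<^bsub>V\<^esub> v \<oplus>\<^bsub>V\<^esub> u_class sl2_alg (fmap_algebra deg0_part b) \<odot>\<^bsub>V\<^esub> v"
    using c v by (simp add: fmap_simps sl2.u_class_simps V.smult_l_distr)
  thus ?case
    using add(3,4) iota_linear(1)[OF V.smult_closed[OF sl2.uh.hom_closed[OF c(1)] v]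
        V.smult_closed[OF sl2.uh.hom_closed[OF c(2)] v]]
    by (simp add: ev_simps)
qed

text \<open>Frobenius reciprocity: the L_(0)-equivariant \<open>iota\<close> extends to the
  u(L,0)-linear map that sends the tensor of r and v to r applied to \<open>iota v\<close>.\<close>

lemma comparison_map:
  obtains g where
    "\<And>m n. m \<in> carrier E.M \<Longrightarrow> n \<in> carrier E.M \<Longrightarrow> g (m \<oplus>\<^bsub>E.M\<^esub> n) = g m + g n"
    "\<And>v. v \<in> carrier V \<Longrightarrow> g (t v) = iota v"
    "\<And>m. m \<in> carrier E.M \<Longrightarrow> g m \<in> Sym l"
    "\<And>D m. D \<in> L_carrier \<Longrightarrow> m \<in> carrier E.M \<Longrightarrow> g (M.act D m) = rho l D (g m)"
    "\<And>c m. m \<in> carrier E.M \<Longrightarrow> g (M.scal c m) = scT c (g m)"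
proof -
  let ?h = "\<lambda>r v. rep r (iota v)"
  have 1: "?h (r \<oplus>\<^bsub>u_alg L_alg\<^esub> r') v = ?h r v + ?h r' v"
    if "r \<in> carrier (u_alg L_alg)" "r' \<in> carrier (u_alg L_alg)" and v: "v \<in> carrier VI"
    for r r' :: "('a vfield list \<Rightarrow>\<^sub>0 'a) set set" and v
  proof -
    from that obtain a b where a: "a \<in> carrier L.FA" "r = u_class L_alg a" and b: "b \<in> carrier L.FA" "r' = u_class L_alg b"
      by (metis L.u_algE)
    have "iota v \<in> Sym l" using v iota_Sym by simp
    thus ?thesis
      unfolding a b L.u_class_simps(1)[OF a(1) b(1), symmetric]
      by (simp only: rep_class a(1) b(1) free_closed ev_simps)
  qed
  have 2: "?h r (v \<oplus>\<^bsub>VI\<^esub> v') = ?h r v + ?h r v'"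
    if "r \<in> carrier (u_alg L_alg)" and v: "v \<in> carrier VI" "v' \<in> carrier VI"
    for r :: "('a vfield list \<Rightarrow>\<^sub>0 'a) set set" and v v'
  proof -
    from that obtain a where a: "a \<in> carrier L.FA" "r = u_class L_alg a" by (metis L.u_algE)
    have "iota v \<in> Sym l" "iota v' \<in> Sym l" using v iota_Sym by simp_all
    thus ?thesis
      using v iota_linear(1)[of v v'] unfolding a
      by (simp add: rep_class[OF a(1)] ev_linear[OF a(1)] del: plus_fun_apply)
  qed
  have 3: "?h (r \<otimes>\<^bsub>u_alg L_alg\<^esub> u_map L_alg (\<lambda>x. x) b) v = ?h r (b \<odot>\<^bsub>VI\<^esub> v)"
    if "r \<in> carrier (u_alg L_alg)" "b \<in> carrier (u_alg L0_alg)" and v: "v \<in> carrier VI"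
    for r b :: "('a vfield list \<Rightarrow>\<^sub>0 'a) set set" and v
  proof -
    from that obtain a c where a: "a \<in> carrier L.FA" "r = u_class L_alg a" and c: "c \<in> carrier L0.FA" "b = u_class L0_alg c"
      by (metis L.u_algE L0.u_algE)
    have v': "v \<in> carrier V" using v by simp
    note s = iota_Sym[OF v']
    have "r \<otimes>\<^bsub>u_alg L_alg\<^esub> u_map L_alg (\<lambda>x. x) b = u_class L_alg (a * c)"
      unfolding a c incl_class[OF c(1)] L.u_class_simps(2)[OF a(1) L0_FA[OF c(1)]] ..
    hence "?h (r \<otimes>\<^bsub>u_alg L_alg\<^esub> u_map L_alg (\<lambda>x. x) b) v = ev l a (ev l c (iota v))"
      using rep_class[OF _ s, of "a * c"] a c L0_FA by (simp add: ev_mult)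
    also have "ev l c (iota v) = iota (b \<odot>\<^bsub>VI\<^esub> v)"
      unfolding c(2) VI_smult[OF c(1)] iota_ev[OF c(1) v'] ..
    also have "ev l a \<dots> = ?h r (b \<odot>\<^bsub>VI\<^esub> v)"
    proof -
      have "b \<odot>\<^bsub>VI\<^esub> v \<in> carrier V"
        using E.V_smult_closed[of b v] c v L0.uh.hom_closed[OF c(1)] by simp
      thus ?thesis unfolding a(2) using rep_class[OF a(1) iota_Sym] by simp
    qed
    finally show ?thesis .
  qed
  have sc: "scT (of_int (m + n) :: 'a) s = scT (of_int m) s + scT (of_int n) s"
    "scT (of_int 1 :: 'a) s = s" for m n s
    by (simp_all add: scT_left del: plus_fun_apply)
  have "\<exists>g. (\<forall>m\<in>carrier E.M. \<forall>n\<in>carrier E.M. g (m \<oplus>\<^bsub>E.M\<^esub> n) = g m + g n) \<and>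
      (\<forall>r\<in>carrier (u_alg L_alg). \<forall>v\<in>carrier VI. g (E.tau r v) = ?h r v)" (is "\<exists>g. ?P g")
  proof (rule E.extend_universal[where h = ?h and sc = "\<lambda>n. scT (of_int n)", OF sc 1 2 3])
    fix g assume *: "\<And>m n. m \<in> carrier E.M \<Longrightarrow> n \<in> carrier E.M \<Longrightarrow> g (m \<oplus>\<^bsub>E.M\<^esub> n) = g m + g n"
      "\<And>r v. r \<in> carrier (u_alg L_alg) \<Longrightarrow> v \<in> carrier VI \<Longrightarrow> g (E.tau r v) = ?h r v"
    show ?thesis by (rule exI[of ?P g], intro conjI ballI *)
  qed
  then obtain g where g: "?P g" ..
  note add = conjunct1[OF g, rule_format] and tau = conjunct2[OF g, rule_format]
  have gdiff: "g (m \<ominus>\<^bsub>E.M\<^esub> n) = g m - g n" if "m \<in> carrier E.M" "n \<in> carrier E.M" for m n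
  proof -
    have "(m \<ominus>\<^bsub>E.M\<^esub> n) \<oplus>\<^bsub>E.M\<^esub> n = m"
      using that by (simp add: a_minus_def E.M.M.a_assoc E.M.M.l_neg)
    thus ?thesis using add[of "m \<ominus>\<^bsub>E.M\<^esub> n" n] that by (simp add: algebra_simps)
  qed
  have Sym: "g m \<in> Sym l" if "m \<in> carrier E.M" for m
    using that
  proof (induction rule: E.M_induct)
    case (gen r v)
    then obtain a where a: "a \<in> carrier L.FA" "r = u_class L_alg a" by (metis L.u_algE)
    have "v \<in> carrier V" using gen by simp
    thus ?case using gen rep_class[OF a(1)] ev_Sym[OF a(1)] iota_Sym unfolding a(2) by (simp add: tau)
  next
    case (diff m n)
    show ?case unfolding gdiff[OF diff(1,2)] using diff(3,4) by (rule Sym_simps)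
  qed
  have smult: "g (u_class L_alg a \<odot>\<^bsub>E.M\<^esub> m) = ev l a (g m)" if a: "a \<in> carrier L.FA" and "m \<in> carrier E.M" for a m
    using that(2)
  proof (induction rule: E.M_induct)
    case (gen r v)
    then obtain b where b: "b \<in> carrier L.FA" "r = u_class L_alg b" by (metis L.u_algE)
    have s: "iota v \<in> Sym l" using gen iota_Sym by simp
    have "u_class L_alg a \<odot>\<^bsub>E.M\<^esub> E.tau r v = E.tau (u_class L_alg (a * b)) v"
      unfolding b L.u_class_simps(2)[OF a b(1)] using gen a b by (intro E.smult_tau) auto
    thus ?case using gen a b by (simp add: tau rep_class s ev_mult)
  next
    case (diff m n)
    have r: "u_class L_alg a \<in> carrier (u_alg L_alg)" using a by simp
    have "u_class L_alg a \<odot>\<^bsub>E.M\<^esub> (m \<ominus>\<^bsub>E.M\<^esub> n) \<oplus>\<^bsub>E.M\<^esub> u_class L_alg a \<odot>\<^bsub>E.M\<^esub> n = u_class L_alg a \<odot>\<^bsub>E.M\<^esub> m"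
    proof -
      have "(m \<ominus>\<^bsub>E.M\<^esub> n) \<oplus>\<^bsub>E.M\<^esub> n = m"
        using diff by (simp add: a_minus_def E.M.M.a_assoc E.M.M.l_neg)
      thus ?thesis using E.M.smult_r_distr[OF r, of "m \<ominus>\<^bsub>E.M\<^esub> n" n] diff by simp
    qed
    hence "g (u_class L_alg a \<odot>\<^bsub>E.M\<^esub> (m \<ominus>\<^bsub>E.M\<^esub> n)) + ev l a (g n) = ev l a (g m)"
      using add[OF E.M.smult_closed[OF r, of "m \<ominus>\<^bsub>E.M\<^esub> n"] E.M.smult_closed[OF r, of n]] diff by simp
    thus ?case unfolding gdiff[OF diff(1,2)] ev_linear(4)[OF a] by (simp only: eq_diff_eq)
  qed
  show thesis
  proof (rule that[OF add _ Sym])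
    show "g (t v) = iota v" if v: "v \<in> carrier V" for v
    proof -
      have "g (t v) = rep (u_class L_alg 1) (iota v)"
        unfolding t_def using tau[of "\<one>\<^bsub>u_alg L_alg\<^esub>" v] v L.uh.hom_one by simp
      thus ?thesis using rep_class[of 1 "iota v"] iota_Sym[OF v] by (simp add: ev_one)
    qed
    show "g (M.act D m) = rho l D (g m)" if "D \<in> L_carrier" "m \<in> carrier E.M" for D m
      using smult[of "fgen D" m] that by (simp add: M.act_def ev_gen[OF L_W])
    show "g (M.scal c m) = scT c (g m)" if "m \<in> carrier E.M" for c m
      using smult[of "fscal c" m] that by (simp add: M.scal_def ev_fscal)
  qed
qed

lemma vec_zero: "vec (\<lambda>_. 0) = \<zero>\<^bsub>V\<^esub>"
  using vec_linear(2)[of 0 "\<lambda>_. 0"] V.scal_linear(6)[OF vec_closed, of "\<lambda>_. 0"] by simp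

proposition M_irreducible: "irreducible_module (u_alg L_alg) (M_mod V)"
proof -
  obtain g where add: "\<And>m n. m \<in> carrier E.M \<Longrightarrow> n \<in> carrier E.M \<Longrightarrow> g (m \<oplus>\<^bsub>E.M\<^esub> n) = g m + g n"
    and gt: "\<And>v. v \<in> carrier V \<Longrightarrow> g (t v) = iota v"
    and Sym: "\<And>m. m \<in> carrier E.M \<Longrightarrow> g m \<in> Sym l"
    and act: "\<And>D m. D \<in> L_carrier \<Longrightarrow> m \<in> carrier E.M \<Longrightarrow> g (M.act D m) = rho l D (g m)"
    and scal: "\<And>c m. m \<in> carrier E.M \<Longrightarrow> g (M.scal c m) = scT c (g m)"
    using comparison_map by blast
  have g0: "g \<zero>\<^bsub>E.M\<^esub> = 0"
    using add[of "\<zero>\<^bsub>E.M\<^esub>" "\<zero>\<^bsub>E.M\<^esub>"] by (metis E.M.M.zero_closed E.M.M.l_zero add_cancel_right_right)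
  have pow: "g ((M.act D ^^ n) m) = (rho l D ^^ n) (g m)" if "D \<in> L_carrier" "m \<in> carrier E.M" for D n m
    using that by (induction n) (simp_all add: act act_funpow)
  have gG: "g (G a b v) = XY l a b (iota v)" if "v \<in> carrier V" for a b v
    unfolding G_def XY_def using that by (simp add: pow act_funpow XX_L YY_L gt)
  have gsum: "g (\<Oplus>\<^bsub>E.M\<^esub>q\<in>A. f q) = (\<Sum>q\<in>A. g (f q))"
    if "finite A" "\<And>q. q \<in> A \<Longrightarrow> f q \<in> carrier E.M" for A and f :: "nat \<times> nat \<Rightarrow> _"
    using that
  proof (induction rule: finite_induct)
    case (insert q A)
    hence "f \<in> A \<rightarrow> carrier E.M" by auto
    thus ?case using insert by (simp add: add E.M.M.finsum_closed)
  qed (simp add: g0)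
  \<comment> \<open>An element of the kernel is written in the spanning family; independence of the
    images makes every coefficient vector zero.\<close>
  have inj: "m = \<zero>\<^bsub>E.M\<^esub>" if m: "m \<in> carrier E.M" "g m = 0" for m
  proof -
    obtain n where "m \<in> span n" using span_carrier[OF m(1)] .
    then obtain w where w: "\<And>q. w q \<in> carrier V" "m = (\<Oplus>\<^bsub>E.M\<^esub>q\<in>grid CHAR('a). G (fst q) (snd q) (w q))"
      using span_finsum by blast
    have "g m = (\<Sum>q\<in>grid CHAR('a). XY l (fst q) (snd q) (iota (w q)))"
      unfolding w(2) using w(1) by (subst gsum) (auto simp: gG)
    hence "(\<Sum>(a, b)\<in>grid CHAR('a). XY l a b (tp (coords (w (a, b))))) = 0"
      using m(2) by (simp add: iota_def case_prod_unfold)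
    hence "coords (w (a, b)) k = 0" if "a < CHAR('a)" "b < CHAR('a)" for a b k
      by (rule XY_tp_independent[where c = "\<lambda>a b. coords (w (a, b))", OF _ that])
    hence "coords (w q) = (\<lambda>_. 0)" if "q \<in> grid (CHAR('a))" for q using that by (auto simp: fun_eq_iff)
    hence "w q = \<zero>\<^bsub>V\<^esub>" if "q \<in> grid (CHAR('a))" for q
      using coords(1)[OF w(1), of q] that by (simp add: vec_zero)
    hence "m = (\<Oplus>\<^bsub>E.M\<^esub>q\<in>grid CHAR('a). \<zero>\<^bsub>E.M\<^esub>)"
      unfolding w(2) by (intro E.M.M.finsum_cong') (auto simp: G_zero)
    thus ?thesis by simp
  qed
  have eqI: "m = n" if "m \<in> carrier E.M" "n \<in> carrier E.M" "g m = g n" for m n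
  proof -
    have "M.scal (- 1) n = \<ominus>\<^bsub>E.M\<^esub> n" by (rule M.scal_minus[OF that(2)])
    hence "g (m \<ominus>\<^bsub>E.M\<^esub> n) = g m + scT (- 1) (g n)"
      using that add[of m "\<ominus>\<^bsub>E.M\<^esub> n"] scal[of n "- 1"] by (simp add: a_minus_def)
    also have "\<dots> = scT (1 + - 1) (g n)" unfolding that(3) scT_left by simp
    finally have "m \<ominus>\<^bsub>E.M\<^esub> n = \<zero>\<^bsub>E.M\<^esub>" using that by (intro inj) simp_all
    moreover have "m = (m \<ominus>\<^bsub>E.M\<^esub> n) \<oplus>\<^bsub>E.M\<^esub> n"
      using that by (simp add: a_minus_def E.M.M.a_assoc E.M.M.l_neg)
    ultimately show ?thesis using that(2) by simp
  qed
  have "N = carrier E.M" if N: "submodule N (u_alg L_alg) E.M" and N0: "N \<noteq> {\<zero>\<^bsub>E.M\<^esub>}" for N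
  proof (rule E.submodule_eq_carrier[OF N])
    interpret N: submodule N "u_alg L_alg" E.M by (rule N)
    have Nc: "m \<in> carrier E.M" if "m \<in> N" for m using N.subset that by auto
    obtain m where m: "m \<in> N" "m \<noteq> \<zero>\<^bsub>E.M\<^esub>" using N0 N.one_closed by auto
    fix v assume "v \<in> carrier VI"
    hence v: "v \<in> carrier V" by simp
    \<comment> \<open>The image of N contains \<open>iota v\<close>, the image of
      \<open>t v\<close>; by injectivity \<open>t v\<close> itself lies in N, and these vectors
      generate the module.\<close>
    have "tp (coords v) \<in> g ` N"
    proof (rule symmetric_forms_irreducible[OF l])
      show "g ` N \<subseteq> Sym l" using Sym Nc by blast
      show "g m \<in> g ` N" using m by blast
      show "g m \<noteq> 0" using inj[OF Nc[OF m(1)]] m(2) by blast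
      show "coords v k = 0" if "l < k" for k using coords(2)[OF v] that by (simp add: bounded_def)
    next
      fix s s' assume "s \<in> g ` N" "s' \<in> g ` N"
      then obtain n n' where n: "s = g n" "s' = g n'" "n \<in> N" "n' \<in> N" by blast
      have "n \<oplus>\<^bsub>E.M\<^esub> n' \<in> N" using N.m_closed[OF n(3,4)] by simp
      thus "s + s' \<in> g ` N" unfolding n(1,2) add[OF Nc[OF n(3)] Nc[OF n(4)], symmetric] by blast
    next
      fix r s assume "s \<in> g ` N"
      then obtain n where n: "s = g n" "n \<in> N" by blast
      have "M.scal r n \<in> N" unfolding M.scal_def using n(2) by (intro N.smult_closed L.uh.hom_closed) auto
      thus "scT r s \<in> g ` N" unfolding n(1) scal[OF Nc[OF n(2)], symmetric] by blast
    next
      fix D :: "'a vfield" and s assume D: "D \<in> L_carrier" and "s \<in> g ` N"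
      then obtain n where n: "s = g n" "n \<in> N" by blast
      have "M.act D n \<in> N" unfolding M.act_def using n(2) D by (intro N.smult_closed L.uh.hom_closed) auto
      thus "rho l D s \<in> g ` N" unfolding n(1) act[OF D Nc[OF n(2)], symmetric] by blast
    qed
    then obtain n where n: "tp (coords v) = g n" "n \<in> N" by (rule imageE)
    have "g n = g (t v)" unfolding gt[OF v] iota_def n(1) ..
    hence "n = t v" by (rule eqI[OF Nc[OF n(2)] t_closed[OF v]])
    thus "E.tau \<one>\<^bsub>u_alg L_alg\<^esub> v \<in> N" using n(2) by (simp add: t_def)
  qed
  moreover have "carrier E.M \<noteq> {\<zero>\<^bsub>E.M\<^esub>}"
  proof
    assume "carrier E.M = {\<zero>\<^bsub>E.M\<^esub>}"
    hence "t v0 = \<zero>\<^bsub>E.M\<^esub>" using t_closed[OF v0(1)] by auto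
    hence "tp (coords v0) = 0" using gt[OF v0(1)] g0 by (simp add: iota_def)
    hence "coords v0 k = 0" for k
    proof -
      have "coeff2 (tp (coords v0) k) (CHAR('a) - 1) (CHAR('a) - 1) = 0"
        using \<open>tp (coords v0) = 0\<close> by simp
      thus ?thesis using p0 by (simp add: tp_def coeff2_monom2)
    qed
    hence "coords v0 = (\<lambda>_. 0)" by auto
    hence "v0 = \<zero>\<^bsub>V\<^esub>"
      using coords(1)[OF v0(1)] by (simp add: vec_zero)
    thus False using v0(2) by simp
  qed
  ultimately show ?thesis
    unfolding irreducible_module_def M_mod_eq using E.M_left_module by blast
qed

end

theorem theorem5p3:
  fixes p lam :: nat
    and V :: "('a::alg_closed_field, 'a vfield, 'v) restricted_module"
  assumes "CHAR('a) = p" and "p > 3"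
    and "lam \<in> {2..p-1}"
    and "is_V lam V"
  shows "irreducible_module (u_alg L_alg) (M_mod V)"
proof -
  interpret weight_module "TYPE('a)" lam V
    by unfold_locales (use assms in auto)
  show ?thesis by (rule M_irreducible)
qed

end
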